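(* Let $(M^7,\omega)$ be a $G_2$-manifold with closed fundamental form, $d\omega=0$, and induced metric $g$. Then the Ricci tensor $\tilde\rho$ of the canonical connection $\tilde\nabla$ is related to the Riemannian Ricci tensor $\rho$ of $g$ by $$\tilde\rho=\frac{2}{3}\rho.$$
   Context: A $G_2$-structure on a $7$-manifold $M$ is a differential three-form $\omega$ (the fundamental form) such that around every point there are local frames $e_1,\dots,e_7$ of the cotangent bundle with $\omega=e_{124}+e_{235}+e_{346}+e_{457}+e_{561}+e_{672}+e_{713}$, where $e_{ijk}=e_i\wedge e_j\wedge e_k$; the pair $(M,\omega)$ is a $G_2$-manifold. Declaring these frames orthonormal defines the induced metric $g$, with Levi-Civita connection $\nabla^g$. Repeated indices are summed and components are with respect to an orthonormal frame. The codifferential is $\delta\omega_{ij}=-\nabla^g_k\omega_{kij}$. The canonical connection $\tilde\nabla$ of a closed $G_2$-structure is defined by $$g(\tilde\nabla_XY,Z)=g(\nabla^g_XY,Z)-\tfrac16\,\delta\omega(X,e_i)\,\omega(e_i,Y,Z)$$ for vector fields $X,Y,Z$. Curvature: $R_{X,Y}=[\nabla^g_X,\nabla^g_Y]-\nabla^g_{[X,Y]}$, $R_{sijk}=g(R(e_s,e_i)e_j,e_k)$, $\rho_{ij}=R_{sijs}$; likewise $\tilde R$ is the curvature of $\tilde\nabla$, with the same conventions, and $\tilde\rho_{ij}=\tilde R_{sijs}$. *)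

theory Defs
  imports "HOL-Analysis.Analysis"
begin

section \<open>Smooth 7-manifolds\<close>

definition partial_deriv :: "'n \<Rightarrow> (real^'n \<Rightarrow> 'b::real_normed_vector) \<Rightarrow> real^'n \<Rightarrow> 'b" where
  "partial_deriv i f x = frechet_derivative f (at x) (axis i 1)"

text \<open>Both definitions below are meant for open \<open>S\<close> only.\<close>

primrec Ck_on :: "nat \<Rightarrow> (real^'n) set \<Rightarrow> (real^'n \<Rightarrow> 'b::real_normed_vector) \<Rightarrow> bool" where
  "Ck_on 0 S f \<longleftrightarrow> continuous_on S f"
| "Ck_on (Suc k) S f \<longleftrightarrow>
     (\<forall>x\<in>S. f differentiable (at x)) \<and> (\<forall>i. Ck_on k S (partial_deriv i f))"

definition Cinf_on :: "(real^'n) set \<Rightarrow> (real^'n \<Rightarrow> 'b::real_normed_vector) \<Rightarrow> bool" where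
  "Cinf_on S f \<longleftrightarrow> (\<forall>k. Ck_on k S f)"

text \<open>The manifold is the whole type \<open>'a\<close>; its topology is that of the type, which the
  theorem takes to be Hausdorff and second countable.  A chart is a pair (domain, coordinate map).\<close>

type_synonym 'a chart = "'a set \<times> ('a \<Rightarrow> real^7)"

definition is_chart :: "('a::topological_space) chart \<Rightarrow> bool" where
  "is_chart c \<longleftrightarrow> (case c of (U, \<phi>) \<Rightarrow>
     open U \<and> open (\<phi> ` U) \<and> homeomorphism U (\<phi> ` U) \<phi> (inv_into U \<phi>))"

definition smooth_atlas :: "('a::topological_space) chart set \<Rightarrow> bool" where
  "smooth_atlas A \<longleftrightarrow>
     (\<forall>c\<in>A. is_chart c) \<and>
     (\<forall>p. \<exists>(U, \<phi>)\<in>A. p \<in> U) \<and>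
     (\<forall>(U, \<phi>)\<in>A. \<forall>(V, \<psi>)\<in>A. Cinf_on (\<phi> ` (U \<inter> V)) (\<psi> \<circ> inv_into U \<phi>))"

definition smooth_fun_on ::
    "('a::topological_space) chart set \<Rightarrow> 'a set \<Rightarrow> ('a \<Rightarrow> real) \<Rightarrow> bool" where
  "smooth_fun_on A W f \<longleftrightarrow>
     open W \<and> (\<forall>(U, \<phi>)\<in>A. Cinf_on (\<phi> ` (U \<inter> W)) (f \<circ> inv_into U \<phi>))"

definition smooth_at :: "('a::topological_space) chart set \<Rightarrow> 'a \<Rightarrow> ('a \<Rightarrow> real) \<Rightarrow> bool" where
  "smooth_at A p f \<longleftrightarrow> (\<exists>W. p \<in> W \<and> smooth_fun_on A W f)"

section \<open>Tangent vectors and vector fields\<close>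

text \<open>A tangent vector at \<open>p\<close> is a directional derivative: for some chart \<open>\<phi>\<close> around \<open>p\<close> and
  some \<open>w\<close>, it is the operator \<open>\<Sum>i. w\<^sub>i \<partial>/\<partial>\<phi>\<^sub>i\<close> at \<open>p\<close>.  It acts on functions that are smooth near
  \<open>p\<close>, and by convention gives 0 on all others, so that equality of tangent vectors is equality
  of functions.\<close>

type_synonym 'a tangent = "('a \<Rightarrow> real) \<Rightarrow> real"
type_synonym 'a vfield = "'a \<Rightarrow> 'a tangent"

definition coord_vector ::
    "('a::topological_space) chart set \<Rightarrow> 'a chart \<Rightarrow> 'a \<Rightarrow> real^7 \<Rightarrow> 'a tangent" where
  "coord_vector A c p w = (case c of (U, \<phi>) \<Rightarrow>
     (\<lambda>f. if smooth_at A p f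
          then frechet_derivative (f \<circ> inv_into U \<phi>) (at (\<phi> p)) w else 0))"

definition tangent_space :: "('a::topological_space) chart set \<Rightarrow> 'a \<Rightarrow> 'a tangent set" where
  "tangent_space A p = {coord_vector A c p w | c w. c \<in> A \<and> p \<in> fst c}"

definition vector_field_on ::
    "('a::topological_space) chart set \<Rightarrow> 'a set \<Rightarrow> 'a vfield \<Rightarrow> bool" where
  "vector_field_on A U X \<longleftrightarrow>
     open U \<and> (\<forall>p\<in>U. X p \<in> tangent_space A p) \<and>
     (\<forall>V f. V \<subseteq> U \<and> smooth_fun_on A V f \<longrightarrow> smooth_fun_on A V (\<lambda>p. X p f))"

definition vf_add :: "'a vfield \<Rightarrow> 'a vfield \<Rightarrow> 'a vfield" where
  "vf_add X Y = (\<lambda>p f. X p f + Y p f)"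

definition vf_diff :: "'a vfield \<Rightarrow> 'a vfield \<Rightarrow> 'a vfield" where
  "vf_diff X Y = (\<lambda>p f. X p f - Y p f)"

definition vf_scale :: "('a \<Rightarrow> real) \<Rightarrow> 'a vfield \<Rightarrow> 'a vfield" where
  "vf_scale h X = (\<lambda>p f. h p * X p f)"

definition lie_bracket ::
    "('a::topological_space) chart set \<Rightarrow> 'a vfield \<Rightarrow> 'a vfield \<Rightarrow> 'a vfield" where
  "lie_bracket A X Y = (\<lambda>p f.
     if smooth_at A p f then X p (\<lambda>q. Y q f) - Y p (\<lambda>q. X q f) else 0)"

section \<open>Forms and metrics\<close>

text \<open>A covariant tensor at \<open>p\<close> is a multilinear function on the tangent space at \<open>p\<close>; its values
  on arguments outside the tangent space are irrelevant.\<close>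

definition linear_at ::
    "('a::topological_space) chart set \<Rightarrow> 'a \<Rightarrow> ('a tangent \<Rightarrow> real) \<Rightarrow> bool" where
  "linear_at A p \<alpha> \<longleftrightarrow> (\<forall>u\<in>tangent_space A p. \<forall>v\<in>tangent_space A p. \<forall>a b.
     \<alpha> (\<lambda>f. a * u f + b * v f) = a * \<alpha> u + b * \<alpha> v)"

definition one_form_on ::
    "('a::topological_space) chart set \<Rightarrow> 'a set \<Rightarrow> ('a \<Rightarrow> 'a tangent \<Rightarrow> real) \<Rightarrow> bool" where
  "one_form_on A U \<alpha> \<longleftrightarrow>
     open U \<and> (\<forall>p\<in>U. linear_at A p (\<alpha> p)) \<and>
     (\<forall>V X. V \<subseteq> U \<and> vector_field_on A V X \<longrightarrow> smooth_fun_on A V (\<lambda>p. \<alpha> p (X p)))"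

definition riemannian_metric ::
    "('a::topological_space) chart set \<Rightarrow> ('a \<Rightarrow> 'a tangent \<Rightarrow> 'a tangent \<Rightarrow> real) \<Rightarrow> bool" where
  "riemannian_metric A g \<longleftrightarrow>
     (\<forall>p. \<forall>u\<in>tangent_space A p. linear_at A p (g p u)) \<and>
     (\<forall>p. \<forall>u\<in>tangent_space A p. \<forall>v\<in>tangent_space A p. g p u v = g p v u) \<and>
     (\<forall>p. \<forall>u\<in>tangent_space A p. u \<noteq> (\<lambda>f. 0) \<longrightarrow> g p u u > 0) \<and>
     (\<forall>U X Y. vector_field_on A U X \<and> vector_field_on A U Y \<longrightarrow>
        smooth_fun_on A U (\<lambda>p. g p (X p) (Y p)))"

type_synonym 'a form3 = "'a \<Rightarrow> 'a tangent \<Rightarrow> 'a tangent \<Rightarrow> 'a tangent \<Rightarrow> real"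

definition three_form :: "('a::topological_space) chart set \<Rightarrow> 'a form3 \<Rightarrow> bool" where
  "three_form A \<omega> \<longleftrightarrow>
     (\<forall>p. \<forall>u\<in>tangent_space A p. \<forall>v\<in>tangent_space A p.
        linear_at A p (\<lambda>w. \<omega> p w u v) \<and> linear_at A p (\<lambda>w. \<omega> p u w v) \<and>
        linear_at A p (\<lambda>w. \<omega> p u v w)) \<and>
     (\<forall>p. \<forall>u\<in>tangent_space A p. \<forall>v\<in>tangent_space A p.
        \<omega> p u u v = 0 \<and> \<omega> p u v u = 0 \<and> \<omega> p v u u = 0) \<and>
     (\<forall>U X Y Z. vector_field_on A U X \<and> vector_field_on A U Y \<and> vector_field_on A U Z \<longrightarrow>
        smooth_fun_on A U (\<lambda>p. \<omega> p (X p) (Y p) (Z p)))"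

text \<open>The invariant formula
  \<open>d\<omega>(X\<^sub>0,\<dots>,X\<^sub>3) = \<Sum>\<^sub>i (-1)\<^sup>i X\<^sub>i(\<omega>(\<dots>)) + \<Sum>\<^sub>i\<^sub><\<^sub>j (-1)\<^sup>i\<^sup>+\<^sup>j \<omega>([X\<^sub>i,X\<^sub>j],\<dots>)\<close>.\<close>

definition ext_deriv3 ::
    "('a::topological_space) chart set \<Rightarrow> 'a form3 \<Rightarrow>
     'a vfield \<Rightarrow> 'a vfield \<Rightarrow> 'a vfield \<Rightarrow> 'a vfield \<Rightarrow> 'a \<Rightarrow> real" where
  "ext_deriv3 A \<omega> W X Y Z p =
     W p (\<lambda>q. \<omega> q (X q) (Y q) (Z q)) - X p (\<lambda>q. \<omega> q (W q) (Y q) (Z q))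
   + Y p (\<lambda>q. \<omega> q (W q) (X q) (Z q)) - Z p (\<lambda>q. \<omega> q (W q) (X q) (Y q))
   - \<omega> p (lie_bracket A W X p) (Y p) (Z p) + \<omega> p (lie_bracket A W Y p) (X p) (Z p)
   - \<omega> p (lie_bracket A W Z p) (X p) (Y p) - \<omega> p (lie_bracket A X Y p) (W p) (Z p)
   + \<omega> p (lie_bracket A X Z p) (W p) (Y p) - \<omega> p (lie_bracket A Y Z p) (W p) (X p)"

definition closed_form3 :: "('a::topological_space) chart set \<Rightarrow> 'a form3 \<Rightarrow> bool" where
  "closed_form3 A \<omega> \<longleftrightarrow>
     (\<forall>U W X Y Z. vector_field_on A U W \<and> vector_field_on A U X \<and>
        vector_field_on A U Y \<and> vector_field_on A U Z \<longrightarrow>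
        (\<forall>p\<in>U. ext_deriv3 A \<omega> W X Y Z p = 0))"

section \<open>G2-structures\<close>

definition wedge3 ::
    "('v \<Rightarrow> real) \<Rightarrow> ('v \<Rightarrow> real) \<Rightarrow> ('v \<Rightarrow> real) \<Rightarrow> 'v \<Rightarrow> 'v \<Rightarrow> 'v \<Rightarrow> real" where
  "wedge3 \<alpha> \<beta> \<gamma> u v w =
     det (vector [vector [\<alpha> u, \<alpha> v, \<alpha> w],
                  vector [\<beta> u, \<beta> v, \<beta> w],
                  vector [\<gamma> u, \<gamma> v, \<gamma> w]] :: real^3^3)"

text \<open>Indices live in the type \<open>7\<close>, where \<open>1, \<dots>, 7\<close> are the seven distinct elements (and
  \<open>7 = 0\<close>).\<close>

definition g2_model :: "(7 \<Rightarrow> 'v \<Rightarrow> real) \<Rightarrow> 'v \<Rightarrow> 'v \<Rightarrow> 'v \<Rightarrow> real" where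
  "g2_model \<theta> u v w =
     wedge3 (\<theta> 1) (\<theta> 2) (\<theta> 4) u v w + wedge3 (\<theta> 2) (\<theta> 3) (\<theta> 5) u v w
   + wedge3 (\<theta> 3) (\<theta> 4) (\<theta> 6) u v w + wedge3 (\<theta> 4) (\<theta> 5) (\<theta> 7) u v w
   + wedge3 (\<theta> 5) (\<theta> 6) (\<theta> 1) u v w + wedge3 (\<theta> 6) (\<theta> 7) (\<theta> 2) u v w
   + wedge3 (\<theta> 7) (\<theta> 1) (\<theta> 3) u v w"

definition local_coframe ::
    "('a::topological_space) chart set \<Rightarrow> 'a set \<Rightarrow> (7 \<Rightarrow> 'a \<Rightarrow> 'a tangent \<Rightarrow> real) \<Rightarrow> bool" where
  "local_coframe A U \<theta> \<longleftrightarrow>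
     (\<forall>i. one_form_on A U (\<theta> i)) \<and>
     (\<forall>p\<in>U. \<forall>a. (\<forall>v\<in>tangent_space A p. (\<Sum>i\<in>UNIV. a i * \<theta> i p v) = 0) \<longrightarrow> (\<forall>i. a i = 0))"

definition adapted_coframe ::
    "('a::topological_space) chart set \<Rightarrow> 'a form3 \<Rightarrow> 'a set \<Rightarrow>
     (7 \<Rightarrow> 'a \<Rightarrow> 'a tangent \<Rightarrow> real) \<Rightarrow> bool" where
  "adapted_coframe A \<omega> U \<theta> \<longleftrightarrow>
     local_coframe A U \<theta> \<and>
     (\<forall>p\<in>U. \<forall>u\<in>tangent_space A p. \<forall>v\<in>tangent_space A p. \<forall>w\<in>tangent_space A p.
        \<omega> p u v w = g2_model (\<lambda>i. \<theta> i p) u v w)"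

definition g2_structure :: "('a::topological_space) chart set \<Rightarrow> 'a form3 \<Rightarrow> bool" where
  "g2_structure A \<omega> \<longleftrightarrow>
     three_form A \<omega> \<and> (\<forall>p. \<exists>U \<theta>. p \<in> U \<and> adapted_coframe A \<omega> U \<theta>)"

definition induced_metric ::
    "('a::topological_space) chart set \<Rightarrow> 'a form3 \<Rightarrow>
     ('a \<Rightarrow> 'a tangent \<Rightarrow> 'a tangent \<Rightarrow> real) \<Rightarrow> bool" where
  "induced_metric A \<omega> g \<longleftrightarrow>
     riemannian_metric A g \<and>
     (\<forall>U \<theta>. adapted_coframe A \<omega> U \<theta> \<longrightarrow>
        (\<forall>p\<in>U. \<forall>u\<in>tangent_space A p. \<forall>v\<in>tangent_space A p.
           g p u v = (\<Sum>i\<in>UNIV. \<theta> i p u * \<theta> i p v)))"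

definition orthonormal_frame ::
    "('a::topological_space) chart set \<Rightarrow> ('a \<Rightarrow> 'a tangent \<Rightarrow> 'a tangent \<Rightarrow> real) \<Rightarrow>
     'a set \<Rightarrow> (7 \<Rightarrow> 'a vfield) \<Rightarrow> bool" where
  "orthonormal_frame A g U e \<longleftrightarrow>
     (\<forall>i. vector_field_on A U (e i)) \<and>
     (\<forall>p\<in>U. \<forall>i j. g p (e i p) (e j p) = (if i = j then 1 else 0))"

section \<open>Connections and curvature\<close>

text \<open>A connection acts on locally defined vector fields.  Since vector fields are represented by
  total functions, its compatibility with restriction to open sets is the first clause.\<close>

definition affine_connection ::
    "('a::topological_space) chart set \<Rightarrow> ('a vfield \<Rightarrow> 'a vfield \<Rightarrow> 'a vfield) \<Rightarrow> bool" where
  "affine_connection A D \<longleftrightarrow>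
     (\<forall>U X X' Y Y'. vector_field_on A U X \<and> vector_field_on A U X' \<and>
        vector_field_on A U Y \<and> vector_field_on A U Y' \<and>
        (\<forall>p\<in>U. X p = X' p \<and> Y p = Y' p) \<longrightarrow> (\<forall>p\<in>U. D X Y p = D X' Y' p)) \<and>
     (\<forall>U X Y. vector_field_on A U X \<and> vector_field_on A U Y \<longrightarrow> vector_field_on A U (D X Y)) \<and>
     (\<forall>U X X' Y. vector_field_on A U X \<and> vector_field_on A U X' \<and> vector_field_on A U Y \<longrightarrow>
        (\<forall>p\<in>U. D (vf_add X X') Y p = vf_add (D X Y) (D X' Y) p)) \<and>
     (\<forall>U X Y Y'. vector_field_on A U X \<and> vector_field_on A U Y \<and> vector_field_on A U Y' \<longrightarrow>
        (\<forall>p\<in>U. D X (vf_add Y Y') p = vf_add (D X Y) (D X Y') p)) \<and>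
     (\<forall>U X Y h. vector_field_on A U X \<and> vector_field_on A U Y \<and> smooth_fun_on A U h \<longrightarrow>
        (\<forall>p\<in>U. D (vf_scale h X) Y p = vf_scale h (D X Y) p \<and>
                D X (vf_scale h Y) p =
                  vf_add (vf_scale (\<lambda>q. X q h) Y) (vf_scale h (D X Y)) p))"

definition levi_civita ::
    "('a::topological_space) chart set \<Rightarrow> ('a \<Rightarrow> 'a tangent \<Rightarrow> 'a tangent \<Rightarrow> real) \<Rightarrow>
     ('a vfield \<Rightarrow> 'a vfield \<Rightarrow> 'a vfield) \<Rightarrow> bool" where
  "levi_civita A g D \<longleftrightarrow>
     affine_connection A D \<and>
     (\<forall>U X Y Z. vector_field_on A U X \<and> vector_field_on A U Y \<and> vector_field_on A U Z \<longrightarrow>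
        (\<forall>p\<in>U. X p (\<lambda>q. g q (Y q) (Z q)) =
                g p (D X Y p) (Z p) + g p (Y p) (D X Z p))) \<and>
     (\<forall>U X Y. vector_field_on A U X \<and> vector_field_on A U Y \<longrightarrow>
        (\<forall>p\<in>U. vf_diff (D X Y) (D Y X) p = lie_bracket A X Y p))"

definition cov_deriv3 ::
    "('a vfield \<Rightarrow> 'a vfield \<Rightarrow> 'a vfield) \<Rightarrow> 'a form3 \<Rightarrow>
     'a vfield \<Rightarrow> 'a vfield \<Rightarrow> 'a vfield \<Rightarrow> 'a vfield \<Rightarrow> 'a \<Rightarrow> real" where
  "cov_deriv3 D \<omega> W X Y Z p =
     W p (\<lambda>q. \<omega> q (X q) (Y q) (Z q))
     - \<omega> p (D W X p) (Y p) (Z p) - \<omega> p (X p) (D W Y p) (Z p) - \<omega> p (X p) (Y p) (D W Z p)"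

text \<open>Here \<open>D\<close> is the Levi-Civita connection and \<open>e\<close> an orthonormal frame, on which the value does
  not depend.\<close>

definition codiff3 ::
    "('a vfield \<Rightarrow> 'a vfield \<Rightarrow> 'a vfield) \<Rightarrow> (7 \<Rightarrow> 'a vfield) \<Rightarrow> 'a form3 \<Rightarrow>
     'a vfield \<Rightarrow> 'a vfield \<Rightarrow> 'a \<Rightarrow> real" where
  "codiff3 D e \<omega> X Y p = - (\<Sum>k\<in>UNIV. cov_deriv3 D \<omega> (e k) (e k) X Y p)"

definition canonical_connection ::
    "('a::topological_space) chart set \<Rightarrow> 'a form3 \<Rightarrow>
     ('a \<Rightarrow> 'a tangent \<Rightarrow> 'a tangent \<Rightarrow> real) \<Rightarrow> ('a vfield \<Rightarrow> 'a vfield \<Rightarrow> 'a vfield) \<Rightarrow>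
     ('a vfield \<Rightarrow> 'a vfield \<Rightarrow> 'a vfield) \<Rightarrow> bool" where
  "canonical_connection A \<omega> g D D' \<longleftrightarrow>
     affine_connection A D' \<and>
     (\<forall>U e X Y Z. orthonormal_frame A g U e \<and> vector_field_on A U X \<and>
        vector_field_on A U Y \<and> vector_field_on A U Z \<longrightarrow>
        (\<forall>p\<in>U. g p (D' X Y p) (Z p) =
           g p (D X Y p) (Z p)
           - 1/6 * (\<Sum>i\<in>UNIV. codiff3 D e \<omega> X (e i) p * \<omega> p (e i p) (Y p) (Z p))))"

definition curvature ::
    "('a::topological_space) chart set \<Rightarrow> ('a vfield \<Rightarrow> 'a vfield \<Rightarrow> 'a vfield) \<Rightarrow>
     'a vfield \<Rightarrow> 'a vfield \<Rightarrow> 'a vfield \<Rightarrow> 'a vfield" where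
  "curvature A D X Y Z =
     vf_diff (vf_diff (D X (D Y Z)) (D Y (D X Z))) (D (lie_bracket A X Y) Z)"

definition curv_comp ::
    "('a::topological_space) chart set \<Rightarrow> ('a \<Rightarrow> 'a tangent \<Rightarrow> 'a tangent \<Rightarrow> real) \<Rightarrow>
     ('a vfield \<Rightarrow> 'a vfield \<Rightarrow> 'a vfield) \<Rightarrow> (7 \<Rightarrow> 'a vfield) \<Rightarrow>
     7 \<Rightarrow> 7 \<Rightarrow> 7 \<Rightarrow> 7 \<Rightarrow> 'a \<Rightarrow> real" where
  "curv_comp A g D e s i j k p = g p (curvature A D (e s) (e i) (e j) p) (e k p)"

definition ricci_comp ::
    "('a::topological_space) chart set \<Rightarrow> ('a \<Rightarrow> 'a tangent \<Rightarrow> 'a tangent \<Rightarrow> real) \<Rightarrow>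
     ('a vfield \<Rightarrow> 'a vfield \<Rightarrow> 'a vfield) \<Rightarrow> (7 \<Rightarrow> 'a vfield) \<Rightarrow> 7 \<Rightarrow> 7 \<Rightarrow> 'a \<Rightarrow> real" where
  "ricci_comp A g D e i j p = (\<Sum>s\<in>UNIV. curv_comp A g D e s i j s p)"

end

theory Submission
  imports Defs
begin

text \<open>
  In an orthonormal frame the components \<open>w\<close> of the fundamental form satisfy the cross product
  identity \<open>w\<^sub>i\<^sub>j\<^sub>m w\<^sub>k\<^sub>l\<^sub>m = \<delta>\<^sub>i\<^sub>k \<delta>\<^sub>j\<^sub>l - \<delta>\<^sub>i\<^sub>l \<delta>\<^sub>j\<^sub>k + \<psi>\<^sub>i\<^sub>j\<^sub>k\<^sub>l\<close> with \<open>\<psi>\<close> totally skew, and a skew matrix \<open>B\<close> moves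
  \<open>w\<close> only through \<open>B\<^sub>k\<^sub>l w\<^sub>k\<^sub>l\<^sub>m\<close>.  Since \<open>w\<close> stays in one orthogonal orbit, \<open>d\<omega> = 0\<close> then forces
  \<open>\<nabla>\<^sub>a w\<^sub>b\<^sub>c\<^sub>d = - \<tau>\<^sub>a\<^sub>m \<psi>\<^sub>m\<^sub>b\<^sub>c\<^sub>d / 2\<close> with \<open>\<tau> = \<delta>\<omega>\<close> and \<open>\<tau>\<^sub>k\<^sub>l w\<^sub>k\<^sub>l\<^sub>m = 0\<close>, which says that the canonical
  connection makes \<open>\<omega>\<close> parallel.  Let \<open>T\<close> be its covariant derivative of \<open>\<tau>\<close>, and put
  \<open>S\<^sub>i\<^sub>j = T\<^sub>s\<^sub>i\<^sub>l w\<^sub>l\<^sub>j\<^sub>s\<close>, \<open>K\<^sub>i\<^sub>j = \<tau>\<^sub>l\<^sub>i \<tau>\<^sub>l\<^sub>j\<close>.  Comparing the two curvatures and tracing gives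
  \<open>\<rho> = \<rho>' + S/6 + K/9 - (tr K) \<delta>/36\<close> for the canonical Ricci tensor \<open>\<rho>'\<close>.  The canonical curvature is
  \<open>\<^bold>g\<^sub>2\<close>-valued, so contracting the same comparison with \<open>w\<^sub>j\<^sub>k\<^sub>m w\<^sub>i\<^sub>n\<^sub>m\<close> and using the first Bianchi
  identity of \<open>R\<close> gives \<open>2 \<rho> = S + 2 K/3 - (tr K) \<delta>/6\<close>.  Hence \<open>\<rho> - \<rho>' = \<rho>/3\<close>.
\<close>

section \<open>Tensor algebra of the fundamental form\<close>

definition kd :: "'n \<Rightarrow> 'n \<Rightarrow> real" where "kd i j = (if i = j then 1 else 0)"

lemma kd_refl [simp]: "kd i i = 1" by (simp add: kd_def)

lemma kd_commute: "kd i j = kd j i" by (auto simp: kd_def)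

lemma sum_kd [simp]:
  fixes i :: "'n::finite"
  shows "(\<Sum>j\<in>UNIV. kd i j * f j) = f i" "(\<Sum>j\<in>UNIV. kd j i * f j) = f i"
    "(\<Sum>j\<in>UNIV. f j * kd i j) = f i" "(\<Sum>j\<in>UNIV. f j * kd j i) = f i"
    "(\<Sum>j\<in>UNIV. f j * (kd i j * h j)) = f i * h i"
    "(\<Sum>j\<in>UNIV. f j * (kd j i * h j)) = f i * h i"
    "(\<Sum>j\<in>UNIV. f j * (h j * kd i j)) = f i * h i"
    "(\<Sum>j\<in>UNIV. f j * (h j * kd j i)) = f i * h i"
    "(\<Sum>j\<in>UNIV. f j * (h j * (kd i j * k j))) = f i * (h i * k i)"
    "(\<Sum>j\<in>UNIV. f j * (h j * (kd j i * k j))) = f i * (h i * k i)"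
    "(\<Sum>j\<in>UNIV. kd i j) = 1" "(\<Sum>j\<in>UNIV. kd j i) = 1"
  by (simp_all add: kd_def if_distrib[of "\<lambda>x. _ * x"] if_distrib[of "\<lambda>x. x * _"] cong: if_cong)

text \<open>The 4-form \<open>\<psi> = *\<omega>\<close>, up to sign, read off from the contraction of \<open>\<omega>\<close> with itself.\<close>

definition coass :: "('n::finite \<Rightarrow> 'n \<Rightarrow> 'n \<Rightarrow> real) \<Rightarrow> 'n \<Rightarrow> 'n \<Rightarrow> 'n \<Rightarrow> 'n \<Rightarrow> real" where
  "coass w i j k l = (\<Sum>m\<in>UNIV. w i j m * w k l m) - kd i k * kd j l + kd i l * kd j k"

definition act :: "('n::finite \<Rightarrow> 'n \<Rightarrow> real) \<Rightarrow> ('n \<Rightarrow> 'n \<Rightarrow> 'n \<Rightarrow> real) \<Rightarrow> 'n \<Rightarrow> 'n \<Rightarrow> 'n \<Rightarrow> real" where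
  "act B w b c d = (\<Sum>l\<in>UNIV. B b l * w l c d) + (\<Sum>l\<in>UNIV. B c l * w b l d) + (\<Sum>l\<in>UNIV. B d l * w b c l)"

section \<open>Rearranging nested contractions\<close>

lemma sum_pull:
  fixes x :: "'a::finite \<Rightarrow> real" and v :: "'a \<Rightarrow> 'b::finite \<Rightarrow> real"
  shows "(\<Sum>d\<in>UNIV. (\<Sum>l\<in>UNIV. x l * v l d) * z d) = (\<Sum>l\<in>UNIV. x l * (\<Sum>d\<in>UNIV. v l d * z d))"
  by (simp add: sum_distrib_left sum_distrib_right mult.assoc) (rule sum.swap)

lemma sum_pull2:
  fixes x :: "'a::finite \<Rightarrow> real" and v :: "'a \<Rightarrow> 'b::finite \<Rightarrow> 'c::finite \<Rightarrow> real"
  shows "(\<Sum>c\<in>UNIV. \<Sum>d\<in>UNIV. (\<Sum>l\<in>UNIV. x l * v l c d) * z c d)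
       = (\<Sum>l\<in>UNIV. x l * (\<Sum>c\<in>UNIV. \<Sum>d\<in>UNIV. v l c d * z c d))"
  by (simp add: sum_pull, subst sum.swap) (simp add: sum_distrib_left)

lemma sum_pull3:
  fixes x :: "'a::finite \<Rightarrow> real" and v :: "'a \<Rightarrow> 'b::finite \<Rightarrow> 'c::finite \<Rightarrow> 'd::finite \<Rightarrow> real"
  shows "(\<Sum>b\<in>UNIV. \<Sum>c\<in>UNIV. \<Sum>d\<in>UNIV. (\<Sum>l\<in>UNIV. x l * v l b c d) * z b c d)
       = (\<Sum>l\<in>UNIV. x l * (\<Sum>b\<in>UNIV. \<Sum>c\<in>UNIV. \<Sum>d\<in>UNIV. v l b c d * z b c d))"
  by (simp add: sum_pull2, subst sum.swap) (simp add: sum_distrib_left)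

lemma sum_cyc3:
  fixes f :: "'n::finite \<Rightarrow> 'n \<Rightarrow> 'n \<Rightarrow> real"
  shows "(\<Sum>b\<in>UNIV. \<Sum>c\<in>UNIV. \<Sum>d\<in>UNIV. f c d b) = (\<Sum>b\<in>UNIV. \<Sum>c\<in>UNIV. \<Sum>d\<in>UNIV. f b c d)"
  by (subst sum.swap, subst (2) sum.swap, rule refl)

lemma act_diff: "act (\<lambda>i j. B i j - C i j) w b c d = act B w b c d - act C w b c d"
  by (simp add: act_def left_diff_distrib sum_subtractf)

text \<open>The three laws axiomatise the components of a G2 form in an orthonormal frame. Skewness
  of \<open>coass\<close> in its outer pairs already follows from \<open>w12\<close>, so
  \<open>psi23\<close> supplies exactly the missing transposition that makes it totally skew. The
  laws are checked on the model form and then carried along orthogonal changes of frame.\<close>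

locale g2_tensor =
  fixes w :: "7 \<Rightarrow> 7 \<Rightarrow> 7 \<Rightarrow> real"
  assumes w12: "w i j k = - w j i k"
    and w23: "w i j k = - w i k j"
    and psi23: "coass w i j k l = - coass w i k j l"
begin

section \<open>Contraction identities in dimension seven\<close>

abbreviation psi :: "7 \<Rightarrow> 7 \<Rightarrow> 7 \<Rightarrow> 7 \<Rightarrow> real" where "psi \<equiv> coass w"

lemma w_cyc: "w i j k = w j k i"
  using w12[of i j k] w23[of j i k] by simp

lemma psi12: "psi i j k l = - psi j i k l"
  by (simp add: coass_def w12[of i j] sum_negf)

lemma psi34: "psi i j k l = - psi i j l k"
  by (simp add: coass_def w12[of k l] sum_negf)

lemma psi_pair: "psi i j k l = psi k l i j"
  by (simp add: coass_def kd_commute mult.commute)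

lemma psi_refl [simp]: "psi i i k l = 0" "psi i j j l = 0" "psi i j k k = 0" "psi i j i l = 0"
    "psi i j k j = 0"
  using psi12[of i i k l] psi23[of i j j l] psi34[of i j k k] psi23[of i j i l] psi12[of i i j l]
    psi23[of i j k j] psi34[of i k j j] by auto

lemma ww: "(\<Sum>m\<in>UNIV. w i j m * w k l m) = kd i k * kd j l - kd i l * kd j k + psi i j k l"
  by (simp add: coass_def)

text \<open>The constant is 7 - 1: tracing \<open>ww\<close> leaves only its Kronecker terms,
  because \<open>psi\<close> vanishes on a repeated index.\<close>

lemma ww6: "(\<Sum>j\<in>UNIV. \<Sum>k\<in>UNIV. w a j k * w b j k) = 6 * kd a b"
  by (simp add: ww sum.distrib sum_subtractf kd_commute)

lemma ww6': "(\<Sum>j\<in>UNIV. \<Sum>k\<in>UNIV. w j k a * w j k b) = 6 * kd a b"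
  unfolding ww6[symmetric] w_cyc[of a] w_cyc[of b] by (rule refl)

text \<open>The product term of \<open>coass\<close> contributes 6 by \<open>ww6'\<close>, and each
  of the two Kronecker terms removes 1. Thus the seven-dimensional summand of the 2-forms, spanned
  by contractions of \<open>w\<close> with vectors, is an eigenspace of \<open>psi\<close> with
  eigenvalue 4.\<close>

lemma psi_w: "(\<Sum>k\<in>UNIV. \<Sum>l\<in>UNIV. psi i j k l * w k l m) = 4 * w i j m"
proof -
  have "(\<Sum>k\<in>UNIV. \<Sum>l\<in>UNIV. (\<Sum>n\<in>UNIV. w i j n * w k l n) * w k l m)
      = (\<Sum>k\<in>UNIV. \<Sum>n\<in>UNIV. w i j n * (\<Sum>l\<in>UNIV. w k l n * w k l m))"
    by (simp add: sum_distrib_left sum_distrib_right mult.assoc, subst (2) sum.swap, simp)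
  also have "\<dots> = (\<Sum>n\<in>UNIV. w i j n * (\<Sum>k\<in>UNIV. \<Sum>l\<in>UNIV. w k l n * w k l m))"
    by (subst sum.swap) (simp add: sum_distrib_left)
  also have "\<dots> = 6 * w i j m" by (simp add: ww6')
  finally have "(\<Sum>k\<in>UNIV. \<Sum>l\<in>UNIV. psi i j k l * w k l m)
     = 6 * w i j m - w i j m + w j i m"
    by (simp add: coass_def distrib_right left_diff_distrib sum.distrib sum_subtractf mult.assoc)
  then show ?thesis using w12[of j i m] by simp
qed

text \<open>Expanding the second factor by the definition of \<open>coass\<close> reduces its
  product term to \<open>psi_w\<close> and then to \<open>ww\<close>. The Kronecker terms lower the
  coefficient of \<open>psi m a f b\<close> from 4 to 2.\<close>

lemma psi_psi:
  "(\<Sum>c\<in>UNIV. \<Sum>d\<in>UNIV. psi m a c d * psi f b c d)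
     = 4 * kd m f * kd a b - 4 * kd m b * kd a f + 2 * psi m a f b"
proof -
  have "(\<Sum>c\<in>UNIV. \<Sum>d\<in>UNIV. psi m a c d * (\<Sum>n\<in>UNIV. w f b n * w c d n))
      = (\<Sum>c\<in>UNIV. \<Sum>n\<in>UNIV. w f b n * (\<Sum>d\<in>UNIV. psi m a c d * w c d n))"
    by (simp add: sum_distrib_left mult.left_commute, subst (2) sum.swap, simp)
  also have "\<dots> = (\<Sum>n\<in>UNIV. w f b n * (\<Sum>c\<in>UNIV. \<Sum>d\<in>UNIV. psi m a c d * w c d n))"
    by (subst sum.swap) (simp add: sum_distrib_left)
  also have "\<dots> = 4 * (\<Sum>n\<in>UNIV. w m a n * w f b n)" 
    by (simp only: psi_w) (simp add: sum_distrib_left mult_ac)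
  finally have *: "(\<Sum>c\<in>UNIV. \<Sum>d\<in>UNIV. psi m a c d * (\<Sum>n\<in>UNIV. w f b n * w c d n)) = 4 * (\<Sum>n\<in>UNIV. w m a n * w f b n)" .
  have "(\<Sum>c\<in>UNIV. \<Sum>d\<in>UNIV. psi m a c d * psi f b c d) = 4 * (\<Sum>n\<in>UNIV. w m a n * w f b n)
     - (\<Sum>c\<in>UNIV. \<Sum>d\<in>UNIV. psi m a c d * (kd f c * kd b d))
     + (\<Sum>c\<in>UNIV. \<Sum>d\<in>UNIV. psi m a c d * (kd f d * kd b c))"
    unfolding *[symmetric]
    by (subst (2) coass_def) (simp add: distrib_left right_diff_distrib sum.distrib sum_subtractf)
  also have "(\<Sum>c\<in>UNIV. \<Sum>d\<in>UNIV. psi m a c d * (kd f c * kd b d)) = psi m a f b"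
    by simp
  also have "(\<Sum>c\<in>UNIV. \<Sum>d\<in>UNIV. psi m a c d * (kd f d * kd b c)) = psi m a b f"
    by simp
  finally show ?thesis using psi34[of m a b f] by (simp add: ww)
qed

lemma psi_psi3:
  "(\<Sum>b\<in>UNIV. \<Sum>c\<in>UNIV. \<Sum>d\<in>UNIV. psi m b c d * psi f b c d) = 24 * kd m f"
  by (simp add: psi_psi sum.distrib sum_subtractf kd_commute mult.assoc)

text \<open>The second hypothesis removes the product term of \<open>coass\<close>, and only the two
  Kronecker terms remain. Such matrices form the fourteen-dimensional summand of the 2-forms, the
  Lie algebra of G2.\<close>

lemma psi_14:
  assumes "\<And>i j. B i j = - B j i" "\<And>m. (\<Sum>k\<in>UNIV. \<Sum>l\<in>UNIV. B k l * w k l m) = 0"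
  shows "(\<Sum>k\<in>UNIV. \<Sum>l\<in>UNIV. psi i j k l * B k l) = - 2 * B i j"
proof -
  have "(\<Sum>k\<in>UNIV. \<Sum>l\<in>UNIV. (\<Sum>n\<in>UNIV. w i j n * w k l n) * B k l)
      = (\<Sum>k\<in>UNIV. \<Sum>n\<in>UNIV. w i j n * (\<Sum>l\<in>UNIV. B k l * w k l n))"
    by (simp add: sum_distrib_left sum_distrib_right mult_ac, subst (2) sum.swap, simp)
  also have "\<dots> = (\<Sum>n\<in>UNIV. w i j n * (\<Sum>k\<in>UNIV. \<Sum>l\<in>UNIV. B k l * w k l n))"
    by (subst sum.swap) (simp add: sum_distrib_left)
  also have "\<dots> = 0" by (simp add: assms(2))
  finally have "(\<Sum>k\<in>UNIV. \<Sum>l\<in>UNIV. psi i j k l * B k l) = - B i j + B j i"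
    by (simp add: coass_def distrib_right left_diff_distrib sum.distrib sum_subtractf mult.assoc)
  then show ?thesis using assms(1)[of j i] by simp
qed

text \<open>The Lie algebra of G2 fixes the form infinitesimally. The squared norm of
  \<open>act B w\<close> consists of three squares of size \<open>6 * n\<close> and three doubled
  cross terms of size \<open>- 3 * n\<close>, and these cancel exactly.\<close>

lemma act_14:
  assumes anti: "\<And>i j. B i j = - B j i" and zero: "\<And>m. (\<Sum>k\<in>UNIV. \<Sum>l\<in>UNIV. B k l * w k l m) = 0"
  shows "act B w b c d = 0"
proof -
  define Y where "Y b c d = (\<Sum>l\<in>UNIV. B b l * w l c d)" for b c d
  define n where "n = (\<Sum>b\<in>UNIV. \<Sum>l\<in>UNIV. B b l * B b l)"
  have act: "act B w b c d = Y b c d + Y c d b + Y d b c" for b c d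
    by (simp add: act_def Y_def w_cyc[of b _ d] w_cyc[of _ b c])
  have "(\<Sum>c\<in>UNIV. \<Sum>d\<in>UNIV. Y b c d * Y b c d) = 6 * (\<Sum>l\<in>UNIV. B b l * B b l)" for b
  proof -
    have "(\<Sum>c\<in>UNIV. \<Sum>d\<in>UNIV. w l c d * Y b c d) = 6 * B b l" for l
      using sum_pull2[of "B b" w "w l"] unfolding Y_def[symmetric]
      by (simp add: ww6 mult.commute)
    then show ?thesis
      using sum_pull2[of "B b" w "Y b"] unfolding Y_def[symmetric]
      by (simp add: sum_distrib_left mult_ac)
  qed
  then have S1: "(\<Sum>b\<in>UNIV. \<Sum>c\<in>UNIV. \<Sum>d\<in>UNIV. Y b c d * Y b c d) = 6 * n"
    by (simp add: n_def sum_distrib_left)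
  have inner: "(\<Sum>d\<in>UNIV. Y b c d * Y c d b)
      = (\<Sum>l\<in>UNIV. B b l * (\<Sum>m\<in>UNIV. B c m * (kd l b * kd c m - kd l m * kd c b + psi b l c m)))" for b c
  proof -
    have "psi l c b m = psi b l c m" for l m
      using psi12[of l c b m] psi23[of c l b m] psi12[of c b l m] psi23[of b c l m] by linarith
    then have "(\<Sum>d\<in>UNIV. w m d b * w l c d) = kd l b * kd c m - kd l m * kd c b + psi b l c m" for l m
      using ww[of l c b m] by (simp add: w_cyc[of m _ b] w_cyc[of _ b m] mult.commute)
    then have "(\<Sum>d\<in>UNIV. w l c d * Y c d b) 
       = (\<Sum>m\<in>UNIV. B c m * (kd l b * kd c m - kd l m * kd c b + psi b l c m))" for l
      using sum_pull[of "B c" "\<lambda>m d. w m d b" "w l c"] by (simp add: Y_def mult.commute)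
    then show ?thesis
      using sum_pull[of "B b" "\<lambda>l d. w l c d" "\<lambda>d. Y c d b"] by (simp add: Y_def)
  qed
  have tr: "B b b = 0" for b using anti[of b b] by simp
  have "(\<Sum>c\<in>UNIV. \<Sum>l\<in>UNIV. B b l * (\<Sum>m\<in>UNIV. B c m * (kd l b * kd c m - kd l m * kd c b + psi b l c m)))
     = - 3 * (\<Sum>l\<in>UNIV. B b l * B b l)" for b
  proof -
    have "(\<Sum>c\<in>UNIV. \<Sum>l\<in>UNIV. B b l * (\<Sum>m\<in>UNIV. B c m * (kd l b * kd c m - kd l m * kd c b + psi b l c m)))
      = - (\<Sum>l\<in>UNIV. B b l * B b l) + (\<Sum>c\<in>UNIV. \<Sum>l\<in>UNIV. B b l * (\<Sum>m\<in>UNIV. psi b l c m * B c m))"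
      by (simp add: tr distrib_left right_diff_distrib sum.distrib sum_subtractf mult.commute[of "psi _ _ _ _"])
         (subst sum.swap, simp)
    also have "(\<Sum>c\<in>UNIV. \<Sum>l\<in>UNIV. B b l * (\<Sum>m\<in>UNIV. psi b l c m * B c m))
       = (\<Sum>l\<in>UNIV. B b l * (\<Sum>c\<in>UNIV. \<Sum>m\<in>UNIV. psi b l c m * B c m))"
      by (subst sum.swap) (simp add: sum_distrib_left)
    also have "(\<Sum>l\<in>UNIV. B b l * (\<Sum>c\<in>UNIV. \<Sum>m\<in>UNIV. psi b l c m * B c m))
       = - 2 * (\<Sum>l\<in>UNIV. B b l * B b l)"
      by (simp only: psi_14[OF anti zero]) (simp add: sum_distrib_left mult.left_commute sum_negf)
    finally show ?thesis by simp
  qed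
  then have S2: "(\<Sum>b\<in>UNIV. \<Sum>c\<in>UNIV. \<Sum>d\<in>UNIV. Y b c d * Y c d b) = - 3 * n"
    by (simp add: inner n_def sum_distrib_left)
  have "(\<Sum>b\<in>UNIV. \<Sum>c\<in>UNIV. \<Sum>d\<in>UNIV. (act B w b c d)^2) 
      = (\<Sum>b\<in>UNIV. \<Sum>c\<in>UNIV. \<Sum>d\<in>UNIV. (Y b c d * Y b c d + Y c d b * Y c d b + Y d b c * Y d b c)
         + 2 * (Y b c d * Y c d b + Y c d b * Y d b c + Y d b c * Y b c d))"
    by (simp add: act power2_eq_square algebra_simps)
  also have "\<dots> = 0"
    using S1 S2 sum_cyc3[of "\<lambda>b c d. Y b c d * Y b c d"] sum_cyc3[of "\<lambda>b c d. Y c d b * Y c d b"]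
      sum_cyc3[of "\<lambda>b c d. Y b c d * Y c d b"] sum_cyc3[of "\<lambda>b c d. Y c d b * Y d b c"]
    by (simp add: sum.distrib flip: sum_distrib_left)
  finally show ?thesis
    by (simp add: sum_nonneg_eq_0_iff sum_nonneg)
qed

text \<open>By \<open>ww\<close> each slot contributes one copy of \<open>psi\<close>, and the
  Kronecker terms cancel in the cyclic sum. This covers the summand complementary to the one in
  \<open>act_14\<close>.\<close>

lemma act_vec:
  "act (\<lambda>b l. \<Sum>m\<in>UNIV. v m * w m b l) w b c d = 3 * (\<Sum>m\<in>UNIV. v m * psi m b c d)"
proof -
  have p: "psi m c d b = psi m b c d" "psi m d b c = psi m b c d" for m
    using psi34[of m c d b] psi23[of m c b d] psi23[of m d b c] psi34[of m b d c] by auto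
  have "act (\<lambda>b l. \<Sum>m\<in>UNIV. v m * w m b l) w b c d = 
     (\<Sum>m\<in>UNIV. v m * (\<Sum>l\<in>UNIV. w m b l * w c d l)) + (\<Sum>m\<in>UNIV. v m * (\<Sum>l\<in>UNIV. w m c l * w d b l))
     + (\<Sum>m\<in>UNIV. v m * (\<Sum>l\<in>UNIV. w m d l * w b c l))"
    by (simp add: act_def sum_pull w_cyc[of _ c d] w_cyc[of d b, symmetric])
  also have "\<dots> = 3 * (\<Sum>m\<in>UNIV. v m * psi m b c d)"
    by (simp add: ww p distrib_left right_diff_distrib sum.distrib sum_subtractf kd_commute)
  finally show ?thesis .
qed

text \<open>Only the component of \<open>B\<close> in the seven-dimensional summand of \<open>\<Lambda>\<^sup>2\<close> moves \<open>w\<close>.\<close>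

lemma act_antisym:
  assumes "\<And>i j. B i j = - B j i"
  shows "act B w b c d = 1/2 * (\<Sum>m\<in>UNIV. (\<Sum>k\<in>UNIV. \<Sum>l\<in>UNIV. B k l * w k l m) * psi m b c d)"
proof -
  \<comment> \<open>By \<open>ww6\<close> the factor 1/6 gives the contraction of \<open>v\<close>
    with \<open>w\<close> the same trace against \<open>w\<close> as \<open>B\<close> has. The
    remainder \<open>C\<close> then falls under \<open>act_14\<close>, and the 3 of
    \<open>act_vec\<close> times 1/6 is the 1/2 of the claim.\<close>
  define v where "v m = 1/6 * (\<Sum>k\<in>UNIV. \<Sum>l\<in>UNIV. B k l * w k l m)" for m
  define C where "C i j = B i j - (\<Sum>m\<in>UNIV. v m * w m i j)" for i j
  have "C i j = - C j i" for i j
    unfolding C_def w23[of _ i j] using assms[of i j] by (simp add: sum_negf)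
  moreover have "(\<Sum>k\<in>UNIV. \<Sum>l\<in>UNIV. C k l * w k l m) = 0" for m
  proof -
    have "(\<Sum>k\<in>UNIV. \<Sum>l\<in>UNIV. C k l * w k l m)
       = 6 * v m - (\<Sum>k\<in>UNIV. \<Sum>l\<in>UNIV. (\<Sum>n\<in>UNIV. v n * w n k l) * w k l m)"
      by (simp add: C_def v_def left_diff_distrib sum_subtractf)
    also have "\<dots> = 0"
      using ww6 by (simp add: sum_pull2 w_cyc[of _ _ m] w_cyc[of _ m] mult.left_commute[of _ 6])
    finally show ?thesis .
  qed
  ultimately have "act C w b c d = 0" by (rule act_14)
  then show ?thesis
    by (simp add: C_def[abs_def] act_diff act_vec)
       (simp add: v_def mult.commute flip: sum_divide_distrib)
qed

end

section \<open>The torsion of a closed structure\<close>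

context g2_tensor
begin

text \<open>By \<open>act_antisym\<close> the tensor \<open>N\<close> is encoded by a 7 by 7 matrix
  \<open>\<beta>\<close>. Closedness removes its trace, its symmetric part and its contraction with
  \<open>w\<close>, so that a matrix in the Lie algebra of G2 remains, proportional to
  \<open>tau\<close>. The third claim presents \<open>N\<close> as the infinitesimal rotation by the
  correction term of the canonical connection.\<close>

lemma closed_torsion:
  assumes N: "\<And>a b c d. N a b c d = act (B a) w b c d"
    and anti: "\<And>a i j. B a i j = - B a j i"
    and closed: "\<And>a b c d. N a b c d - N b a c d + N c a b d - N d a b c = 0"
    and tau: "\<And>c d. tau c d = - (\<Sum>a\<in>UNIV. N a a c d)"
  shows "tau i j = - tau j i"
    and "(\<Sum>k\<in>UNIV. \<Sum>l\<in>UNIV. tau k l * w k l m) = 0"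
    and "N a b c d = act (\<lambda>j k. -1/6 * (\<Sum>i\<in>UNIV. tau a i * w i j k)) w b c d"
proof -
  define \<beta> where "\<beta> a m = 1/2 * (\<Sum>k\<in>UNIV. \<Sum>l\<in>UNIV. B a k l * w k l m)" for a m
  define t where "t = (\<Sum>a\<in>UNIV. \<beta> a a)"
  have Nb: "N a b c d = (\<Sum>m\<in>UNIV. \<beta> a m * psi m b c d)" for a b c d
    by (simp add: N act_antisym[OF anti] \<beta>_def flip: sum_divide_distrib)
  have zero: "(\<Sum>b\<in>UNIV. \<Sum>c\<in>UNIV. \<Sum>d\<in>UNIV. (N a b c d - N b a c d + N c a b d - N d a b c) * z b c d) = 0" for a z
    by (simp add: closed)
  \<comment> \<open>Against a totally skew \<open>z\<close> the last three terms of the closedness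
    equation contribute equally, hence the factor 3. It is used with \<open>z\<close> a contraction
    of \<open>psi\<close>, and with \<open>z = w\<close>.\<close>
  have skew: "(\<Sum>b\<in>UNIV. \<Sum>c\<in>UNIV. \<Sum>d\<in>UNIV. N a b c d * z b c d)
      = 3 * (\<Sum>b\<in>UNIV. \<Sum>c\<in>UNIV. \<Sum>d\<in>UNIV. N b a c d * z b c d)"
    if z: "\<And>b c d. z b c d = - z c b d" "\<And>b c d. z c d b = z b c d" for a z
  proof -
    have "(\<Sum>b\<in>UNIV. \<Sum>c\<in>UNIV. \<Sum>d\<in>UNIV. N c a b d * z b c d) 
        = (\<Sum>b\<in>UNIV. \<Sum>c\<in>UNIV. \<Sum>d\<in>UNIV. N b a c d * z c b d)"
      by (rule sum.swap)
    also have "\<dots> = - (\<Sum>b\<in>UNIV. \<Sum>c\<in>UNIV. \<Sum>d\<in>UNIV. N b a c d * z b c d)"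
      by (subst z(1)) (simp add: sum_negf)
    finally have 1: "(\<Sum>b\<in>UNIV. \<Sum>c\<in>UNIV. \<Sum>d\<in>UNIV. N c a b d * z b c d) = \<dots>" .
    have 2: "(\<Sum>b\<in>UNIV. \<Sum>c\<in>UNIV. \<Sum>d\<in>UNIV. N d a b c * z b c d) 
        = (\<Sum>b\<in>UNIV. \<Sum>c\<in>UNIV. \<Sum>d\<in>UNIV. N b a c d * z b c d)"
      using sum_cyc3[of "\<lambda>b c d. N d a b c * z b c d"] by (simp add: z(2))
    show ?thesis using zero[of a z] 1 2
      by (simp add: left_diff_distrib distrib_right sum.distrib sum_subtractf)
  qed
  have eq1: "24 * \<beta> a f = 3 * (4 * \<beta> a f - 4 * t * kd a f - 2 * (\<Sum>k\<in>UNIV. \<Sum>l\<in>UNIV. psi a f k l * \<beta> k l))" for a f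
  proof -
    have p: "psi f b c d = - psi f c b d" "psi f c d b = psi f b c d" for b c d
      using psi23[of f b c d] psi34[of f c d b] psi23[of f c b d] by auto
    have "24 * \<beta> a f = (\<Sum>b\<in>UNIV. \<Sum>c\<in>UNIV. \<Sum>d\<in>UNIV. N a b c d * psi f b c d)"
      by (simp only: Nb sum_pull3 psi_psi3) simp
    also have "\<dots> = 3 * (\<Sum>b\<in>UNIV. \<Sum>c\<in>UNIV. \<Sum>d\<in>UNIV. N b a c d * psi f b c d)"
      by (rule skew) (rule p)+
    also have "(\<Sum>b\<in>UNIV. \<Sum>c\<in>UNIV. \<Sum>d\<in>UNIV. N b a c d * psi f b c d)
       = (\<Sum>b\<in>UNIV. \<Sum>m\<in>UNIV. \<beta> b m * (4 * kd m f * kd a b - 4 * kd m b * kd a f + 2 * psi m a f b))"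
      by (simp only: Nb sum_pull2 psi_psi)
    also have "\<dots> = (\<Sum>b\<in>UNIV. \<Sum>m\<in>UNIV. \<beta> b m * (4 * (kd m f * kd a b)) - \<beta> b m * (4 * (kd m b * kd a f)) - 2 * (psi a f b m * \<beta> b m))"
    proof -
      have "psi m a f b = - psi a f b m" for m b
        using psi12[of m a f b] psi23[of a m f b] psi34[of a f m b] by linarith
      then show ?thesis by (simp add: algebra_simps)
    qed
    also have "\<dots> = 4 * \<beta> a f - 4 * t * kd a f - 2 * (\<Sum>k\<in>UNIV. \<Sum>l\<in>UNIV. psi a f k l * \<beta> k l)"
      by (simp add: sum.distrib sum_subtractf t_def mult.left_commute[of _ 4] flip: sum_distrib_left)
         (simp add: sum_distrib_right)
    finally show ?thesis .
  qed
  \<comment> \<open>In the trace of \<open>eq1\<close> the Kronecker term gives 12 * 7 = 84 and the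
    \<open>psi\<close> term vanishes, so 24 t = 12 t - 84 t.\<close>
  have "(\<Sum>a\<in>UNIV. 24 * \<beta> a a) = (\<Sum>a\<in>UNIV. 12 * \<beta> a a) - 84 * t"
    by (subst eq1) (simp add: sum.distrib sum_subtractf)
  then have "t = 0"
    by (simp add: t_def flip: sum_distrib_left)
  then have b: "\<beta> a f = - 1/2 * (\<Sum>k\<in>UNIV. \<Sum>l\<in>UNIV. psi a f k l * \<beta> k l)" for a f
    using eq1[of a f] by simp
  have banti: "\<beta> a f = - \<beta> f a" for a f
    unfolding b[of a f] b[of f a] using psi12[of a f] by (simp add: sum_negf)
  \<comment> \<open>With \<open>z = w\<close> the left side of \<open>skew\<close> vanishes, since
    \<open>psi_w\<close> yields \<open>w\<close> with a repeated index; the right side is 12 times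
    the contraction of \<open>\<beta>\<close> with \<open>w\<close>.\<close>
  have b14: "(\<Sum>k\<in>UNIV. \<Sum>l\<in>UNIV. \<beta> k l * w k l a) = 0" for a
  proof -
    have "0 = (\<Sum>b\<in>UNIV. \<Sum>c\<in>UNIV. \<Sum>d\<in>UNIV. N a b c d * w b c d)"
    proof -
      have "w m b b = 0" for m b using w23[of m b b] by simp
      moreover have "(\<Sum>c\<in>UNIV. \<Sum>d\<in>UNIV. psi m b c d * w b c d) = 4 * w m b b" for m b
        unfolding w_cyc[of b] by (rule psi_w)
      ultimately have "(\<Sum>b\<in>UNIV. \<Sum>c\<in>UNIV. \<Sum>d\<in>UNIV. psi m b c d * w b c d) = 0" for m
        by simp
      then show ?thesis by (simp only: Nb sum_pull3) simp
    qed
    also have "\<dots> = 3 * (\<Sum>b\<in>UNIV. \<Sum>c\<in>UNIV. \<Sum>d\<in>UNIV. N b a c d * w b c d)"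
      by (rule skew) (rule w12, rule w_cyc[symmetric])
    also have "(\<Sum>b\<in>UNIV. \<Sum>c\<in>UNIV. \<Sum>d\<in>UNIV. N b a c d * w b c d) 
        = 4 * (\<Sum>b\<in>UNIV. \<Sum>m\<in>UNIV. \<beta> b m * w b m a)"
    proof -
      have "(\<Sum>c\<in>UNIV. \<Sum>d\<in>UNIV. psi m a c d * w b c d) = 4 * w b m a" for b m
        using psi_w[of m a b] w_cyc[of b m a] unfolding w_cyc[of b] by simp
      then show ?thesis by (simp only: Nb sum_pull2) (simp add: sum_distrib_left mult.left_commute)
    qed
    finally show ?thesis by simp
  qed
  \<comment> \<open>Now \<open>psi_14\<close> applies to \<open>\<beta>\<close>, and its eigenvalue
    is the constant -2 here.\<close>
  have tb: "tau c d = - 2 * \<beta> c d" for c d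
  proof -
    have "(\<Sum>m\<in>UNIV. \<beta> a m * psi m a c d) = - (\<Sum>m\<in>UNIV. psi c d a m * \<beta> a m)" for a
      by (subst psi12) (simp add: psi_pair[of c d] sum_negf mult.commute)
    then show ?thesis
      unfolding tau Nb using psi_14[OF banti b14, of c d] by (simp add: sum_negf)
  qed
  show "tau i j = - tau j i" using tb banti[of i j] by simp
  show "(\<Sum>k\<in>UNIV. \<Sum>l\<in>UNIV. tau k l * w k l m) = 0"
    using b14[of m] by (simp add: tb mult.assoc sum_negf flip: sum_distrib_left)
  have "act (\<lambda>j k. -1/6 * (\<Sum>i\<in>UNIV. tau a i * w i j k)) w b c d
     = act (\<lambda>j k. \<Sum>i\<in>UNIV. (1/3 * \<beta> a i) * w i j k) w b c d"
    by (simp add: tb sum_distrib_left mult.assoc)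
  also have "\<dots> = N a b c d"
    by (simp only: act_vec) (simp add: Nb sum_distrib_left)
  finally show "N a b c d = act (\<lambda>j k. -1/6 * (\<Sum>i\<in>UNIV. tau a i * w i j k)) w b c d" by simp
qed
end

section \<open>Two contractions of the difference of the curvatures\<close>

lemma sum_swap3:
  fixes f :: "'a::finite \<Rightarrow> 'b::finite \<Rightarrow> 'c::finite \<Rightarrow> real"
  shows "(\<Sum>i\<in>UNIV. \<Sum>j\<in>UNIV. \<Sum>k\<in>UNIV. f i j k) = (\<Sum>j\<in>UNIV. \<Sum>k\<in>UNIV. \<Sum>i\<in>UNIV. f i j k)"
  by (subst sum.swap, subst (2) sum.swap, rule refl)

lemma sum_pull_pair:
  fixes x :: "'a::finite \<Rightarrow> 'b::finite \<Rightarrow> real" and v :: "'a \<Rightarrow> 'b \<Rightarrow> 'c::finite \<Rightarrow> real"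
  shows "(\<Sum>d\<in>UNIV. (\<Sum>a\<in>UNIV. \<Sum>b\<in>UNIV. x a b * v a b d) * z d)
       = (\<Sum>a\<in>UNIV. \<Sum>b\<in>UNIV. x a b * (\<Sum>d\<in>UNIV. v a b d * z d))"
  by (simp add: sum_distrib_left sum_distrib_right mult.assoc) (rule sum_swap3)

text \<open>Cyclicity in the last three indices needs the pair symmetry of \<open>R\<close>.\<close>

lemma bianchi_last3:
  fixes R :: "'n \<Rightarrow> 'n \<Rightarrow> 'n \<Rightarrow> 'n \<Rightarrow> real"
  assumes a: "\<And>i j k l. R i j k l = - R j i k l" and b: "\<And>i j k l. R i j k l = - R i j l k"
    and c: "\<And>i j k l. R i j k l + R j k i l + R k i j l = 0"
  shows "R s i j k + R s j k i + R s k i j = 0"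
  using c[of s i j k] c[of s j k i] c[of s k i j] c[of i j k s]
    b[of i j s k] b[of j s i k] b[of s i j k] b[of s j k i] b[of j k s i] b[of k s j i]
    b[of s k i j] b[of k i s j] b[of i s k j]
    a[of i s j k] a[of j s k i] a[of k s i j] a[of i s k j] a[of j s i k] a[of k s j i]
  by linarith

context g2_tensor
begin

text \<open>\<open>R\<close> and \<open>Rt\<close> stand for the curvatures of the Levi-Civita and of the canonical connection, \<open>T\<close>
  for the canonical covariant derivative of \<open>\<tau>\<close>, and \<open>A\<close> for the difference of the connections.\<close>

lemma ricci_ratio:
  fixes R Rt :: "7 \<Rightarrow> 7 \<Rightarrow> 7 \<Rightarrow> 7 \<Rightarrow> real" and tau :: "7 \<Rightarrow> 7 \<Rightarrow> real" and T :: "7 \<Rightarrow> 7 \<Rightarrow> 7 \<Rightarrow> real"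
  assumes tau: "\<And>i j. tau i j = - tau j i" "\<And>m. (\<Sum>k\<in>UNIV. \<Sum>l\<in>UNIV. tau k l * w k l m) = 0"
    and T14: "\<And>i m. (\<Sum>k\<in>UNIV. \<Sum>l\<in>UNIV. T i k l * w k l m) = 0"
    and A: "\<And>i j k. A i j k = -1/6 * (\<Sum>a\<in>UNIV. tau i a * w a j k)"
    and Rt: "\<And>s i m. (\<Sum>j\<in>UNIV. \<Sum>k\<in>UNIV. Rt s i j k * w j k m) = 0"
    and R: "\<And>s i j k. R s i j k = Rt s i j k + 1/6 * (\<Sum>l\<in>UNIV. (T s i l - T i s l) * w l j k)
        - (\<Sum>l\<in>UNIV. (A s i l - A i s l) * A l j k)
        + (\<Sum>l\<in>UNIV. A i j l * A s l k) - (\<Sum>l\<in>UNIV. A s j l * A i l k)"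
    and R1: "\<And>i j k l. R i j k l = - R j i k l" and R2: "\<And>i j k l. R i j k l = - R i j l k"
    and R3: "\<And>i j k l. R i j k l + R j k i l + R k i j l = 0"
  shows "(\<Sum>s\<in>UNIV. Rt s i j s) = 2/3 * (\<Sum>s\<in>UNIV. R s i j s)"
proof -
  define K where "K a b = (\<Sum>l\<in>UNIV. tau l a * tau l b)" for a b
  define tr where "tr = (\<Sum>a\<in>UNIV. K a a)"
  define S where "S i j = (\<Sum>s\<in>UNIV. \<Sum>l\<in>UNIV. T s i l * w l j s)" for i j
  define W where "W s i m = (\<Sum>a\<in>UNIV. \<Sum>b\<in>UNIV. tau i a * (tau s b * w a b m))" for s i m
  define Q where "Q s i j k = (\<Sum>a\<in>UNIV. \<Sum>b\<in>UNIV. tau i a * (tau s b * psi a b j k))" for s i j k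
  have Kc: "K a b = K b a" for a b by (simp add: K_def mult.commute)
  have tau0: "tau i i = 0" for i using tau(1)[of i i] by simp
  have tautau: "(\<Sum>l\<in>UNIV. tau a l * tau l b) = - K a b" "(\<Sum>l\<in>UNIV. tau l b * tau a l) = - K a b"
      "(\<Sum>l\<in>UNIV. tau a l * tau b l) = K a b" for a b
    by (simp_all add: K_def tau(1)[of a] tau(1)[of b] sum_negf mult.commute)
  have Kpsi: "(\<Sum>a\<in>UNIV. \<Sum>b\<in>UNIV. K a b * psi b j i a) = 0" for i j
  proof -
    have "(\<Sum>a\<in>UNIV. \<Sum>b\<in>UNIV. K a b * psi b j i a) = (\<Sum>a\<in>UNIV. \<Sum>b\<in>UNIV. K a b * psi a j i b)"
      by (subst sum.swap) (simp add: Kc)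
    also have "\<dots> = - (\<Sum>a\<in>UNIV. \<Sum>b\<in>UNIV. K a b * psi b j i a)"
    proof -
      have p: "psi a j i b = - psi b j i a" for a b
        using psi12[of a j i b] psi23[of j a i b] psi34[of j i a b] psi23[of j i b a] psi12[of j b i a]
        by linarith
      show ?thesis by (subst p) (simp only: mult_minus_right sum_negf)
    qed
    finally show ?thesis by simp
  qed
  have psitau: "(\<Sum>k\<in>UNIV. \<Sum>l\<in>UNIV. psi i j k l * tau k l) = - 2 * tau i j" for i j
    by (rule psi_14) (rule tau(1), rule tau(2))
  \<comment> \<open>This difference is the torsion of the canonical connection. Because
    \<open>act tau w\<close> vanishes, the two terms with \<open>tau\<close> on the first two
    indices can be traded for a single one with \<open>tau\<close> on the last index.\<close>
  have tor: "A s i l - A i s l = 1/6 * (\<Sum>a\<in>UNIV. w s i a * tau l a)" for s i l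
  proof -
    have "act tau w s i l = 0" by (rule act_14) (rule tau(1), rule tau(2))
    moreover have "(\<Sum>a\<in>UNIV. tau i a * w a s l) = - (\<Sum>a\<in>UNIV. tau i a * w s a l)"
      by (simp add: w12[of _ s] sum_negf)
    ultimately show ?thesis by (simp add: act_def A mult.commute)
  qed
  have Tor: "(\<Sum>l\<in>UNIV. (A s i l - A i s l) * A l j k)
     = - 1/36 * (\<Sum>a\<in>UNIV. w s i a * (\<Sum>b\<in>UNIV. K a b * w b j k))" for s i j k
  proof -
    have "(\<Sum>l\<in>UNIV. (A s i l - A i s l) * A l j k) = 
      - 1/36 * (\<Sum>l\<in>UNIV. (\<Sum>a\<in>UNIV. w s i a * tau l a) * (\<Sum>b\<in>UNIV. tau l b * w b j k))"
      unfolding tor unfolding A by (subst sum_distrib_left) simp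
    also have "(\<Sum>l\<in>UNIV. (\<Sum>a\<in>UNIV. w s i a * tau l a) * (\<Sum>b\<in>UNIV. tau l b * w b j k))
       = (\<Sum>a\<in>UNIV. w s i a * (\<Sum>l\<in>UNIV. (\<Sum>b\<in>UNIV. w b j k * tau l b) * tau l a))"
      by (subst sum_pull) (simp add: mult.commute)
    also have "\<dots> = (\<Sum>a\<in>UNIV. w s i a * (\<Sum>b\<in>UNIV. K a b * w b j k))"
      by (simp only: sum_pull) (simp add: K_def mult.commute)
    finally show ?thesis .
  qed
  have AA: "(\<Sum>l\<in>UNIV. A i j l * A s l k)
     = 1/36 * (tau i k * tau s j - K i s * kd j k + Q s i j k)" for i j s k
  proof -
    have p: "psi a j k b = psi a b j k" for a b
      using psi34[of a j k b] psi23[of a j b k] by linarith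
    have "(\<Sum>l\<in>UNIV. A i j l * A s l k) 
      = 1/36 * (\<Sum>l\<in>UNIV. (\<Sum>a\<in>UNIV. tau i a * w a j l) * (\<Sum>b\<in>UNIV. tau s b * w k b l))"
      unfolding A w_cyc[of k] by (subst sum_distrib_left) simp
    also have "(\<Sum>l\<in>UNIV. (\<Sum>a\<in>UNIV. tau i a * w a j l) * (\<Sum>b\<in>UNIV. tau s b * w k b l))
      = (\<Sum>a\<in>UNIV. tau i a * (\<Sum>b\<in>UNIV. tau s b * (\<Sum>l\<in>UNIV. w k b l * w a j l)))"
      by (simp only: sum_pull mult.commute[of "w _ _ _" "sum _ _"])
    also have "\<dots> = (\<Sum>a\<in>UNIV. tau i a * (\<Sum>b\<in>UNIV. tau s b * (kd k a * kd b j - kd k j * kd b a + psi a b j k)))"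
      by (simp only: ww p[symmetric] psi_pair[of k]) 
    also have "\<dots> = tau i k * tau s j - K i s * kd j k + Q s i j k"
      by (simp add: distrib_left right_diff_distrib sum.distrib sum_subtractf Q_def tautau(3)[symmetric] sum_distrib_left sum_distrib_right kd_commute mult_ac)
    finally show ?thesis .
  qed
  have Qs: "Q i s j k = - Q s i j k" for s i j k
  proof -
    have "Q i s j k = (\<Sum>b\<in>UNIV. \<Sum>a\<in>UNIV. tau s a * (tau i b * psi a b j k))"
      unfolding Q_def by (rule sum.swap)
    also have "\<dots> = - Q s i j k"
      unfolding Q_def by (subst psi12) (simp add: sum_negf mult.left_commute)
    finally show ?thesis .
  qed
  have R': "R s i j k = Rt s i j k + 1/6 * (\<Sum>l\<in>UNIV. T s i l * w l j k) - 1/6 * (\<Sum>l\<in>UNIV. T i s l * w l j k)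
        + 1/36 * (\<Sum>a\<in>UNIV. w s i a * (\<Sum>b\<in>UNIV. K a b * w b j k))
        + 1/36 * (tau i k * tau s j - tau s k * tau i j + 2 * Q s i j k)" for s i j k
    unfolding R Tor AA Qs[of s i] using Kc[of s i] by (simp add: left_diff_distrib sum_subtractf diff_divide_distrib add_divide_distrib)
  \<comment> \<open>First relation. One of the two \<open>T\<close> terms drops out by
    \<open>T14\<close>, and the \<open>Q\<close> term reduces to \<open>K\<close> because
    \<open>tau\<close> is an eigenvector of \<open>psi\<close>.\<close>
  have trace: "(\<Sum>s\<in>UNIV. R s i j s) = (\<Sum>s\<in>UNIV. Rt s i j s) + 1/6 * S i j + 1/9 * K i j - 1/36 * tr * kd i j"
  proof -
    have t1: "(\<Sum>s\<in>UNIV. \<Sum>l\<in>UNIV. T i s l * w l j s) = 0"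
      using T14[of i j] unfolding w_cyc[of _ _ j] .
    have t2: "(\<Sum>s\<in>UNIV. \<Sum>a\<in>UNIV. w s i a * (\<Sum>b\<in>UNIV. K a b * w b j s)) = K i j - tr * kd i j"
    proof -
      have "(\<Sum>s\<in>UNIV. \<Sum>a\<in>UNIV. w s i a * (\<Sum>b\<in>UNIV. K a b * w b j s))
         = (\<Sum>a\<in>UNIV. \<Sum>s\<in>UNIV. (\<Sum>b\<in>UNIV. K a b * w b j s) * w i a s)"
        by (subst sum.swap) (simp add: mult.commute w_cyc[of _ i])
      also have "\<dots> = (\<Sum>a\<in>UNIV. \<Sum>b\<in>UNIV. K a b * (kd b i * kd j a - kd b a * kd j i + psi b j i a))"
        by (simp only: sum_pull ww)
      also have "\<dots> = K i j - tr * kd i j + (\<Sum>a\<in>UNIV. \<Sum>b\<in>UNIV. K a b * psi b j i a)"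
        by (simp add: distrib_left right_diff_distrib sum.distrib sum_subtractf tr_def sum_distrib_right kd_commute Kc)
      finally show ?thesis by (simp add: Kpsi)
    qed
    have t3: "(\<Sum>s\<in>UNIV. Q s i j s) = 2 * K i j"
    proof -
      have "(\<Sum>s\<in>UNIV. Q s i j s) = (\<Sum>a\<in>UNIV. tau i a * (\<Sum>s\<in>UNIV. \<Sum>b\<in>UNIV. tau s b * psi a b j s))"
        unfolding Q_def by (subst sum.swap) (simp add: sum_distrib_left)
      also have "\<dots> = (\<Sum>a\<in>UNIV. tau i a * (\<Sum>s\<in>UNIV. \<Sum>b\<in>UNIV. psi a j s b * tau s b))"
      proof -
        have "psi a b j s = psi a j s b" for a b s
          using psi23[of a b j s] psi34[of a j b s] by linarith
        then show ?thesis by (simp add: mult.commute)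
      qed
      also have "\<dots> = 2 * K i j"
        unfolding psitau using tautau(1)[of i j] by (simp add: sum_negf mult.left_commute[of _ 2] flip: sum_distrib_left)
      finally show ?thesis .
    qed
    have t4: "(\<Sum>s\<in>UNIV. tau i s * tau s j) = - K i j" by (rule tautau)
    show ?thesis
      unfolding R' using t1 t2 t3 t4
      by (simp add: sum.distrib sum_subtractf S_def tau0 flip: sum_distrib_left sum_divide_distrib)
         (simp add: diff_divide_distrib)
  qed
  \<comment> \<open>Contraction with \<open>w\<close> eliminates \<open>Rt\<close>, so the relation
    derived from it involves the Riemannian Ricci tensor but not the canonical one.\<close>
  have contr: "(\<Sum>j\<in>UNIV. \<Sum>k\<in>UNIV. R s i j k * w j k m)
      = T s i m - T i s m + 1/6 * (\<Sum>a\<in>UNIV. w s i a * K a m) + 1/6 * W s i m" for s i m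
  proof -
    have c1: "(\<Sum>j\<in>UNIV. \<Sum>k\<in>UNIV. (\<Sum>l\<in>UNIV. x l * w l j k) * w j k m) = 6 * x m" for x
      unfolding sum_pull2 w_cyc[of _ _ m] w_cyc[of _ m] using ww6 by (simp add: mult.left_commute[of _ 6])
    have c2: "(\<Sum>j\<in>UNIV. \<Sum>k\<in>UNIV. (\<Sum>a\<in>UNIV. w s i a * (\<Sum>b\<in>UNIV. K a b * w b j k)) * w j k m) = 6 * (\<Sum>a\<in>UNIV. w s i a * K a m)"
      by (subst sum_pull2, simp only: c1) (simp add: sum_distrib_left mult_ac)
    have c3: "(\<Sum>j\<in>UNIV. \<Sum>k\<in>UNIV. tau s k * tau i j * w j k m) = W s i m"
      by (simp add: W_def mult_ac)
    have c4: "(\<Sum>j\<in>UNIV. \<Sum>k\<in>UNIV. tau i k * tau s j * w j k m) = - W s i m"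
      unfolding W_def by (subst sum.swap, subst w12) (simp add: sum_negf mult_ac)
    have c5: "(\<Sum>j\<in>UNIV. \<Sum>k\<in>UNIV. Q s i j k * w j k m) = 4 * W s i m"
    proof -
      have "(\<Sum>j\<in>UNIV. \<Sum>k\<in>UNIV. Q s i j k * w j k m) = 
         (\<Sum>a\<in>UNIV. tau i a * (\<Sum>j\<in>UNIV. \<Sum>k\<in>UNIV. (\<Sum>b\<in>UNIV. tau s b * psi a b j k) * w j k m))"
        unfolding Q_def sum_distrib_left[symmetric] by (rule sum_pull2)
      also have "\<dots> = 4 * W s i m"
        by (simp only: sum_pull2 psi_w W_def) (simp add: sum_distrib_left mult.left_commute)
      finally show ?thesis .
    qed
    have lin: "(\<Sum>j\<in>UNIV. \<Sum>k\<in>UNIV. (p j k + 1/6 * q j k - 1/6 * r j k + 1/36 * u j k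
            + 1/36 * (x j k - y j k + 2 * z j k)) * v j k)
       = (\<Sum>j\<in>UNIV. \<Sum>k\<in>UNIV. p j k * v j k) + 1/6 * (\<Sum>j\<in>UNIV. \<Sum>k\<in>UNIV. q j k * v j k)
         - 1/6 * (\<Sum>j\<in>UNIV. \<Sum>k\<in>UNIV. r j k * v j k) + 1/36 * (\<Sum>j\<in>UNIV. \<Sum>k\<in>UNIV. u j k * v j k)
         + 1/36 * ((\<Sum>j\<in>UNIV. \<Sum>k\<in>UNIV. x j k * v j k) - (\<Sum>j\<in>UNIV. \<Sum>k\<in>UNIV. y j k * v j k)
            + 2 * (\<Sum>j\<in>UNIV. \<Sum>k\<in>UNIV. z j k * v j k))"
      for p q r u x y z v :: "7 \<Rightarrow> 7 \<Rightarrow> real"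
      by (simp only: sum_distrib_left distrib_right left_diff_distrib distrib_left right_diff_distrib
          mult.assoc sum.distrib sum_subtractf)
    have "(\<Sum>j\<in>UNIV. \<Sum>k\<in>UNIV. R s i j k * w j k m) = 
       (\<Sum>j\<in>UNIV. \<Sum>k\<in>UNIV. Rt s i j k * w j k m) 
       + 1/6 * (\<Sum>j\<in>UNIV. \<Sum>k\<in>UNIV. (\<Sum>l\<in>UNIV. T s i l * w l j k) * w j k m)
       - 1/6 * (\<Sum>j\<in>UNIV. \<Sum>k\<in>UNIV. (\<Sum>l\<in>UNIV. T i s l * w l j k) * w j k m)
       + 1/36 * (\<Sum>j\<in>UNIV. \<Sum>k\<in>UNIV. (\<Sum>a\<in>UNIV. w s i a * (\<Sum>b\<in>UNIV. K a b * w b j k)) * w j k m)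
       + 1/36 * ((\<Sum>j\<in>UNIV. \<Sum>k\<in>UNIV. tau i k * tau s j * w j k m) - (\<Sum>j\<in>UNIV. \<Sum>k\<in>UNIV. tau s k * tau i j * w j k m)
          + 2 * (\<Sum>j\<in>UNIV. \<Sum>k\<in>UNIV. Q s i j k * w j k m))"
      unfolding R' by (rule lin)
    also have "\<dots> = T s i m - T i s m + 1/6 * (\<Sum>a\<in>UNIV. w s i a * K a m) + 1/6 * W s i m"
      unfolding Rt c1 c2 c3 c4 c5 by simp
    finally show ?thesis .
  qed
  \<comment> \<open>Contracting \<open>contr\<close> once more with \<open>w\<close> turns the
    curvature side into twice the Ricci contraction plus a \<open>psi\<close> term, by
    \<open>ww\<close>.\<close>
  have second: "2 * (\<Sum>s\<in>UNIV. R s p n s) = S p n + 2/3 * K p n - 1/6 * tr * kd p n" for p n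
  proof -
    have "(\<Sum>i\<in>UNIV. \<Sum>m\<in>UNIV. (\<Sum>j\<in>UNIV. \<Sum>k\<in>UNIV. R p i j k * w j k m) * w i n m)
       = (\<Sum>i\<in>UNIV. \<Sum>j\<in>UNIV. \<Sum>k\<in>UNIV. R p i j k * (kd j i * kd k n - kd j n * kd k i + psi j k i n))"
      by (simp only: sum_pull_pair ww)
    also have "\<dots> = 2 * (\<Sum>s\<in>UNIV. R s p n s) + (\<Sum>i\<in>UNIV. \<Sum>j\<in>UNIV. \<Sum>k\<in>UNIV. R p i j k * psi j k i n)"
    proof -
      have "(\<Sum>i\<in>UNIV. \<Sum>j\<in>UNIV. \<Sum>k\<in>UNIV. R p i j k * (kd j i * kd k n - kd j n * kd k i + psi j k i n))
         = (\<Sum>i\<in>UNIV. R p i i n) - (\<Sum>i\<in>UNIV. R p i n i) + (\<Sum>i\<in>UNIV. \<Sum>j\<in>UNIV. \<Sum>k\<in>UNIV. R p i j k * psi j k i n)"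
        by (simp add: distrib_left right_diff_distrib sum.distrib sum_subtractf)
      moreover have "R p i i n = R i p n i" "R p i n i = - R i p n i" for i
        using R1[of p i i n] R2[of i p i n] R1[of p i n i] by auto
      ultimately show ?thesis by (simp add: sum_negf)
    qed
    also have "(\<Sum>i\<in>UNIV. \<Sum>j\<in>UNIV. \<Sum>k\<in>UNIV. R p i j k * psi j k i n) = 0"
    proof -
      \<comment> \<open>\<open>psi\<close> is invariant under cyclic permutations of
        \<open>i j k\<close>, so three times this sum is a sum over the cyclic sums of
        \<open>R\<close>, which vanish by \<open>bianchi_last3\<close>.\<close>
      define f where "f i j k = R p i j k * psi j k i n" for i j k
      have "psi k i j n = psi j k i n" for i j k
        using psi23[of k i j n] psi12[of k j i n] by linarith
      then have "f i j k + f j k i + f k i j = (R p i j k + R p j k i + R p k i j) * psi j k i n" for i j k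
        by (simp add: f_def distrib_right)
      then have z: "f i j k + f j k i + f k i j = 0" for i j k
        using bianchi_last3[of R p i j k, OF R1 R2 R3] by simp
      have "(\<Sum>i\<in>UNIV. \<Sum>j\<in>UNIV. \<Sum>k\<in>UNIV. f i j k + f j k i + f k i j)
          = 3 * (\<Sum>i\<in>UNIV. \<Sum>j\<in>UNIV. \<Sum>k\<in>UNIV. f i j k)"
        using sum_cyc3[of f] sum_cyc3[of "\<lambda>i j k. f j k i"] by (simp add: sum.distrib)
      then show ?thesis unfolding z by (simp add: f_def)
    qed
    finally have L: "2 * (\<Sum>s\<in>UNIV. R s p n s) = (\<Sum>i\<in>UNIV. \<Sum>m\<in>UNIV. (\<Sum>j\<in>UNIV. \<Sum>k\<in>UNIV. R p i j k * w j k m) * w i n m)"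
      by simp
    have d1: "(\<Sum>i\<in>UNIV. \<Sum>m\<in>UNIV. T p i m * w i n m) = 0"
      using T14[of p n] by (simp add: w23[of _ n] sum_negf)
    have d2: "(\<Sum>i\<in>UNIV. \<Sum>m\<in>UNIV. T i p m * w i n m) = - S p n"
      unfolding S_def by (subst w_cyc, subst w12) (simp add: sum_negf w_cyc[of n] w_cyc[of _ n])
    have d3: "(\<Sum>i\<in>UNIV. \<Sum>m\<in>UNIV. (\<Sum>a\<in>UNIV. w p i a * K a m) * w i n m) = K p n - tr * kd p n"
    proof -
      have "(\<Sum>i\<in>UNIV. \<Sum>m\<in>UNIV. (\<Sum>a\<in>UNIV. w p i a * K a m) * w i n m)
        = (\<Sum>i\<in>UNIV. \<Sum>m\<in>UNIV. \<Sum>a\<in>UNIV. K a m * (w a p i * w n m i))"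
        unfolding w_cyc[of _ n] w_cyc[symmetric, of p] by (simp add: sum_distrib_left mult_ac)
      also have "\<dots> = (\<Sum>m\<in>UNIV. \<Sum>a\<in>UNIV. K a m * (kd a n * kd p m - kd a m * kd p n + psi a p n m))"
        by (subst sum_swap3) (simp only: sum_distrib_left[symmetric] ww)
      also have "\<dots> = K p n - tr * kd p n + (\<Sum>m\<in>UNIV. \<Sum>a\<in>UNIV. K m a * psi a p n m)"
        by (simp add: distrib_left right_diff_distrib sum.distrib sum_subtractf tr_def sum_distrib_right Kc)
      finally show ?thesis by (simp add: Kpsi)
    qed
    have d4: "(\<Sum>i\<in>UNIV. \<Sum>m\<in>UNIV. W p i m * w i n m) = 3 * K p n"
    proof -
      have "(\<Sum>i\<in>UNIV. \<Sum>m\<in>UNIV. W p i m * w i n m)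
        = (\<Sum>i\<in>UNIV. \<Sum>a\<in>UNIV. \<Sum>b\<in>UNIV. (tau i a * tau p b) * (kd a i * kd b n - kd a n * kd b i + psi a b i n))"
        unfolding W_def mult.assoc[symmetric] by (simp only: sum_pull_pair ww)
      also have "\<dots> = K p n + (\<Sum>i\<in>UNIV. \<Sum>a\<in>UNIV. \<Sum>b\<in>UNIV. tau p b * (psi a b i n * tau i a))"
        by (simp add: distrib_left right_diff_distrib sum.distrib sum_subtractf mult.assoc tau0 tautau)
           (simp add: mult_ac tau0, simp add: tautau)
      also have "(\<Sum>i\<in>UNIV. \<Sum>a\<in>UNIV. \<Sum>b\<in>UNIV. tau p b * (psi a b i n * tau i a))
        = (\<Sum>b\<in>UNIV. tau p b * (\<Sum>i\<in>UNIV. \<Sum>a\<in>UNIV. psi b n i a * tau i a))"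
      proof -
        have "psi a b i n = psi b n i a" for a b i
          using psi12[of a b i n] psi23[of b a i n] psi34[of b i a n] psi23[of b i n a] by linarith
        then show ?thesis
          by (subst sum_swap3[symmetric]) (simp add: sum_distrib_left)
      qed
      also have "\<dots> = 2 * K p n"
        unfolding psitau using tautau(1)[of p n]
        by (simp add: sum_negf mult.left_commute[of _ 2] flip: sum_distrib_left)
      finally show ?thesis by simp
    qed
    have "(\<Sum>i\<in>UNIV. \<Sum>m\<in>UNIV. (\<Sum>j\<in>UNIV. \<Sum>k\<in>UNIV. R p i j k * w j k m) * w i n m)
     = (\<Sum>i\<in>UNIV. \<Sum>m\<in>UNIV. T p i m * w i n m) - (\<Sum>i\<in>UNIV. \<Sum>m\<in>UNIV. T i p m * w i n m)
       + 1/6 * (\<Sum>i\<in>UNIV. \<Sum>m\<in>UNIV. (\<Sum>a\<in>UNIV. w p i a * K a m) * w i n m)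
       + 1/6 * (\<Sum>i\<in>UNIV. \<Sum>m\<in>UNIV. W p i m * w i n m)"
      unfolding contr sum_distrib_left sum.distrib[symmetric] sum_subtractf[symmetric]
      by (simp only: distrib_right left_diff_distrib mult.assoc sum_distrib_left sum_distrib_right)
    then show ?thesis unfolding L d1 d2 d3 d4 by (simp add: algebra_simps)
  qed
  \<comment> \<open>The right side of \<open>second\<close> is six times the correction in
    \<open>trace\<close>. The correction is therefore one third of the Ricci contraction of
    \<open>R\<close>.\<close>
  show ?thesis
    using trace second[of i j] by (simp add: algebra_simps)
qed
end

section \<open>The model form\<close>

lemma exhaust_7: "x = 1 \<or> x = 2 \<or> x = 3 \<or> x = 4 \<or> x = 5 \<or> x = 6 \<or> x = (7::7)"
proof (induct x)
  case (of_int z)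
  then have "z = 0 \<or> z = 1 \<or> z = 2 \<or> z = 3 \<or> z = 4 \<or> z = 5 \<or> z = 6" by fastforce
  then show ?case by auto
qed

lemma forall_7: "(\<forall>i::7. P i) \<longleftrightarrow> P 1 \<and> P 2 \<and> P 3 \<and> P 4 \<and> P 5 \<and> P 6 \<and> P 7"
  by (metis exhaust_7)

lemma wedge3_expand:
  "wedge3 \<alpha> \<beta> \<gamma> u v w = \<alpha> u * (\<beta> v * \<gamma> w) - \<alpha> u * (\<beta> w * \<gamma> v) - \<alpha> v * (\<beta> u * \<gamma> w)
     + \<alpha> v * (\<beta> w * \<gamma> u) + \<alpha> w * (\<beta> u * \<gamma> v) - \<alpha> w * (\<beta> v * \<gamma> u)"
  unfolding wedge3_def det_3 by (simp add: vector_3 algebra_simps)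

text \<open>The seven lines of the model form are the translates of \<open>{1, 2, 4}\<close> modulo 7, so the line
  through \<open>a\<close> and \<open>b\<close>, and its sign, depend on \<open>b - a\<close> only; \<open>{1, 2, 4}\<close> are the quadratic
  residues.\<close>

definition qr :: "7 \<Rightarrow> bool" where "qr d \<longleftrightarrow> d = 1 \<or> d = 2 \<or> d = 4"

definition sg :: "7 \<Rightarrow> real" where "sg d = (if d = 0 then 0 else if qr d then 1 else -1)"

definition third :: "7 \<Rightarrow> 7" where "third d = (if qr d then 3 * d else 5 * d)"

text \<open>The pair 1, 2 has third point 1 + 3, and multiplication by residues preserves the line,
  whence \<open>3 * d\<close>. Reversing a pair replaces this by \<open>-2 * d\<close>, which is
  \<open>5 * d\<close> modulo 7. With a single delta per component, contractions of the model form
  collapse.\<close>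

lemma g2_model_kd: "g2_model kd a b c = sg (b - a) * kd (a + third (b - a)) c"
proof -
  have "\<forall>a b c. g2_model kd a b c = sg (b - a) * kd (a + third (b - a)) c"
    unfolding forall_7
    by (intro conjI) (simp_all add: g2_model_def wedge3_expand kd_def sg_def third_def qr_def)
  then show ?thesis by blast
qed

lemma g2_model_tensor: "g2_tensor (g2_model kd)"
proof
  fix i j k l :: 7
  show "g2_model kd i j k = - g2_model kd j i k" "g2_model kd i j k = - g2_model kd i k j"
    by (simp_all add: g2_model_def wedge3_expand)
  have kd_add: "kd (i + a) (i + b) = kd a b" "kd i (i + b) = kd 0 b" "kd (i + b) i = kd b 0" for a b
    by (auto simp: kd_def)
  \<comment> \<open>Components depend on index differences only, so the first index stays symbolic
    and just the 343 triples of offsets are enumerated.\<close>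
  have "\<forall>a b c. coass (g2_model kd) i (i + a) (i + b) (i + c) = - coass (g2_model kd) i (i + b) (i + a) (i + c)"
    unfolding forall_7
    by (intro conjI)
      (simp_all add: coass_def g2_model_kd mult.assoc mult.left_commute[of "kd _ _"] add.assoc kd_add,
       simp_all add: sg_def third_def qr_def kd_def)
  then have "coass (g2_model kd) i (i + (j - i)) (i + (k - i)) (i + (l - i))
     = - coass (g2_model kd) i (i + (k - i)) (i + (j - i)) (i + (l - i))" by blast
  then show "coass (g2_model kd) i j k l = - coass (g2_model kd) i k j l" by simp
qed

section \<open>Curvature in a frame\<close>

text \<open>Actions on different slots commute, so only products within one slot survive. This turns
  the quadratic terms of a curvature into the action of a single matrix.\<close>

lemma act_commutator:
  fixes M K :: "'n::finite \<Rightarrow> 'n \<Rightarrow> real"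
  shows "act M (act K w) b c d - act K (act M w) b c d
     = act (\<lambda>i j. (\<Sum>l\<in>UNIV. M i l * K l j) - (\<Sum>l\<in>UNIV. K i l * M l j)) w b c d"
proof -
  have sw: "(\<Sum>l\<in>UNIV. M i l * (\<Sum>m\<in>UNIV. K j m * f l m)) = (\<Sum>l\<in>UNIV. K j l * (\<Sum>m\<in>UNIV. M i m * f m l))"
    for i j f
    by (simp add: sum_distrib_left, subst sum.swap) (simp add: mult.left_commute)
  show ?thesis
    unfolding act_def
    by (simp add: distrib_left sum.distrib left_diff_distrib sum_subtractf sum_pull
        sw[of b c "\<lambda>l m. w l m d"] sw[of b d "\<lambda>l m. w l c m"] sw[of c b "\<lambda>l m. w m l d"]
        sw[of c d "\<lambda>l m. w b l m"] sw[of d b "\<lambda>l m. w m c l"] sw[of d c "\<lambda>l m. w b m l"])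
qed

lemma act_add: "act (\<lambda>i j. B i j + C i j) w b c d = act B w b c d + act C w b c d"
  by (simp add: act_def distrib_right sum.distrib)

lemma act_sum: "act (\<lambda>i j. \<Sum>l\<in>UNIV. x l * B l i j) w b c d = (\<Sum>l\<in>UNIV. x l * act (B l) w b c d)"
  for x :: "'a::finite \<Rightarrow> real"
  by (simp add: act_def sum_pull distrib_left sum.distrib)

text \<open>\<open>dzero\<close> is the derivative of \<open>zero\<close> along one frame vector
  when \<open>w\<close> is parallel for the connection matrix \<open>G\<close>. Since
  \<open>G\<close> is skew, its action on the contracted slots of \<open>w\<close> moves over to
  \<open>tau\<close>; its action on the free slot vanishes by \<open>zero\<close>.\<close>

lemma cov_deriv_contract:
  fixes G :: "'n::finite \<Rightarrow> 'n \<Rightarrow> real"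
  assumes G: "\<And>i j. G i j = - G j i"
    and zero: "\<And>m. (\<Sum>k\<in>UNIV. \<Sum>l\<in>UNIV. tau k l * w k l m) = 0"
    and dzero: "(\<Sum>k\<in>UNIV. \<Sum>l\<in>UNIV. dt k l * w k l m + tau k l * act G w k l m) = 0"
  shows "(\<Sum>k\<in>UNIV. \<Sum>l\<in>UNIV.
      (dt k l - (\<Sum>n\<in>UNIV. G k n * tau n l) - (\<Sum>n\<in>UNIV. G l n * tau k n)) * w k l m) = 0"
proof -
  have a: "(\<Sum>k\<in>UNIV. \<Sum>l\<in>UNIV. tau k l * (\<Sum>n\<in>UNIV. G k n * w n l m))
      = - (\<Sum>k\<in>UNIV. \<Sum>l\<in>UNIV. (\<Sum>n\<in>UNIV. G k n * tau n l) * w k l m)"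
  proof -
    have "(\<Sum>k\<in>UNIV. \<Sum>l\<in>UNIV. tau k l * (\<Sum>n\<in>UNIV. G k n * w n l m))
       = (\<Sum>l\<in>UNIV. \<Sum>k\<in>UNIV. \<Sum>n\<in>UNIV. tau k l * (G k n * w n l m))"
      by (subst sum.swap) (simp add: sum_distrib_left)
    also have "\<dots> = (\<Sum>l\<in>UNIV. \<Sum>n\<in>UNIV. \<Sum>k\<in>UNIV. tau k l * (G k n * w n l m))"
      by (intro sum.cong refl sum.swap)
    also have "\<dots> = (\<Sum>n\<in>UNIV. \<Sum>l\<in>UNIV. \<Sum>k\<in>UNIV. - (G n k * tau k l) * w n l m)"
      by (subst sum.swap, subst G) (simp add: mult_ac)
    finally show ?thesis by (simp add: sum_distrib_right sum_negf)
  qed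
  have b: "(\<Sum>k\<in>UNIV. \<Sum>l\<in>UNIV. tau k l * (\<Sum>n\<in>UNIV. G l n * w k n m))
      = - (\<Sum>k\<in>UNIV. \<Sum>l\<in>UNIV. (\<Sum>n\<in>UNIV. G l n * tau k n) * w k l m)"
  proof -
    have "(\<Sum>k\<in>UNIV. \<Sum>l\<in>UNIV. tau k l * (\<Sum>n\<in>UNIV. G l n * w k n m))
       = (\<Sum>k\<in>UNIV. \<Sum>n\<in>UNIV. \<Sum>l\<in>UNIV. tau k l * (G l n * w k n m))"
      by (simp add: sum_distrib_left) (intro sum.cong refl sum.swap)
    also have "\<dots> = (\<Sum>k\<in>UNIV. \<Sum>n\<in>UNIV. \<Sum>l\<in>UNIV. - (G n l * tau k l) * w k n m)"
      by (subst G) (simp add: mult_ac)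
    finally show ?thesis by (simp add: sum_distrib_right sum_negf)
  qed
  have c: "(\<Sum>k\<in>UNIV. \<Sum>l\<in>UNIV. tau k l * (\<Sum>n\<in>UNIV. G m n * w k l n)) = 0"
  proof -
    have "(\<Sum>k\<in>UNIV. \<Sum>l\<in>UNIV. tau k l * (\<Sum>n\<in>UNIV. G m n * w k l n))
       = (\<Sum>n\<in>UNIV. G m n * (\<Sum>k\<in>UNIV. \<Sum>l\<in>UNIV. w k l n * tau k l))"
      using sum_pull2[of "G m" "\<lambda>n k l. w k l n" tau] by (simp add: mult.commute)
    then show ?thesis using zero by (simp add: mult.commute)
  qed
  show ?thesis using dzero a b c
    by (simp add: act_def distrib_left sum.distrib left_diff_distrib sum_subtractf)
qed

text \<open>The Leibniz rule for a contraction of \<open>tau\<close> with a parallel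
  \<open>w\<close>: the derivative falls on \<open>tau\<close> alone.\<close>

lemma cov_deriv_contract1:
  fixes G :: "'n::finite \<Rightarrow> 'n \<Rightarrow> real"
  assumes G: "\<And>i j. G i j = - G j i"
    and A: "\<And>i j k. A i j k = r * (\<Sum>a\<in>UNIV. tau i a * w a j k)"
    and dA: "\<And>i j k. dA i j k = r * (\<Sum>a\<in>UNIV. dt i a * w a j k + tau i a * act G w a j k)"
  shows "dA i j k - (\<Sum>l\<in>UNIV. G i l * A l j k) - (\<Sum>l\<in>UNIV. G j l * A i l k) - (\<Sum>l\<in>UNIV. G k l * A i j l)
     = r * (\<Sum>a\<in>UNIV. (dt i a - (\<Sum>n\<in>UNIV. G i n * tau n a) - (\<Sum>n\<in>UNIV. G a n * tau i n)) * w a j k)"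
proof -
  have p: "(\<Sum>a\<in>UNIV. y a * (\<Sum>l\<in>UNIV. x l * v l a)) = (\<Sum>l\<in>UNIV. x l * (\<Sum>a\<in>UNIV. y a * v l a))"
    for x y and v :: "'n \<Rightarrow> 'n \<Rightarrow> real"
    by (simp add: sum_distrib_left, subst sum.swap) (simp add: mult.left_commute)
  have a: "(\<Sum>a\<in>UNIV. tau i a * (\<Sum>l\<in>UNIV. G a l * w l j k))
      = - (\<Sum>a\<in>UNIV. (\<Sum>n\<in>UNIV. G a n * tau i n) * w a j k)"
  proof -
    have "(\<Sum>a\<in>UNIV. tau i a * (\<Sum>l\<in>UNIV. G a l * w l j k))
       = (\<Sum>l\<in>UNIV. \<Sum>a\<in>UNIV. tau i a * (G a l * w l j k))"
      by (simp add: sum_distrib_left) (rule sum.swap)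
    also have "\<dots> = (\<Sum>l\<in>UNIV. \<Sum>a\<in>UNIV. - (G l a * tau i a) * w l j k)"
      by (subst G) (simp add: mult_ac)
    finally show ?thesis by (simp add: sum_distrib_right sum_negf)
  qed
  have q: "(\<Sum>l\<in>UNIV. x l * (r * f l)) = r * (\<Sum>l\<in>UNIV. x l * f l)" for x f :: "'n \<Rightarrow> real"
    by (simp add: sum_distrib_left mult.left_commute)
  have b: "(\<Sum>l\<in>UNIV. G i l * (\<Sum>a\<in>UNIV. tau l a * w a j k)) = (\<Sum>a\<in>UNIV. (\<Sum>n\<in>UNIV. G i n * tau n a) * w a j k)"
    by (rule sum_pull[symmetric])
  show ?thesis
    unfolding A dA q act_def b[symmetric]
    by (simp add: distrib_left sum.distrib left_diff_distrib right_diff_distrib sum_subtractf a b p[of "tau i" "G j"] p[of "tau i" "G k"])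
qed

text \<open>The classical curvature components in a non-coordinate orthonormal frame:
  \<open>G\<close> holds the connection coefficients, \<open>c\<close> the structure functions of
  the frame, and \<open>dG s\<close> the derivatives of \<open>G\<close> along the frame vector
  \<open>s\<close>. Treating the derivatives as independent data makes the comparison of curvatures
  pure algebra at one point.\<close>

definition frame_curv ::
    "('n::finite \<Rightarrow> 'n \<Rightarrow> 'n \<Rightarrow> 'n \<Rightarrow> real) \<Rightarrow> ('n \<Rightarrow> 'n \<Rightarrow> 'n \<Rightarrow> real) \<Rightarrow> ('n \<Rightarrow> 'n \<Rightarrow> 'n \<Rightarrow> real) \<Rightarrow>
     'n \<Rightarrow> 'n \<Rightarrow> 'n \<Rightarrow> 'n \<Rightarrow> real" where
  "frame_curv dG G c s i j k = dG s i j k - dG i s j k + (\<Sum>l\<in>UNIV. G i j l * G s l k)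
     - (\<Sum>l\<in>UNIV. G s j l * G i l k) - (\<Sum>l\<in>UNIV. c s i l * G l j k)"

lemma frame_curv_swap:
  assumes "\<And>i j k. c i j k = - c j i k"
  shows "frame_curv dG G c s i j k = - frame_curv dG G c i s j k"
  by (simp add: frame_curv_def assms[of s i] sum_negf)

lemma frame_curv_antisym:
  assumes "\<And>i j k. G i j k = - G i k j" "\<And>s i j k. dG s i j k = - dG s i k j"
  shows "frame_curv dG G c s i j k = - frame_curv dG G c s i k j"
proof -
  have "(\<Sum>l\<in>UNIV. G i k l * G s l j) = (\<Sum>l\<in>UNIV. G s j l * G i l k)" for s i j k
    by (subst assms(1), subst (2) assms(1)) (simp add: mult.commute)
  moreover have "(\<Sum>l\<in>UNIV. c s i l * G l j k) = - (\<Sum>l\<in>UNIV. c s i l * G l k j)"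
    by (subst assms(1)) (simp add: sum_negf)
  ultimately show ?thesis
    using assms(2)[of s i j k] assms(2)[of i s j k] by (simp add: frame_curv_def)
qed

text \<open>\<open>X\<close> is the covariant derivative of \<open>A\<close> for the connection
  \<open>H\<close>. As \<open>c\<close> is the torsion-free bracket for \<open>G\<close>, the skew
  part of \<open>A\<close> in its first two indices is the torsion of \<open>H\<close> and produces
  the first product term; the other two are the commutator of \<open>A\<close> with itself. It is
  applied with \<open>G\<close> Levi-Civita and \<open>H\<close> canonical.\<close>

lemma frame_curv_shift:
  assumes G: "\<And>i j k. G i j k = H i j k - A i j k" and dG: "\<And>s i j k. dG s i j k = dH s i j k - dA s i j k"
    and H: "\<And>i j k. H i j k = - H i k j"
    and c: "\<And>i j k. c i j k = G i j k - G j i k"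
    and cov: "\<And>s i j k. X s i j k = dA s i j k - (\<Sum>l\<in>UNIV. H s i l * A l j k)
       - (\<Sum>l\<in>UNIV. H s j l * A i l k) - (\<Sum>l\<in>UNIV. H s k l * A i j l)"
  shows "frame_curv dG G c s i j k = frame_curv dH H c s i j k - X s i j k + X i s j k
     - (\<Sum>l\<in>UNIV. (A s i l - A i s l) * A l j k)
     + (\<Sum>l\<in>UNIV. A i j l * A s l k) - (\<Sum>l\<in>UNIV. A s j l * A i l k)"
proof -
  have h: "(\<Sum>l\<in>UNIV. H s k l * A i j l) = - (\<Sum>l\<in>UNIV. A i j l * H s l k)" for s i j
    by (subst H) (simp add: sum_negf mult.commute)
  have "(\<Sum>l\<in>UNIV. c s i l * G l j k) = (\<Sum>l\<in>UNIV. c s i l * H l j k) - (\<Sum>l\<in>UNIV. H s i l * A l j k)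
     + (\<Sum>l\<in>UNIV. H i s l * A l j k) + (\<Sum>l\<in>UNIV. (A s i l - A i s l) * A l j k)"
    by (simp add: c G algebra_simps sum.distrib sum_subtractf)
  moreover have "(\<Sum>l\<in>UNIV. G i j l * G s l k) = (\<Sum>l\<in>UNIV. H i j l * H s l k) - (\<Sum>l\<in>UNIV. H i j l * A s l k)
     - (\<Sum>l\<in>UNIV. A i j l * H s l k) + (\<Sum>l\<in>UNIV. A i j l * A s l k)" for s i
    by (simp add: G algebra_simps sum.distrib sum_subtractf)
  ultimately show ?thesis
    by (simp add: frame_curv_def dG cov h)
qed

section \<open>The orthogonal orbit of the model form\<close>

lemma sum_prod3:
  fixes x y z :: "'n::finite \<Rightarrow> real"
  shows "(\<Sum>a\<in>UNIV. x a) * ((\<Sum>b\<in>UNIV. y b) * (\<Sum>c\<in>UNIV. z c))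
    = (\<Sum>a\<in>UNIV. \<Sum>b\<in>UNIV. \<Sum>c\<in>UNIV. x a * (y b * z c))"
  by (simp add: sum_distrib_right) (simp add: sum_distrib_left)

text \<open>Converse of \<open>act_14\<close>. By \<open>act_antisym\<close> the hypothesis says
  that a vector contracted with \<open>psi\<close> is zero, and \<open>psi_psi3\<close> shows this
  contraction to be injective.\<close>

lemma g2_tensor_zero:
  assumes "g2_tensor w" "\<And>i j. B i j = - B j i" "\<And>b c d. act B w b c d = 0"
  shows "(\<Sum>k\<in>UNIV. \<Sum>l\<in>UNIV. B k l * w k l m) = 0"
proof -
  interpret g2_tensor w by fact
  define r where "r n = (\<Sum>k\<in>UNIV. \<Sum>l\<in>UNIV. B k l * w k l n)" for n
  have "(\<Sum>n\<in>UNIV. r n * psi n b c d) = 0" for b c d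
    using act_antisym[where B = B and b = b and c = c and d = d, OF assms(2)] assms(3)[of b c d] by (simp add: r_def)
  then have "0 = (\<Sum>b\<in>UNIV. \<Sum>c\<in>UNIV. \<Sum>d\<in>UNIV. (\<Sum>n\<in>UNIV. r n * psi n b c d) * psi m b c d)"
    by simp
  also have "\<dots> = 24 * r m" by (simp only: sum_pull3 psi_psi3) simp
  finally show ?thesis by (simp add: r_def)
qed

lemma g2_model_expand:
  fixes \<theta> :: "7 \<Rightarrow> 'v \<Rightarrow> real"
  shows "g2_model \<theta> u v w
    = (\<Sum>a\<in>UNIV. \<Sum>b\<in>UNIV. \<Sum>c\<in>UNIV. (\<theta> a u * (\<theta> b v * \<theta> c w)) * g2_model kd a b c)"
proof -
  have m: "(\<Sum>a\<in>UNIV. \<Sum>b\<in>UNIV. \<Sum>c\<in>UNIV. (\<theta> a u * (\<theta> b v * \<theta> c w)) * (kd i a * (kd j b * kd k c)))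
     = \<theta> i u * (\<theta> j v * \<theta> k w)"
    "(\<Sum>a\<in>UNIV. \<Sum>b\<in>UNIV. \<Sum>c\<in>UNIV. (\<theta> a u * (\<theta> b v * \<theta> c w)) * (kd i a * (kd j c * kd k b)))
     = \<theta> i u * (\<theta> j w * \<theta> k v)"
    "(\<Sum>a\<in>UNIV. \<Sum>b\<in>UNIV. \<Sum>c\<in>UNIV. (\<theta> a u * (\<theta> b v * \<theta> c w)) * (kd i b * (kd j a * kd k c)))
     = \<theta> i v * (\<theta> j u * \<theta> k w)"
    "(\<Sum>a\<in>UNIV. \<Sum>b\<in>UNIV. \<Sum>c\<in>UNIV. (\<theta> a u * (\<theta> b v * \<theta> c w)) * (kd i b * (kd j c * kd k a)))
     = \<theta> i v * (\<theta> j w * \<theta> k u)"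
    "(\<Sum>a\<in>UNIV. \<Sum>b\<in>UNIV. \<Sum>c\<in>UNIV. (\<theta> a u * (\<theta> b v * \<theta> c w)) * (kd i c * (kd j a * kd k b)))
     = \<theta> i w * (\<theta> j u * \<theta> k v)"
    "(\<Sum>a\<in>UNIV. \<Sum>b\<in>UNIV. \<Sum>c\<in>UNIV. (\<theta> a u * (\<theta> b v * \<theta> c w)) * (kd i c * (kd j b * kd k a)))
     = \<theta> i w * (\<theta> j v * \<theta> k u)" for i j k
    using sum_prod3[of "\<lambda>a. \<theta> a u * kd i a" "\<lambda>b. \<theta> b v * kd j b" "\<lambda>c. \<theta> c w * kd k c"]
      sum_prod3[of "\<lambda>a. \<theta> a u * kd i a" "\<lambda>b. \<theta> b v * kd k b" "\<lambda>c. \<theta> c w * kd j c"]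
      sum_prod3[of "\<lambda>a. \<theta> a u * kd j a" "\<lambda>b. \<theta> b v * kd i b" "\<lambda>c. \<theta> c w * kd k c"]
      sum_prod3[of "\<lambda>a. \<theta> a u * kd k a" "\<lambda>b. \<theta> b v * kd i b" "\<lambda>c. \<theta> c w * kd j c"]
      sum_prod3[of "\<lambda>a. \<theta> a u * kd j a" "\<lambda>b. \<theta> b v * kd k b" "\<lambda>c. \<theta> c w * kd i c"]
      sum_prod3[of "\<lambda>a. \<theta> a u * kd k a" "\<lambda>b. \<theta> b v * kd j b" "\<lambda>c. \<theta> c w * kd i c"]
    by (simp_all only: sum_kd) (simp_all only: mult_ac)
  have "(\<Sum>a\<in>UNIV. \<Sum>b\<in>UNIV. \<Sum>c\<in>UNIV. (\<theta> a u * (\<theta> b v * \<theta> c w)) * wedge3 (kd i) (kd j) (kd k) a b c)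
     = wedge3 (\<theta> i) (\<theta> j) (\<theta> k) u v w" for i j k
    unfolding wedge3_expand by (simp only: distrib_left right_diff_distrib sum.distrib sum_subtractf m)
  then show ?thesis
    unfolding g2_model_def by (simp only: distrib_left sum.distrib)
qed

text \<open>For a square matrix orthonormal columns force orthonormal rows. Hence
  \<open>coass\<close> of the rotated form is the rotated \<open>coass\<close> of the model, and
  skewness is inherited.\<close>

lemma g2_model_orthogonal:
  fixes Q :: "7 \<Rightarrow> 7 \<Rightarrow> real"
  assumes Q: "\<And>i j. (\<Sum>a\<in>UNIV. Q a i * Q a j) = kd i j"
  shows "(\<Sum>m\<in>UNIV. Q a m * Q b m) = kd a b" and "g2_tensor (g2_model Q)"
proof -
  define M :: "real^7^7" where "M = (\<chi> a i. Q a i)"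
  have "transpose M ** M = mat 1"
    using Q by (simp add: M_def matrix_matrix_mult_def transpose_def mat_def vec_eq_iff kd_def)
  then have "M ** transpose M = mat 1" by (simp add: matrix_left_right_inverse)
  then have "(\<Sum>m\<in>UNIV. Q a m * Q b m) = (mat 1 :: real^7^7) $ a $ b" for a b
    by (auto simp: M_def matrix_matrix_mult_def transpose_def vec_eq_iff)
  then show QQ: "(\<Sum>m\<in>UNIV. Q a m * Q b m) = kd a b" for a b
    by (simp add: mat_def kd_def)
  define ph :: "7 \<Rightarrow> 7 \<Rightarrow> 7 \<Rightarrow> real" where "ph = g2_model kd"
  \<comment> \<open>\<open>V\<close> rotates two slots only. The rotations of the third slots cancel
    in a contraction because the rows of \<open>Q\<close> are orthonormal.\<close>
  define V where "V i j e = (\<Sum>a\<in>UNIV. \<Sum>b\<in>UNIV. (Q a i * Q b j) * ph a b e)" for i j e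
  have w: "g2_model Q i j m = (\<Sum>e\<in>UNIV. V i j e * Q e m)" for i j m
    unfolding V_def ph_def sum_pull_pair by (simp add: g2_model_expand[of Q i] sum_distrib_left mult_ac)
  have VV: "(\<Sum>m\<in>UNIV. g2_model Q i j m * g2_model Q k l m) = (\<Sum>e\<in>UNIV. V i j e * V k l e)" for i j k l
  proof -
    have inner: "(\<Sum>m\<in>UNIV. Q e m * g2_model Q k l m) = V k l e" for e
    proof -
      have "(\<Sum>m\<in>UNIV. g2_model Q k l m * Q e m) = (\<Sum>f\<in>UNIV. V k l f * kd f e)"
        unfolding w[of k l] sum_pull QQ ..
      then show ?thesis by (simp add: mult.commute)
    qed
    have "(\<Sum>m\<in>UNIV. g2_model Q i j m * g2_model Q k l m)
       = (\<Sum>e\<in>UNIV. V i j e * (\<Sum>m\<in>UNIV. Q e m * g2_model Q k l m))"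
      unfolding w[of i j] by (rule sum_pull)
    then show ?thesis unfolding inner .
  qed
  have kQ: "(\<Sum>a\<in>UNIV. \<Sum>b\<in>UNIV. (Q a i * Q b j) * (Q a k * Q b l)) = kd i k * kd j l" for i j k l
  proof -
    have "(\<Sum>a\<in>UNIV. \<Sum>b\<in>UNIV. (Q a i * Q b j) * (Q a k * Q b l))
       = (\<Sum>a\<in>UNIV. \<Sum>b\<in>UNIV. (Q a i * Q a k) * (Q b j * Q b l))"
      by (simp add: mult_ac)
    also have "\<dots> = (\<Sum>a\<in>UNIV. Q a i * Q a k) * (\<Sum>b\<in>UNIV. Q b j * Q b l)"
      by (rule sum_product[symmetric])
    finally show ?thesis unfolding Q .
  qed
  have co: "coass (g2_model Q) i j k l
      = (\<Sum>a\<in>UNIV. \<Sum>b\<in>UNIV. (Q a i * Q b j) * (\<Sum>c\<in>UNIV. \<Sum>d\<in>UNIV. (Q c k * Q d l) * coass ph a b c d))" for i j k l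
  proof -
    have pp: "(\<Sum>e\<in>UNIV. ph c d e * ph a b e) = coass ph a b c d + kd a c * kd b d - kd a d * kd b c" for a b c d
      by (simp add: coass_def mult.commute)
    have kd4: "(\<Sum>d\<in>UNIV. x d * (y d * (z d * kd b d))) = x b * (y b * z b)" for x y z and b :: 7
      using sum_kd(3)[where i = b and f = "\<lambda>d. x d * (y d * z d)"] by (simp add: mult.assoc)
    have qq: "(\<Sum>c\<in>UNIV. \<Sum>d\<in>UNIV. (Q c k * Q d l) * (coass ph a b c d + kd a c * kd b d - kd a d * kd b c))
       = (\<Sum>c\<in>UNIV. \<Sum>d\<in>UNIV. (Q c k * Q d l) * coass ph a b c d) + Q a k * Q b l - Q a l * Q b k" for a b
      by (simp add: distrib_left right_diff_distrib sum.distrib sum_subtractf mult.assoc kd4)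
    have vv: "(\<Sum>e\<in>UNIV. ph a b e * V k l e) = (\<Sum>c\<in>UNIV. \<Sum>d\<in>UNIV. (Q c k * Q d l) * (\<Sum>e\<in>UNIV. ph c d e * ph a b e))" for a b
      using sum_pull_pair[of "\<lambda>c d. Q c k * Q d l" ph "ph a b"] by (simp add: V_def mult.commute)
    have "(\<Sum>e\<in>UNIV. V i j e * V k l e) = (\<Sum>a\<in>UNIV. \<Sum>b\<in>UNIV. (Q a i * Q b j) * (\<Sum>e\<in>UNIV. ph a b e * V k l e))"
      unfolding V_def[of i j] by (rule sum_pull_pair)
    also have "\<dots> = (\<Sum>a\<in>UNIV. \<Sum>b\<in>UNIV. (Q a i * Q b j) * (\<Sum>c\<in>UNIV. \<Sum>d\<in>UNIV. (Q c k * Q d l) * coass ph a b c d))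
       + (\<Sum>a\<in>UNIV. \<Sum>b\<in>UNIV. (Q a i * Q b j) * (Q a k * Q b l)) - (\<Sum>a\<in>UNIV. \<Sum>b\<in>UNIV. (Q a i * Q b j) * (Q a l * Q b k))"
      unfolding vv pp qq by (simp only: distrib_left right_diff_distrib sum.distrib sum_subtractf)
    finally show ?thesis by (simp add: coass_def[of "g2_model Q"] VV kQ)
  qed
  interpret p: g2_tensor ph unfolding ph_def by (rule g2_model_tensor)
  show "g2_tensor (g2_model Q)"
  proof
    fix i j k l
    show "g2_model Q i j k = - g2_model Q j i k" "g2_model Q i j k = - g2_model Q i k j"
      by (simp_all add: g2_model_def wedge3_expand)
    have "coass (g2_model Q) i j k l
      = (\<Sum>a\<in>UNIV. \<Sum>b\<in>UNIV. \<Sum>c\<in>UNIV. \<Sum>d\<in>UNIV. Q a i * (Q b j * (Q c k * (Q d l * coass ph a b c d))))"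
      by (simp add: co sum_distrib_left mult_ac)
    also have "\<dots> = (\<Sum>a\<in>UNIV. \<Sum>c\<in>UNIV. \<Sum>b\<in>UNIV. \<Sum>d\<in>UNIV. Q a i * (Q b j * (Q c k * (Q d l * coass ph a b c d))))"
      by (intro sum.cong refl sum.swap)
    also have "\<dots> = - coass (g2_model Q) i k j l"
      by (subst p.psi23) (simp add: co sum_distrib_left sum_negf mult_ac)
    finally show "coass (g2_model Q) i j k l = - coass (g2_model Q) i k j l" .
  qed
qed

section \<open>Smooth functions and tangent vectors\<close>

lemma has_derivative_cong_open:
  assumes "open S" "x \<in> S" "\<And>y. y \<in> S \<Longrightarrow> f y = g y"
  shows "(f has_derivative D) (at x) \<longleftrightarrow> (g has_derivative D) (at x)"
  using has_derivative_transform_within_open[of f D x UNIV S g]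
    has_derivative_transform_within_open[of g D x UNIV S f] assms by auto

lemma frechet_derivative_cong_open:
  assumes "open S" "x \<in> S" "\<And>y. y \<in> S \<Longrightarrow> f y = g y"
  shows "frechet_derivative f (at x) = frechet_derivative g (at x)"
  unfolding frechet_derivative_def using has_derivative_cong_open[OF assms] by simp

lemma frechet_derivative_plus_fun:
  assumes "f differentiable (at x)" "g differentiable (at x)"
  shows "frechet_derivative (\<lambda>y. f y + g y) (at x)
       = (\<lambda>h. frechet_derivative f (at x) h + frechet_derivative g (at x) h)"
  by (rule frechet_derivative_at[symmetric], rule has_derivative_add)
    (use assms frechet_derivative_works in blast)+

lemma Ck_on_cong:
  assumes "open S" "\<And>x. x \<in> S \<Longrightarrow> f x = g x"
  shows "Ck_on k S f \<longleftrightarrow> Ck_on k S g"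
  using assms(2)
proof (induction k arbitrary: f g)
  case 0
  then show ?case by (auto cong: continuous_on_cong)
next
  case (Suc k)
  have "f differentiable (at x) \<longleftrightarrow> g differentiable (at x)" if "x \<in> S" for x
    unfolding differentiable_def using has_derivative_cong_open[OF assms(1) that Suc.prems] by simp
  moreover have "Ck_on k S (partial_deriv i f) \<longleftrightarrow> Ck_on k S (partial_deriv i g)" for i
    by (rule Suc.IH)
      (simp add: partial_deriv_def frechet_derivative_cong_open[OF assms(1) _ Suc.prems])
  ultimately show ?case by simp
qed

lemma Ck_on_subset: "Ck_on k S f \<Longrightarrow> T \<subseteq> S \<Longrightarrow> Ck_on k T f"
  by (induction k arbitrary: f) (auto intro: continuous_on_subset)

lemma Ck_on_SucD: "Ck_on (Suc k) S f \<Longrightarrow> Ck_on k S f"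
proof (induction k arbitrary: f)
  case 0
  then show ?case
    by (auto intro!: continuous_at_imp_continuous_on differentiable_imp_continuous_within)
next
  case (Suc k)
  then show ?case by (metis Ck_on.simps(2))
qed

lemma Ck_on_const: "Ck_on k S (\<lambda>x. c)"
proof (induction k arbitrary: c)
  case (Suc k)
  have "partial_deriv i (\<lambda>x::real^'a. c) = (\<lambda>x. 0)" for i
    by (simp add: partial_deriv_def fun_eq_iff)
  then show ?case using Suc by simp
qed simp

lemma Ck_on_add:
  assumes "open S"
  shows "Ck_on k S f \<Longrightarrow> Ck_on k S g \<Longrightarrow> Ck_on k S (\<lambda>x. f x + g x)"
proof (induction k arbitrary: f g)
  case 0
  then show ?case by (auto intro: continuous_on_add)
next
  case (Suc k)
  have "Ck_on k S (partial_deriv i (\<lambda>x. f x + g x))" for i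
  proof -
    have "partial_deriv i (\<lambda>x. f x + g x) x = partial_deriv i f x + partial_deriv i g x" if "x \<in> S" for x
      using Suc.prems that by (simp add: partial_deriv_def frechet_derivative_plus_fun)
    then have "Ck_on k S (partial_deriv i (\<lambda>x. f x + g x)) \<longleftrightarrow> Ck_on k S (\<lambda>x. partial_deriv i f x + partial_deriv i g x)"
      by (rule Ck_on_cong[OF assms])
    then show ?thesis using Suc by simp
  qed
  then show ?case using Suc.prems by simp
qed

lemma Ck_on_mult:
  fixes f g :: "real^'n \<Rightarrow> real"
  assumes "open S"
  shows "Ck_on k S f \<Longrightarrow> Ck_on k S g \<Longrightarrow> Ck_on k S (\<lambda>x. f x * g x)"
proof (induction k arbitrary: f g)
  case 0
  then show ?case by (auto intro: continuous_on_mult)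
next
  case (Suc k)
  have "Ck_on k S (partial_deriv i (\<lambda>x. f x * g x))" for i
  proof -
    have "partial_deriv i (\<lambda>x. f x * g x) x = f x * partial_deriv i g x + partial_deriv i f x * g x"
      if "x \<in> S" for x
    proof -
      have "(f has_derivative frechet_derivative f (at x)) (at x)"
        "(g has_derivative frechet_derivative g (at x)) (at x)"
        using Suc.prems that by (simp_all add: frechet_derivative_works[symmetric])
      from frechet_derivative_at[OF has_derivative_mult[OF this]] show ?thesis
        by (simp add: partial_deriv_def fun_eq_iff)
    qed
    then have cong: "Ck_on k S (partial_deriv i (\<lambda>x. f x * g x)) \<longleftrightarrow> Ck_on k S (\<lambda>x. f x * partial_deriv i g x + partial_deriv i f x * g x)"
      by (rule Ck_on_cong[OF assms])
    have "Ck_on k S (\<lambda>x. f x * partial_deriv i g x + partial_deriv i f x * g x)"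
    proof -
      \<comment> \<open>The product rule also leaves undifferentiated factors, whose order must drop
        by one before the induction hypothesis applies.\<close>
      have "Ck_on k S f" "Ck_on k S g" using Suc.prems Ck_on_SucD by blast+
      moreover have "Ck_on k S (partial_deriv i f)" "Ck_on k S (partial_deriv i g)"
        using Suc.prems by simp_all
      ultimately show ?thesis by (intro Ck_on_add[OF assms] Suc.IH)
    qed
    then show ?thesis unfolding cong .
  qed
  then show ?case using Suc.prems by (simp add: differentiable_mult)
qed

section \<open>Smooth functions on the manifold\<close>

locale smooth_manifold =
  fixes A :: "('a::topological_space) chart set"
  assumes atlas: "smooth_atlas A"
begin

lemma chart:
  assumes "(U, \<phi>) \<in> A"
  shows chart_open: "open U" and "open (\<phi> ` U)" "homeomorphism U (\<phi> ` U) \<phi> (inv_into U \<phi>)"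
proof -
  have "is_chart (U, \<phi>)" using atlas assms unfolding smooth_atlas_def by blast
  then show "open U" "open (\<phi> ` U)" "homeomorphism U (\<phi> ` U) \<phi> (inv_into U \<phi>)"
    by (simp_all add: is_chart_def)
qed

lemma chart_inv: "(U, \<phi>) \<in> A \<Longrightarrow> x \<in> U \<Longrightarrow> inv_into U \<phi> (\<phi> x) = x"
  by (rule homeomorphism_apply1[OF chart(3)])

lemma chart_open_image: 
  assumes "(U, \<phi>) \<in> A" "open W"
  shows "open (\<phi> ` (U \<inter> W))"
proof -
  have "openin (top_of_set (\<phi> ` U)) (\<phi> ` (U \<inter> W))"
    by (rule homeomorphism_imp_open_map[OF chart(3)[OF assms(1)]]) (use assms(2) in auto)
  then show ?thesis using chart(2)[OF assms(1)] openin_open_trans by blast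
qed

lemma chart_at: obtains U \<phi> where "(U, \<phi>) \<in> A" "p \<in> U"
  using atlas unfolding smooth_atlas_def by (metis (mono_tags, lifting) case_prodE)

lemma smooth_fun_on_iff:
  "smooth_fun_on A W f \<longleftrightarrow> open W \<and> (\<forall>U \<phi> k. (U, \<phi>) \<in> A \<longrightarrow> Ck_on k (\<phi> ` (U \<inter> W)) (f \<circ> inv_into U \<phi>))"
  unfolding smooth_fun_on_def Cinf_on_def by blast

lemma smooth_fun_on_open: "smooth_fun_on A W f \<Longrightarrow> open W"
  unfolding smooth_fun_on_def by blast

lemma smooth_fun_on_subset:
  "smooth_fun_on A W f \<Longrightarrow> open V \<Longrightarrow> V \<subseteq> W \<Longrightarrow> smooth_fun_on A V f"
  unfolding smooth_fun_on_iff by (meson Ck_on_subset Int_mono image_mono order_refl)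

lemma smooth_fun_on_cong:
  assumes "\<And>q. q \<in> W \<Longrightarrow> f q = h q"
  shows "smooth_fun_on A W f \<longleftrightarrow> smooth_fun_on A W h"
proof -
  have "Ck_on k (\<phi> ` (U \<inter> W)) (f \<circ> inv_into U \<phi>) \<longleftrightarrow> Ck_on k (\<phi> ` (U \<inter> W)) (h \<circ> inv_into U \<phi>)"
    if "(U, \<phi>) \<in> A" "open W" for U \<phi> k
    by (rule Ck_on_cong) (use that assms in \<open>auto simp: chart_open_image chart_inv\<close>)
  then show ?thesis unfolding smooth_fun_on_iff by blast
qed

lemma smooth_fun_on_const: "open W \<Longrightarrow> smooth_fun_on A W (\<lambda>q. c)"
  unfolding smooth_fun_on_iff by (simp add: comp_def Ck_on_const)

lemma smooth_fun_on_add: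
  assumes "smooth_fun_on A W f" "smooth_fun_on A W h"
  shows "smooth_fun_on A W (\<lambda>q. f q + h q)"
proof -
  have "Ck_on k (\<phi> ` (U \<inter> W)) ((\<lambda>q. f q + h q) \<circ> inv_into U \<phi>)" if "(U, \<phi>) \<in> A" for U \<phi> k
    using Ck_on_add[of "\<phi> ` (U \<inter> W)" k "f \<circ> inv_into U \<phi>" "h \<circ> inv_into U \<phi>"] that assms
    unfolding smooth_fun_on_iff by (simp add: chart_open_image comp_def)
  then show ?thesis using assms unfolding smooth_fun_on_iff by blast
qed

lemma smooth_fun_on_mult:
  assumes "smooth_fun_on A W f" "smooth_fun_on A W h"
  shows "smooth_fun_on A W (\<lambda>q. f q * h q)"
proof -
  have "Ck_on k (\<phi> ` (U \<inter> W)) ((\<lambda>q. f q * h q) \<circ> inv_into U \<phi>)" if "(U, \<phi>) \<in> A" for U \<phi> k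
    using Ck_on_mult[of "\<phi> ` (U \<inter> W)" k "f \<circ> inv_into U \<phi>" "h \<circ> inv_into U \<phi>"] that assms
    unfolding smooth_fun_on_iff by (simp add: chart_open_image comp_def)
  then show ?thesis using assms unfolding smooth_fun_on_iff by blast
qed

lemma smooth_fun_on_sum:
  assumes "open W" "\<And>i. i \<in> I \<Longrightarrow> smooth_fun_on A W (f i)"
  shows "smooth_fun_on A W (\<lambda>q. \<Sum>i\<in>I. f i q)"
  using assms(2)
  by (induction I rule: infinite_finite_induct)
    (auto simp: smooth_fun_on_const assms(1) intro: smooth_fun_on_add)

lemma smooth_fun_on_uminus: "smooth_fun_on A W f \<Longrightarrow> smooth_fun_on A W (\<lambda>q. - f q)"
  using smooth_fun_on_mult[of W "\<lambda>q. -1" f] smooth_fun_on_const[of W "-1"]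
  by (auto simp: smooth_fun_on_def)

lemma smooth_fun_on_diff:
  "smooth_fun_on A W f \<Longrightarrow> smooth_fun_on A W h \<Longrightarrow> smooth_fun_on A W (\<lambda>q. f q - h q)"
  using smooth_fun_on_add[of W f "\<lambda>q. - h q"] smooth_fun_on_uminus[of W h] by simp

lemma smooth_at_cong:
  assumes "open V" "p \<in> V" "\<And>q. q \<in> V \<Longrightarrow> f q = h q"
  shows "smooth_at A p f \<longleftrightarrow> smooth_at A p h"
proof -
  have "smooth_at A p h'" if f': "smooth_at A p f'" and eq: "\<And>q. q \<in> V \<Longrightarrow> f' q = h' q" for f' h'
  proof -
    obtain W where W: "p \<in> W" "smooth_fun_on A W f'" using f' unfolding smooth_at_def by auto
    then have "smooth_fun_on A (W \<inter> V) f'"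
      using smooth_fun_on_subset[OF W(2), of "W \<inter> V"] smooth_fun_on_open[OF W(2)] assms(1) by blast
    then have "smooth_fun_on A (W \<inter> V) h'"
      using smooth_fun_on_cong[of "W \<inter> V" f' h'] eq by auto
    then show ?thesis unfolding smooth_at_def using W(1) assms(2) by auto
  qed
  from this[of f h] this[of h f] show ?thesis using assms(3) by auto
qed

lemma smooth_at_diff:
  assumes "smooth_at A p f" "(U, \<phi>) \<in> A" "p \<in> U"
  shows "(f \<circ> inv_into U \<phi>) differentiable (at (\<phi> p))"
proof -
  obtain W where W: "p \<in> W" "smooth_fun_on A W f" using assms(1) unfolding smooth_at_def by auto
  then have "Ck_on 1 (\<phi> ` (U \<inter> W)) (f \<circ> inv_into U \<phi>)"
    using assms(2) unfolding smooth_fun_on_iff by blast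
  then show ?thesis using W assms(3) by auto
qed

lemma smooth_at_common:
  assumes "smooth_at A p f" "smooth_at A p h"
  obtains W where "p \<in> W" "smooth_fun_on A W f" "smooth_fun_on A W h"
proof -
  obtain V W where "p \<in> V" "smooth_fun_on A V f" "p \<in> W" "smooth_fun_on A W h"
    using assms unfolding smooth_at_def by auto
  moreover from this have "open (V \<inter> W)" unfolding smooth_fun_on_def by blast
  ultimately show ?thesis
    using that[of "V \<inter> W"] smooth_fun_on_subset[of V f "V \<inter> W"] smooth_fun_on_subset[of W h "V \<inter> W"] by simp
qed

lemma smooth_at_add: "smooth_at A p f \<Longrightarrow> smooth_at A p h \<Longrightarrow> smooth_at A p (\<lambda>q. f q + h q)"
  by (erule (1) smooth_at_common) (auto simp: smooth_at_def intro: smooth_fun_on_add)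

lemma smooth_at_mult: "smooth_at A p f \<Longrightarrow> smooth_at A p h \<Longrightarrow> smooth_at A p (\<lambda>q. f q * h q)"
  by (erule (1) smooth_at_common) (auto simp: smooth_at_def intro: smooth_fun_on_mult)

lemma smooth_at_const: "smooth_at A p (\<lambda>q. c)"
  unfolding smooth_at_def using smooth_fun_on_const[of UNIV c] by auto

section \<open>Tangent vectors as local derivations\<close>

lemma tangent_cases:
  assumes "u \<in> tangent_space A p"
  obtains U \<phi> w where "(U, \<phi>) \<in> A" "p \<in> U" "u = coord_vector A (U, \<phi>) p w"
  using assms unfolding tangent_space_def by (auto simp: split_paired_all)

text \<open>The derivative in a chart and the test that selects the default value 0 both depend only
  on the function near \<open>p\<close>.\<close>

lemma tangent_cong:
  assumes u: "u \<in> tangent_space A p" and V: "open V" "p \<in> V" "\<And>q. q \<in> V \<Longrightarrow> f q = h q"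
  shows "u f = u h"
  using u
proof (rule tangent_cases)
  fix U \<phi> w assume c: "(U, \<phi>) \<in> A" "p \<in> U" "u = coord_vector A (U, \<phi>) p w"
  have "frechet_derivative (f \<circ> inv_into U \<phi>) (at (\<phi> p)) = frechet_derivative (h \<circ> inv_into U \<phi>) (at (\<phi> p))"
    by (rule frechet_derivative_cong_open[of "\<phi> ` (U \<inter> V)"])
      (use c V in \<open>auto simp: chart_open_image chart_inv\<close>)
  then show ?thesis using smooth_at_cong[OF V] by (simp add: c(3) coord_vector_def)
qed

lemma tangent_add:
  assumes "u \<in> tangent_space A p" "smooth_at A p f" "smooth_at A p h"
  shows "u (\<lambda>q. f q + h q) = u f + u h"
  using assms(1)
proof (rule tangent_cases)
  fix U \<phi> w assume c: "(U, \<phi>) \<in> A" "p \<in> U" "u = coord_vector A (U, \<phi>) p w"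
  show ?thesis
    using frechet_derivative_plus_fun[OF smooth_at_diff[OF assms(2) c(1,2)] smooth_at_diff[OF assms(3) c(1,2)]]
    by (simp add: c(3) coord_vector_def assms smooth_at_add comp_def)
qed

lemma tangent_mult:
  assumes "u \<in> tangent_space A p" "smooth_at A p f" "smooth_at A p h"
  shows "u (\<lambda>q. f q * h q) = f p * u h + u f * h p"
  using assms(1)
proof (rule tangent_cases)
  fix U \<phi> w assume c: "(U, \<phi>) \<in> A" "p \<in> U" "u = coord_vector A (U, \<phi>) p w"
  have "((f \<circ> inv_into U \<phi>) has_derivative frechet_derivative (f \<circ> inv_into U \<phi>) (at (\<phi> p))) (at (\<phi> p))"
    "((h \<circ> inv_into U \<phi>) has_derivative frechet_derivative (h \<circ> inv_into U \<phi>) (at (\<phi> p))) (at (\<phi> p))"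
    using smooth_at_diff[OF _ c(1,2)] assms(2,3) frechet_derivative_works by blast+
  from frechet_derivative_at[OF has_derivative_mult[OF this]] show ?thesis
    by (simp add: c(3) coord_vector_def assms smooth_at_mult comp_def chart_inv[OF c(1,2)] fun_eq_iff)
qed

lemma tangent_const: "u \<in> tangent_space A p \<Longrightarrow> u (\<lambda>q. c) = 0"
  by (erule tangent_cases) (simp add: coord_vector_def comp_def)

lemma tangent_sum:
  assumes "u \<in> tangent_space A p" "\<And>i. i \<in> I \<Longrightarrow> smooth_at A p (f i)"
  shows "u (\<lambda>q. \<Sum>i\<in>I. f i q) = (\<Sum>i\<in>I. u (f i))" "smooth_at A p (\<lambda>q. \<Sum>i\<in>I. f i q)"
  using assms(2)
  by (induction I rule: infinite_finite_induct)
    (auto simp: tangent_const[OF assms(1)] smooth_at_const tangent_add[OF assms(1)] smooth_at_add)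

lemma tangent_uminus:
  assumes "u \<in> tangent_space A p" "smooth_at A p f"
  shows "u (\<lambda>q. - f q) = - u f"
  using tangent_mult[OF assms(1) smooth_at_const[of p "-1"] assms(2)] tangent_const[OF assms(1)] by simp

lemma tangent_diff:
  assumes "u \<in> tangent_space A p" "smooth_at A p f" "smooth_at A p h"
  shows "u (\<lambda>q. f q - h q) = u f - u h"
  using tangent_add[OF assms(1,2), of "\<lambda>q. - h q"] tangent_uminus[OF assms(1,3)]
    smooth_at_mult[OF smooth_at_const[of p "-1"] assms(3)] by simp

text \<open>By the chain rule the derivative of the transition map carries components in one chart
  to components in another. Vectors given in different charts can thus be added in a common
  one.\<close>

lemma tangent_chart:
  assumes "u \<in> tangent_space A p" "(U, \<phi>) \<in> A" "p \<in> U"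
  obtains w where "u = coord_vector A (U, \<phi>) p w"
  using assms(1)
proof (rule tangent_cases)
  fix V \<psi> w assume c: "(V, \<psi>) \<in> A" "p \<in> V" "u = coord_vector A (V, \<psi>) p w"
  let ?t = "\<phi> \<circ> inv_into V \<psi>"
  have "Ck_on 1 (\<psi> ` (V \<inter> U)) ?t"
    using atlas assms(2) c(1) unfolding smooth_atlas_def Cinf_on_def by blast
  then have "?t differentiable (at (\<psi> p))" using c assms(3) by auto
  then have t: "(?t has_derivative frechet_derivative ?t (at (\<psi> p))) (at (\<psi> p))"
    using frechet_derivative_works by blast
  have tp: "?t (\<psi> p) = \<phi> p" by (simp add: chart_inv[OF c(1,2)])
  have "u f = coord_vector A (U, \<phi>) p (frechet_derivative ?t (at (\<psi> p)) w) f" for f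
  proof (cases "smooth_at A p f")
    case True
    let ?f = "f \<circ> inv_into U \<phi>"
    have "(?f has_derivative frechet_derivative ?f (at (\<phi> p))) (at (?t (\<psi> p)))"
      using smooth_at_diff[OF True assms(2,3)] frechet_derivative_works tp by metis
    from diff_chain_at[OF t this]
    have "((?f \<circ> ?t) has_derivative frechet_derivative ?f (at (\<phi> p)) \<circ> frechet_derivative ?t (at (\<psi> p))) (at (\<psi> p))" .
    then have "((f \<circ> inv_into V \<psi>) has_derivative frechet_derivative ?f (at (\<phi> p)) \<circ> frechet_derivative ?t (at (\<psi> p))) (at (\<psi> p))"
      by (rule has_derivative_transform_within_open[of _ _ _ _ "\<psi> ` (V \<inter> U)"])
        (use c assms(2,3) in \<open>auto simp: chart_open_image chart_open chart_inv\<close>)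
    from frechet_derivative_at[OF this] show ?thesis
      using True by (simp add: c(3) coord_vector_def fun_eq_iff)
  qed (simp add: c(3) coord_vector_def)
  then show ?thesis using that by blast
qed

lemma coord_vector_lin:
  assumes "(U, \<phi>) \<in> A" "p \<in> U"
  shows "coord_vector A (U, \<phi>) p (a *\<^sub>R v + b *\<^sub>R w) f
     = a * coord_vector A (U, \<phi>) p v f + b * coord_vector A (U, \<phi>) p w f"
proof (cases "smooth_at A p f")
  case True
  have "linear (frechet_derivative (f \<circ> inv_into U \<phi>) (at (\<phi> p)))"
    using smooth_at_diff[OF True assms] by (rule linear_frechet_derivative)
  then show ?thesis using True by (simp add: coord_vector_def linear_add linear_cmul)
qed (simp add: coord_vector_def)

lemma coord_vector_sum:
  assumes "(U, \<phi>) \<in> A" "p \<in> U"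
  shows "coord_vector A (U, \<phi>) p (\<Sum>i\<in>I. a i *\<^sub>R w i) f = (\<Sum>i\<in>I. a i * coord_vector A (U, \<phi>) p (w i) f)"
proof (cases "smooth_at A p f")
  case True
  have "linear (frechet_derivative (f \<circ> inv_into U \<phi>) (at (\<phi> p)))"
    using smooth_at_diff[OF True assms] by (rule linear_frechet_derivative)
  then show ?thesis using True by (simp add: coord_vector_def linear_sum linear_cmul)
qed (simp add: coord_vector_def)

lemma coord_vector_tangent: "(U, \<phi>) \<in> A \<Longrightarrow> p \<in> U \<Longrightarrow> coord_vector A (U, \<phi>) p w \<in> tangent_space A p"
  unfolding tangent_space_def by force

lemma tangent_comb:
  assumes "u \<in> tangent_space A p" "v \<in> tangent_space A p"
  shows "(\<lambda>f. a * u f + b * v f) \<in> tangent_space A p"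
proof -
  obtain U \<phi> where c: "(U, \<phi>) \<in> A" "p \<in> U" by (rule chart_at)
  obtain x y where "u = coord_vector A (U, \<phi>) p x" "v = coord_vector A (U, \<phi>) p y"
    using tangent_chart[OF _ c] assms by metis
  then have "(\<lambda>f. a * u f + b * v f) = coord_vector A (U, \<phi>) p (a *\<^sub>R x + b *\<^sub>R y)"
    by (intro ext) (simp add: coord_vector_lin[OF c])
  then show ?thesis using coord_vector_tangent[OF c] by simp
qed

lemma tangent_sum_mem:
  assumes "\<And>i. i \<in> I \<Longrightarrow> e i \<in> tangent_space A p"
  shows "(\<lambda>f. \<Sum>i\<in>I. a i * e i f) \<in> tangent_space A p"
  using assms
proof (induction I rule: infinite_finite_induct)
  case (insert x F)
  then show ?case using tangent_comb[of "e x" p "\<lambda>f. \<Sum>i\<in>F. a i * e i f" "a x" 1] by simp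
next
  obtain U \<phi> where c: "(U, \<phi>) \<in> A" "p \<in> U" by (rule chart_at)
  have z: "(\<lambda>f. 0) \<in> tangent_space A p"
    using tangent_comb[OF coord_vector_tangent[OF c] coord_vector_tangent[OF c], of 0 _ 0] by simp
  { case empty show ?case using z by simp }
  { case (infinite I) show ?case using z infinite by simp }
qed

lemma linear_at_comb:
  "linear_at A p \<alpha> \<Longrightarrow> u \<in> tangent_space A p \<Longrightarrow> v \<in> tangent_space A p \<Longrightarrow>
    \<alpha> (\<lambda>f. a * u f + b * v f) = a * \<alpha> u + b * \<alpha> v"
  unfolding linear_at_def by blast

lemma linear_at_zero: "linear_at A p \<alpha> \<Longrightarrow> \<alpha> (\<lambda>f. 0) = 0"
proof -
  assume a: "linear_at A p \<alpha>"
  obtain U \<phi> where c: "(U, \<phi>) \<in> A" "p \<in> U" by (rule chart_at)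
  show ?thesis
    using linear_at_comb[OF a coord_vector_tangent[OF c] coord_vector_tangent[OF c], of 0 _ 0] by simp
qed

lemma linear_at_sum:
  assumes "linear_at A p \<alpha>" "\<And>i. i \<in> I \<Longrightarrow> e i \<in> tangent_space A p"
  shows "\<alpha> (\<lambda>f. \<Sum>i\<in>I. a i * e i f) = (\<Sum>i\<in>I. a i * \<alpha> (e i))"
  using assms(2)
proof (induction I rule: infinite_finite_induct)
  case (insert x F)
  then show ?case
    using linear_at_comb[OF assms(1), of "e x" "\<lambda>f. \<Sum>i\<in>F. a i * e i f" "a x" 1] by (simp add: tangent_sum_mem)
qed (simp_all add: linear_at_zero[OF assms(1)])

text \<open>Seven orthonormal vectors span because charts take values in \<open>\<real>\<^sup>7\<close>.\<close>

lemma orthonormal_expand: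
  fixes e :: "7 \<Rightarrow> 'a tangent"
  assumes lin: "\<And>v. v \<in> tangent_space A p \<Longrightarrow> linear_at A p (\<lambda>u. \<beta> u v)"
    and e: "\<And>i. e i \<in> tangent_space A p" and on: "\<And>i j. \<beta> (e i) (e j) = (if i = j then 1 else 0)"
    and u: "u \<in> tangent_space A p"
  shows "u = (\<lambda>f. \<Sum>i\<in>UNIV. \<beta> u (e i) * e i f)"
proof -
  obtain U \<phi> where c: "(U, \<phi>) \<in> A" "p \<in> U" by (rule chart_at)
  have "\<exists>w. e i = coord_vector A (U, \<phi>) p w" for i using tangent_chart[OF e c] by metis
  then obtain w where w: "\<And>i. e i = coord_vector A (U, \<phi>) p (w i)" by metis
  obtain x where x: "u = coord_vector A (U, \<phi>) p x" using tangent_chart[OF u c] by metis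
  \<comment> \<open>\<open>M\<close> sends frame coefficients to chart components. The pairing
    \<open>\<beta>\<close> recovers the coefficients, so \<open>M\<close> is injective, and on a
    space of dimension seven it is then onto.\<close>
  define M where "M a = (\<Sum>i\<in>UNIV. (a $ i) *\<^sub>R w i)" for a :: "real^7"
  have M: "coord_vector A (U, \<phi>) p (M a) f = (\<Sum>i\<in>UNIV. a $ i * e i f)" for a f
    unfolding M_def coord_vector_sum[OF c] w ..
  have coef: "\<beta> (\<lambda>f. \<Sum>i\<in>UNIV. a $ i * e i f) (e j) = a $ j" for a :: "real^7" and j
    by (subst linear_at_sum[OF lin[OF e]]) (simp_all add: e on if_distrib cong: if_cong)
  have lM: "linear M"
    unfolding M_def by (intro linearI) (simp_all add: scaleR_add_left sum.distrib scaleR_sum_right)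
  have "inj M"
  proof (subst linear_injective_0[OF lM], intro allI impI)
    fix a assume "M a = 0"
    have "coord_vector A (U, \<phi>) p (0::real^7) f = 0" for f
      using coord_vector_lin[OF c, of 0 0 0 0 f] by simp
    then have "(\<lambda>f. \<Sum>i\<in>UNIV. a $ i * e i f) = (\<lambda>f. 0)"
      using M[of a] \<open>M a = 0\<close> by simp
    then have "a $ j = 0" for j
      using coef[of a j] linear_at_zero[OF lin[OF e[of j]]] by simp
    then show "a = 0" by (simp add: vec_eq_iff)
  qed
  then have "surj M" using linear_injective_imp_surjective[OF lM] by simp
  then obtain a where "x = M a" by (metis surjD)
  then have ua: "u = (\<lambda>f. \<Sum>i\<in>UNIV. a $ i * e i f)" using M x by auto
  then have "\<beta> u (e j) = a $ j" for j using coef by simp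
  then show ?thesis using ua by simp
qed

end

section \<open>Connections in an orthonormal frame\<close>

context smooth_manifold
begin

lemma smooth_fun_on_at: "smooth_fun_on A W f \<Longrightarrow> p \<in> W \<Longrightarrow> smooth_at A p f"
  unfolding smooth_at_def by blast

lemma vf_open: "vector_field_on A U X \<Longrightarrow> open U"
  unfolding vector_field_on_def by blast

lemma vf_tangent: "vector_field_on A U X \<Longrightarrow> p \<in> U \<Longrightarrow> X p \<in> tangent_space A p"
  unfolding vector_field_on_def by blast

lemma vf_smooth:
  "vector_field_on A U X \<Longrightarrow> smooth_fun_on A V f \<Longrightarrow> V \<subseteq> U \<Longrightarrow> smooth_fun_on A V (\<lambda>p. X p f)"
  unfolding vector_field_on_def by blast

lemma vf_subset: "vector_field_on A U X \<Longrightarrow> open V \<Longrightarrow> V \<subseteq> U \<Longrightarrow> vector_field_on A V X"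
  unfolding vector_field_on_def by (meson subset_iff order_trans)

lemma vf_cong:
  assumes "vector_field_on A U X" "\<And>p. p \<in> U \<Longrightarrow> X p = Y p"
  shows "vector_field_on A U Y"
  unfolding vector_field_on_def
proof (intro conjI ballI allI impI)
  show "open U" using vf_open[OF assms(1)] .
  show "Y p \<in> tangent_space A p" if "p \<in> U" for p
    using vf_tangent[OF assms(1) that] assms(2)[OF that] by simp
  fix V f assume V: "V \<subseteq> U \<and> smooth_fun_on A V f"
  then have "smooth_fun_on A V (\<lambda>p. X p f)" using vf_smooth[OF assms(1)] by blast
  moreover have "X p f = Y p f" if "p \<in> V" for p
  proof -
    have "p \<in> U" using V that by blast
    from assms(2)[OF this] show ?thesis by simp
  qed
  ultimately show "smooth_fun_on A V (\<lambda>p. Y p f)"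
    using smooth_fun_on_cong[of V "\<lambda>p. X p f" "\<lambda>p. Y p f"] by blast
qed

lemma vf_sum:
  assumes "open U" "\<And>i. i \<in> I \<Longrightarrow> vector_field_on A U (X i)" "\<And>i. i \<in> I \<Longrightarrow> smooth_fun_on A U (h i)"
  shows "vector_field_on A U (\<lambda>p f. \<Sum>i\<in>I. h i p * X i p f)"
  unfolding vector_field_on_def
proof (intro conjI ballI allI impI)
  show "open U" by fact
  show "(\<lambda>f. \<Sum>i\<in>I. h i p * X i p f) \<in> tangent_space A p" if "p \<in> U" for p
    by (rule tangent_sum_mem) (rule vf_tangent[OF assms(2) that])
  fix V f assume V: "V \<subseteq> U \<and> smooth_fun_on A V f"
  then have "open V" using smooth_fun_on_open by blast
  then show "smooth_fun_on A V (\<lambda>p. \<Sum>i\<in>I. h i p * X i p f)"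
  proof (rule smooth_fun_on_sum)
    fix i assume i: "i \<in> I"
    have "smooth_fun_on A V (h i)" using smooth_fun_on_subset[OF assms(3)[OF i] \<open>open V\<close>] V by blast
    moreover have "smooth_fun_on A V (\<lambda>p. X i p f)" using vf_smooth[OF assms(2)[OF i]] V by blast
    ultimately show "smooth_fun_on A V (\<lambda>p. h i p * X i p f)" by (rule smooth_fun_on_mult)
  qed
qed

lemma vf_vf_scale:
  assumes "vector_field_on A U X" "smooth_fun_on A U h"
  shows "vector_field_on A U (vf_scale h X)"
  using vf_sum[of U "{()}" "\<lambda>_. X" "\<lambda>_. h"] assms vf_open[OF assms(1)] by (simp add: vf_scale_def)

lemma vf_vf_add:
  assumes "vector_field_on A U X" "vector_field_on A U Y"
  shows "vector_field_on A U (vf_add X Y)"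
  using vf_sum[of U "UNIV :: bool set" "\<lambda>b. if b then X else Y" "\<lambda>_ _. 1"] assms vf_open[OF assms(1)]
    smooth_fun_on_const[of U 1]
  by (simp add: vf_add_def UNIV_bool add.commute)

lemma vf_vf_diff:
  assumes "vector_field_on A U X" "vector_field_on A U Y"
  shows "vector_field_on A U (vf_diff X Y)"
proof -
  have "vf_diff X Y = vf_add X (vf_scale (\<lambda>_. -1) Y)"
    by (simp add: vf_diff_def vf_add_def vf_scale_def)
  then show ?thesis
    using vf_vf_add[OF assms(1) vf_vf_scale[OF assms(2) smooth_fun_on_const[OF vf_open[OF assms(1)]]]] by simp
qed

lemma lie_bracket_eval: "smooth_at A p f \<Longrightarrow> lie_bracket A X Y p f = X p (\<lambda>q. Y q f) - Y p (\<lambda>q. X q f)"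
  by (simp add: lie_bracket_def)

lemma lie_bracket_jacobi:
  assumes X: "vector_field_on A U X" and Y: "vector_field_on A U Y" and Z: "vector_field_on A U Z" and p: "p \<in> U"
  shows "lie_bracket A X (lie_bracket A Y Z) p f + lie_bracket A Y (lie_bracket A Z X) p f
    + lie_bracket A Z (lie_bracket A X Y) p f = 0"
proof (cases "smooth_at A p f")
  case True
  then obtain W where W: "p \<in> W" "smooth_fun_on A W f" unfolding smooth_at_def by blast
  \<comment> \<open>On \<open>V\<close> the function and all its iterated derivatives along the
    fields are smooth, so the nested brackets unfold to genuine commutators instead of the default
    0.\<close>
  define V where "V = W \<inter> U"
  have V: "open V" "p \<in> V" "V \<subseteq> U" "smooth_fun_on A V f"
    using W p smooth_fun_on_open[OF W(2)] vf_open[OF X] smooth_fun_on_subset[OF W(2), of V] by (auto simp: V_def)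
  have one: "lie_bracket A P (lie_bracket A Q R) p f
     = (P p (\<lambda>q. Q q (\<lambda>r. R r f)) - P p (\<lambda>q. R q (\<lambda>r. Q r f)))
       - (Q p (\<lambda>q. R q (\<lambda>r. P r f)) - R p (\<lambda>q. Q q (\<lambda>r. P r f)))"
    if vf: "vector_field_on A U P" "vector_field_on A U Q" "vector_field_on A U R" for P Q R
  proof -
    have s1: "smooth_fun_on A V (\<lambda>r. S r f)" if "vector_field_on A U S" for S
      using vf_smooth[OF that V(4) V(3)] .
    have s2: "smooth_fun_on A V (\<lambda>q. T q (\<lambda>r. S r f))"
      if "vector_field_on A U S" "vector_field_on A U T" for S T
      using vf_smooth[OF that(2) s1[OF that(1)] V(3)] .
    have "P p (\<lambda>q. lie_bracket A Q R q f) = P p (\<lambda>q. Q q (\<lambda>r. R r f) - R q (\<lambda>r. Q r f))"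
      by (rule tangent_cong[OF vf_tangent[OF vf(1) p] V(1,2)])
        (rule lie_bracket_eval[OF smooth_fun_on_at[OF V(4)]])
    also have "\<dots> = P p (\<lambda>q. Q q (\<lambda>r. R r f)) - P p (\<lambda>q. R q (\<lambda>r. Q r f))"
      by (rule tangent_diff[OF vf_tangent[OF vf(1) p]])
        (rule smooth_fun_on_at[OF s2[OF vf(3,2)] V(2)], rule smooth_fun_on_at[OF s2[OF vf(2,3)] V(2)])
    finally show ?thesis
      using lie_bracket_eval[OF True, of P "lie_bracket A Q R"]
        lie_bracket_eval[OF smooth_fun_on_at[OF s1[OF vf(1)] V(2)], of Q R] by simp
  qed
  show ?thesis using one[OF X Y Z] one[OF Y Z X] one[OF Z X Y] by simp
qed (simp add: lie_bracket_def)

end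

section \<open>Rules for an affine connection\<close>

locale affine_manifold = smooth_manifold A for A :: "('a::topological_space) chart set" +
  fixes D :: "'a vfield \<Rightarrow> 'a vfield \<Rightarrow> 'a vfield"
  assumes conn: "affine_connection A D"
begin

lemmas conn_clauses = conn[unfolded affine_connection_def]

lemma D_cong:
  assumes "vector_field_on A U X" "vector_field_on A U Y" "vector_field_on A U X'" "vector_field_on A U Y'"
    and "\<And>p. p \<in> U \<Longrightarrow> X p = X' p" "\<And>p. p \<in> U \<Longrightarrow> Y p = Y' p" "p \<in> U"
  shows "D X Y p = D X' Y' p"
  by (rule conn_clauses[THEN conjunct1, rule_format, OF _ assms(7)]) (intro conjI ballI assms)

lemma D_vf: "vector_field_on A U X \<Longrightarrow> vector_field_on A U Y \<Longrightarrow> vector_field_on A U (D X Y)"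
  by (rule conn_clauses[THEN conjunct2, THEN conjunct1, rule_format]) (rule conjI)

lemma D_add1: "vector_field_on A U X \<Longrightarrow> vector_field_on A U X' \<Longrightarrow> vector_field_on A U Y \<Longrightarrow> p \<in> U \<Longrightarrow>
    D (vf_add X X') Y p = vf_add (D X Y) (D X' Y) p"
  by (rule conn_clauses[THEN conjunct2, THEN conjunct2, THEN conjunct1, rule_format, of U]) (intro conjI)

lemma D_add2: "vector_field_on A U X \<Longrightarrow> vector_field_on A U Y \<Longrightarrow> vector_field_on A U Y' \<Longrightarrow> p \<in> U \<Longrightarrow>
    D X (vf_add Y Y') p = vf_add (D X Y) (D X Y') p"
  by (rule conn_clauses[THEN conjunct2, THEN conjunct2, THEN conjunct2, THEN conjunct1, rule_format, of U])
    (intro conjI)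

lemma D_scale:
  assumes "vector_field_on A U X" "vector_field_on A U Y" "smooth_fun_on A U h" "p \<in> U"
  shows D_scale1: "D (vf_scale h X) Y p = vf_scale h (D X Y) p"
    and D_scale2: "D X (vf_scale h Y) p = vf_add (vf_scale (\<lambda>q. X q h) Y) (vf_scale h (D X Y)) p"
  using conn_clauses[THEN conjunct2, THEN conjunct2, THEN conjunct2, THEN conjunct2, rule_format,
      OF conjI[OF assms(1) conjI[OF assms(2,3)]] assms(4)] by (rule conjunct1, rule conjunct2)

lemma D_diff2:
  assumes "vector_field_on A U X" "vector_field_on A U Y" "vector_field_on A U Y'" "p \<in> U"
  shows "D X (vf_diff Y Y') p f = D X Y p f - D X Y' p f"
proof -
  have sm: "smooth_fun_on A U (\<lambda>_. -1)" by (rule smooth_fun_on_const[OF vf_open[OF assms(1)]])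
  have "vf_diff Y Y' = vf_add Y (vf_scale (\<lambda>_. -1) Y')"
    by (simp add: vf_diff_def vf_add_def vf_scale_def)
  then have "D X (vf_diff Y Y') p = vf_add (D X Y) (D X (vf_scale (\<lambda>_. -1) Y')) p"
    using D_add2[OF assms(1,2) vf_vf_scale[OF assms(3) sm] assms(4)] by simp
  then show ?thesis
    using D_scale2[OF assms(1,3) sm assms(4)] tangent_const[OF vf_tangent[OF assms(1,4)]]
    by (simp add: vf_add_def vf_scale_def)
qed

lemma D_sum1:
  assumes "finite I" "vector_field_on A U Y" "p \<in> U"
    and "\<And>i. i \<in> I \<Longrightarrow> vector_field_on A U (X i)" "\<And>i. i \<in> I \<Longrightarrow> smooth_fun_on A U (h i)"
  shows "D (\<lambda>q f. \<Sum>i\<in>I. h i q * X i q f) Y p = (\<lambda>f. \<Sum>i\<in>I. h i p * D (X i) Y p f)"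
  using assms(1,4,5)
proof (induction I)
  case empty
  have "(\<lambda>q f. 0) = vf_scale (\<lambda>_. 0) Y" by (simp add: vf_scale_def)
  then show ?case
    using D_scale1[OF assms(2,2) smooth_fun_on_const[OF vf_open[OF assms(2)]] assms(3), of 0]
    by (simp add: vf_scale_def)
next
  case (insert x F)
  have op: "open U" using vf_open[OF assms(2)] .
  have x: "vector_field_on A U (X x)" "smooth_fun_on A U (h x)" using insert.prems by blast+
  have F: "vector_field_on A U (\<lambda>q f. \<Sum>i\<in>F. h i q * X i q f)"
    by (rule vf_sum[OF op]) (use insert.prems in blast)+
  have "(\<lambda>q f. \<Sum>i\<in>insert x F. h i q * X i q f) = vf_add (vf_scale (h x) (X x)) (\<lambda>q f. \<Sum>i\<in>F. h i q * X i q f)"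
    using insert.hyps by (simp add: vf_add_def vf_scale_def)
  then have "D (\<lambda>q f. \<Sum>i\<in>insert x F. h i q * X i q f) Y p
     = vf_add (D (vf_scale (h x) (X x)) Y) (D (\<lambda>q f. \<Sum>i\<in>F. h i q * X i q f) Y) p"
    using D_add1[OF vf_vf_scale[OF x] F assms(2,3)] by simp
  then show ?case
    using D_scale1[OF x(1) assms(2) x(2) assms(3)] insert.IH insert.prems insert.hyps
    by (simp add: vf_add_def vf_scale_def)
qed

end

text \<open>These hypotheses hold for the Levi-Civita and for the canonical connection, so one
  curvature formula serves both; torsion-freeness enters only in \<open>levi_civita_frame\<close>.
  The clause \<open>bracket\<close> will come from the Levi-Civita connection, whose skew part is
  the bracket.\<close>

locale metric_frame = affine_manifold A D
  for A :: "('a::topological_space) chart set" and D +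
  fixes g :: "'a \<Rightarrow> 'a tangent \<Rightarrow> 'a tangent \<Rightarrow> real" and U :: "'a set" and e :: "7 \<Rightarrow> 'a vfield"
  assumes riem: "riemannian_metric A g"
    and frame: "orthonormal_frame A g U e"
    and compat: "\<And>Y Z i q. vector_field_on A U Y \<Longrightarrow> vector_field_on A U Z \<Longrightarrow> q \<in> U \<Longrightarrow>
      e i q (\<lambda>r. g r (Y r) (Z r)) = g q (D (e i) Y q) (Z q) + g q (Y q) (D (e i) Z q)"
    and bracket: "\<And>i j. vector_field_on A U (lie_bracket A (e i) (e j))"
begin

definition Gam :: "7 \<Rightarrow> 7 \<Rightarrow> 7 \<Rightarrow> 'a \<Rightarrow> real" where "Gam i j k q = g q (D (e i) (e j) q) (e k q)"

definition cc :: "7 \<Rightarrow> 7 \<Rightarrow> 7 \<Rightarrow> 'a \<Rightarrow> real" where "cc i j k q = g q (lie_bracket A (e i) (e j) q) (e k q)"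

lemma e_vf: "vector_field_on A U (e i)"
  using frame unfolding orthonormal_frame_def by blast

lemma e_tangent: "q \<in> U \<Longrightarrow> e i q \<in> tangent_space A q"
  by (rule vf_tangent[OF e_vf])

lemma U_open: "open U" by (rule vf_open[OF e_vf])

lemma e_on: "q \<in> U \<Longrightarrow> g q (e i q) (e j q) = (if i = j then 1 else 0)"
  using frame unfolding orthonormal_frame_def by blast

lemma g_lin2: "u \<in> tangent_space A q \<Longrightarrow> linear_at A q (g q u)"
  using riem unfolding riemannian_metric_def by blast

lemma g_sym: "u \<in> tangent_space A q \<Longrightarrow> v \<in> tangent_space A q \<Longrightarrow> g q u v = g q v u"
  using riem unfolding riemannian_metric_def by blast

lemma g_smooth: "vector_field_on A V X \<Longrightarrow> vector_field_on A V Y \<Longrightarrow> smooth_fun_on A V (\<lambda>p. g p (X p) (Y p))"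
  using riem unfolding riemannian_metric_def by blast

lemma g_lin1: "v \<in> tangent_space A q \<Longrightarrow> linear_at A q (\<lambda>u. g q u v)"
  unfolding linear_at_def
proof (intro ballI allI)
  fix u u' a b assume v: "v \<in> tangent_space A q" and u: "u \<in> tangent_space A q" "u' \<in> tangent_space A q"
  have "g q (\<lambda>f. a * u f + b * u' f) v = g q v (\<lambda>f. a * u f + b * u' f)"
    by (rule g_sym[OF tangent_comb[OF u] v])
  then show "g q (\<lambda>f. a * u f + b * u' f) v = a * g q u v + b * g q u' v"
    using linear_at_comb[OF g_lin2[OF v] u] g_sym[OF v u(1)] g_sym[OF v u(2)] by simp
qed

lemma expand: "q \<in> U \<Longrightarrow> u \<in> tangent_space A q \<Longrightarrow> u = (\<lambda>f. \<Sum>i\<in>UNIV. g q u (e i q) * e i q f)"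
  by (rule orthonormal_expand) (simp_all add: g_lin1 e_tangent e_on)

lemma linear_expand:
  assumes "q \<in> U" "u \<in> tangent_space A q" "linear_at A q \<alpha>"
  shows "\<alpha> u = (\<Sum>l\<in>UNIV. g q u (e l q) * \<alpha> (e l q))"
  by (subst expand[OF assms(1,2)], rule linear_at_sum[OF assms(3)]) (rule e_tangent[OF assms(1)])

lemma Gam_smooth: "smooth_fun_on A U (Gam i j k)"
  unfolding Gam_def[abs_def] by (intro g_smooth D_vf e_vf)

lemma cc_smooth: "smooth_fun_on A U (cc i j k)"
  unfolding cc_def[abs_def] by (intro g_smooth bracket e_vf)

lemma e_smooth: "smooth_fun_on A U f \<Longrightarrow> smooth_fun_on A U (\<lambda>q. e i q f)"
  using vf_smooth[OF e_vf] by blast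

lemma D_tangent: "vector_field_on A U X \<Longrightarrow> vector_field_on A U Y \<Longrightarrow> q \<in> U \<Longrightarrow> D X Y q \<in> tangent_space A q"
  by (rule vf_tangent[OF D_vf])

lemma Gam_antisym:
  assumes q: "q \<in> U"
  shows "Gam i j k q = - Gam i k j q"
proof -
  have "e i q (\<lambda>r. g r (e j r) (e k r)) = e i q (\<lambda>r. if j = k then 1 else 0)"
    by (rule tangent_cong[OF e_tangent[OF q] U_open q]) (simp add: e_on)
  then have "g q (D (e i) (e j) q) (e k q) + g q (e j q) (D (e i) (e k) q) = 0"
    using compat[OF e_vf e_vf q, of i j k] tangent_const[OF e_tangent[OF q]] by simp
  then show ?thesis
    using g_sym[OF e_tangent[OF q, of j] D_tangent[OF e_vf e_vf q, of i k]] by (simp add: Gam_def)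
qed

lemma commutator:
  assumes "smooth_fun_on A U f" "q \<in> U"
  shows "e s q (\<lambda>r. e i r f) - e i q (\<lambda>r. e s r f) = (\<Sum>l\<in>UNIV. cc s i l q * e l q f)"
proof -
  have "lie_bracket A (e s) (e i) q f = (\<Sum>l\<in>UNIV. cc s i l q * e l q f)"
    unfolding cc_def using expand[OF assms(2) vf_tangent[OF bracket assms(2)], of s i] by metis
  then show ?thesis using lie_bracket_eval[OF smooth_fun_on_at[OF assms]] by simp
qed

text \<open>Metric compatibility moves the outer derivative onto the coefficients
  \<open>Gam\<close>, and expanding in the frame gives the products. The bracket term uses linearity
  of \<open>D\<close> over functions in its first argument.\<close>

lemma curv_comp_frame:
  assumes q: "q \<in> U"
  shows "curv_comp A g D e s i j k q
    = frame_curv (\<lambda>s i j k. e s q (Gam i j k)) (\<lambda>i j k. Gam i j k q) (\<lambda>i j k. cc i j k q) s i j k"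
proof -
  have DD: "g q (D (e s) (D (e i) (e j)) q) (e k q) = e s q (Gam i j k) + (\<Sum>l\<in>UNIV. Gam i j l q * Gam s l k q)" for s i
  proof -
    have l: "g q (e l q) (D (e s) (e k) q) = - Gam s l k q" for l
      using g_sym[OF e_tangent[OF q] D_tangent[OF e_vf e_vf q], of l s k] Gam_antisym[OF q, of s l k]
      by (simp add: Gam_def)
    have "e s q (Gam i j k) = g q (D (e s) (D (e i) (e j)) q) (e k q) + g q (D (e i) (e j) q) (D (e s) (e k) q)"
      using compat[OF D_vf[OF e_vf e_vf] e_vf q, of s i j k] unfolding Gam_def[abs_def] .
    also have "g q (D (e i) (e j) q) (D (e s) (e k) q)
       = (\<Sum>l\<in>UNIV. g q (D (e i) (e j) q) (e l q) * g q (e l q) (D (e s) (e k) q))"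
      by (rule linear_expand[OF q D_tangent[OF e_vf e_vf q] g_lin1[OF D_tangent[OF e_vf e_vf q]]])
    finally show ?thesis unfolding l by (simp add: Gam_def[abs_def] sum_negf)
  qed
  have DB: "g q (D (lie_bracket A (e s) (e i)) (e j) q) (e k q) = (\<Sum>l\<in>UNIV. cc s i l q * Gam l j k q)"
  proof -
    \<comment> \<open>The expansion is needed on all of \<open>U\<close>, not only at
      \<open>q\<close>, because \<open>D\<close> acts on fields.\<close>
    have "lie_bracket A (e s) (e i) r = (\<lambda>f. \<Sum>l\<in>UNIV. cc s i l r * e l r f)" if "r \<in> U" for r
      unfolding cc_def by (rule expand[OF that vf_tangent[OF bracket that]])
    then have "D (lie_bracket A (e s) (e i)) (e j) q = D (\<lambda>r f. \<Sum>l\<in>UNIV. cc s i l r * e l r f) (e j) q"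
      by (intro D_cong[OF bracket e_vf _ e_vf _ _ q] vf_sum U_open e_vf cc_smooth) simp_all
    also have "\<dots> = (\<lambda>f. \<Sum>l\<in>UNIV. cc s i l q * D (e l) (e j) q f)"
      by (rule D_sum1[where U = U]) (simp_all add: e_vf q cc_smooth)
    finally have *: "D (lie_bracket A (e s) (e i)) (e j) q = \<dots>" .
    show ?thesis
      unfolding * Gam_def by (rule linear_at_sum[OF g_lin1[OF e_tangent[OF q]] D_tangent[OF e_vf e_vf q]])
  qed
  define u where "u = D (e s) (D (e i) (e j)) q"
  define v where "v = D (e i) (D (e s) (e j)) q"
  define w where "w = D (lie_bracket A (e s) (e i)) (e j) q"
  have t: "u \<in> tangent_space A q" "v \<in> tangent_space A q" "w \<in> tangent_space A q"
    unfolding u_def v_def w_def by (intro D_tangent D_vf e_vf bracket q)+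
  have "curvature A D (e s) (e i) (e j) q = (\<lambda>f. 1 * (1 * u f + -1 * v f) + -1 * w f)"
    by (simp add: curvature_def vf_diff_def u_def v_def w_def)
  then have "curv_comp A g D e s i j k q = 1 * (1 * g q u (e k q) + -1 * g q v (e k q)) + -1 * g q w (e k q)"
    unfolding curv_comp_def
    by (simp only: linear_at_comb[OF g_lin1[OF e_tangent[OF q]] tangent_comb[OF t(1,2)] t(3)]
        linear_at_comb[OF g_lin1[OF e_tangent[OF q]] t(1,2)])
  then show ?thesis
    by (simp add: u_def v_def w_def DD DB frame_curv_def)
qed

end

locale levi_civita_frame = metric_frame A D g U e
  for A :: "('a::topological_space) chart set" and D g U e +
  assumes torsion: "\<And>X Y p. vector_field_on A U X \<Longrightarrow> vector_field_on A U Y \<Longrightarrow> p \<in> U \<Longrightarrow>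
      vf_diff (D X Y) (D Y X) p = lie_bracket A X Y p"
begin

lemma cc_Gam:
  assumes q: "q \<in> U"
  shows "cc i j k q = Gam i j k q - Gam j i k q"
proof -
  have "lie_bracket A (e i) (e j) q = (\<lambda>f. 1 * D (e i) (e j) q f + -1 * D (e j) (e i) q f)"
    using torsion[OF e_vf e_vf q, of i j] by (simp add: vf_diff_def)
  then show ?thesis
    unfolding cc_def
    by (simp only: linear_at_comb[OF g_lin1[OF e_tangent[OF q]] D_tangent[OF e_vf e_vf q] D_tangent[OF e_vf e_vf q]])
       (simp add: Gam_def)
qed

text \<open>Torsion-freeness rewrites every bracket in the Jacobi identity through \<open>D\<close>,
  and the result is the cyclic sum of curvatures.\<close>

lemma bianchi:
  assumes q: "q \<in> U"
  shows "curv_comp A g D e i j k l q + curv_comp A g D e j k i l q + curv_comp A g D e k i j l q = 0"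
proof -
  have br: "D (e i) (lie_bracket A (e j) (e k)) q f = D (e i) (D (e j) (e k)) q f - D (e i) (D (e k) (e j)) q f" for i j k f
  proof -
    have "D (e i) (lie_bracket A (e j) (e k)) q = D (e i) (vf_diff (D (e j) (e k)) (D (e k) (e j))) q"
      by (rule D_cong[OF e_vf bracket e_vf vf_vf_diff[OF D_vf[OF e_vf e_vf] D_vf[OF e_vf e_vf]] _ _ q])
         (simp_all add: torsion e_vf)
    then show ?thesis
      using D_diff2[OF e_vf D_vf[OF e_vf e_vf] D_vf[OF e_vf e_vf] q, of i j k k j f] by simp
  qed
  have lb: "lie_bracket A (e i) (lie_bracket A (e j) (e k)) q f
     = D (e i) (D (e j) (e k)) q f - D (e i) (D (e k) (e j)) q f - D (lie_bracket A (e j) (e k)) (e i) q f" for i j k f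
    using torsion[OF e_vf bracket q, of i j k] br by (simp add: vf_diff_def fun_eq_iff)
  define C where "C i j k = curvature A D (e i) (e j) (e k) q" for i j k
  have C: "C i j k f + C j k i f + C k i j f = 0" for f
    using lie_bracket_jacobi[OF e_vf e_vf e_vf q, of i j k f] unfolding lb
    by (simp add: C_def curvature_def vf_diff_def)
  have t: "C i j k \<in> tangent_space A q" for i j k
    unfolding C_def curvature_def by (rule vf_tangent[OF _ q]) (intro vf_vf_diff D_vf e_vf bracket)
  have "(\<lambda>f. 1 * (1 * C i j k f + 1 * C j k i f) + 1 * C k i j f) = (\<lambda>f. 0)"
    using C by simp
  then have "1 * (1 * g q (C i j k) (e l q) + 1 * g q (C j k i) (e l q)) + 1 * g q (C k i j) (e l q) = 0"
    using linear_at_comb[OF g_lin1[OF e_tangent[OF q]] tangent_comb[OF t t] t, of 1 1 i j k 1 j k i 1 k i j l]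
      linear_at_comb[OF g_lin1[OF e_tangent[OF q]] t t] linear_at_zero[OF g_lin1[OF e_tangent[OF q]]]
    by metis
  then show ?thesis by (simp add: curv_comp_def C_def)
qed

end

section \<open>Closed G2-structures in an orthonormal frame\<close>

text \<open>The orbit of the model form under the orthogonal group has tangent vectors \<open>act S w\<close> with
  \<open>S\<close> skew.\<close>

lemma g2_model_derivative:
  fixes Q dQ :: "7 \<Rightarrow> 7 \<Rightarrow> real"
  assumes Q: "\<And>i j. (\<Sum>a\<in>UNIV. Q a i * Q a j) = kd i j"
    and dQ: "\<And>i j. (\<Sum>a\<in>UNIV. Q a i * dQ a j + dQ a i * Q a j) = 0"
  obtains S where "\<And>i j. S i j = - S j i"
    and "\<And>b c d. (\<Sum>x\<in>UNIV. \<Sum>y\<in>UNIV. \<Sum>z\<in>UNIV.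
      (Q x b * (Q y c * dQ z d + dQ y c * Q z d) + dQ x b * (Q y c * Q z d)) * g2_model kd x y z)
        = act S (g2_model Q) b c d"
proof
  define S where "S i m = (\<Sum>a\<in>UNIV. dQ a i * Q a m)" for i m
  show "S i j = - S j i" for i j
    using dQ[of i j] by (simp add: S_def sum.distrib mult.commute)
  have dS: "dQ x i = (\<Sum>m\<in>UNIV. S i m * Q x m)" for x i
    unfolding S_def sum_pull g2_model_orthogonal(1)[OF Q] by simp
  have tri: "g2_model Q i j k = (\<Sum>x\<in>UNIV. \<Sum>y\<in>UNIV. \<Sum>z\<in>UNIV. (Q x i * (Q y j * Q z k)) * g2_model kd x y z)" for i j k
    by (rule g2_model_expand)
  fix b c d
  have p1: "(\<Sum>x\<in>UNIV. \<Sum>y\<in>UNIV. \<Sum>z\<in>UNIV. (dQ x b * (Q y c * Q z d)) * g2_model kd x y z)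
     = (\<Sum>m\<in>UNIV. S b m * g2_model Q m c d)"
  proof -
    have "(\<Sum>x\<in>UNIV. \<Sum>y\<in>UNIV. \<Sum>z\<in>UNIV. (\<Sum>m\<in>UNIV. S b m * Q x m) * (Q y c * Q z d * g2_model kd x y z))
       = (\<Sum>m\<in>UNIV. S b m * (\<Sum>x\<in>UNIV. \<Sum>y\<in>UNIV. \<Sum>z\<in>UNIV. Q x m * (Q y c * Q z d * g2_model kd x y z)))"
      by (rule sum_pull3)
    then show ?thesis unfolding dS tri by (simp only: mult.assoc)
  qed
  have p2: "(\<Sum>x\<in>UNIV. \<Sum>y\<in>UNIV. \<Sum>z\<in>UNIV. (Q x b * (dQ y c * Q z d)) * g2_model kd x y z)
     = (\<Sum>m\<in>UNIV. S c m * g2_model Q b m d)"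
  proof -
    have "(\<Sum>x\<in>UNIV. \<Sum>y\<in>UNIV. \<Sum>z\<in>UNIV. (\<Sum>m\<in>UNIV. S c m * Q y m) * (Q x b * Q z d * g2_model kd x y z))
       = (\<Sum>m\<in>UNIV. S c m * (\<Sum>x\<in>UNIV. \<Sum>y\<in>UNIV. \<Sum>z\<in>UNIV. Q y m * (Q x b * Q z d * g2_model kd x y z)))"
      by (rule sum_pull3)
    then show ?thesis unfolding dS tri by (simp only: mult_ac)
  qed
  have p3: "(\<Sum>x\<in>UNIV. \<Sum>y\<in>UNIV. \<Sum>z\<in>UNIV. (Q x b * (Q y c * dQ z d)) * g2_model kd x y z)
     = (\<Sum>m\<in>UNIV. S d m * g2_model Q b c m)"
  proof -
    have "(\<Sum>x\<in>UNIV. \<Sum>y\<in>UNIV. \<Sum>z\<in>UNIV. (\<Sum>m\<in>UNIV. S d m * Q z m) * (Q x b * Q y c * g2_model kd x y z))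
       = (\<Sum>m\<in>UNIV. S d m * (\<Sum>x\<in>UNIV. \<Sum>y\<in>UNIV. \<Sum>z\<in>UNIV. Q z m * (Q x b * Q y c * g2_model kd x y z)))"
      by (rule sum_pull3)
    then show ?thesis unfolding dS tri by (simp only: mult_ac)
  qed
  show "(\<Sum>x\<in>UNIV. \<Sum>y\<in>UNIV. \<Sum>z\<in>UNIV.
      (Q x b * (Q y c * dQ z d + dQ y c * Q z d) + dQ x b * (Q y c * Q z d)) * g2_model kd x y z)
        = act S (g2_model Q) b c d"
    using p1 p2 p3 by (simp add: act_def distrib_left distrib_right sum.distrib)
qed

locale closed_g2_frame = levi_civita_frame A D g U e
  for A :: "('a::topological_space) chart set" and D g U e +
  fixes \<omega> :: "'a form3" and D' :: "'a vfield \<Rightarrow> 'a vfield \<Rightarrow> 'a vfield"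
  assumes g2: "g2_structure A \<omega>" and closed: "closed_form3 A \<omega>" and induced: "induced_metric A \<omega> g"
    and canonical: "canonical_connection A \<omega> g D D'"
begin

lemma three: "three_form A \<omega>" using g2 unfolding g2_structure_def by blast

lemma form_lin:
  assumes "u \<in> tangent_space A q" "v \<in> tangent_space A q"
  shows form_lin1: "linear_at A q (\<lambda>w. \<omega> q w u v)" and form_lin2: "linear_at A q (\<lambda>w. \<omega> q u w v)"
    and form_lin3: "linear_at A q (\<lambda>w. \<omega> q u v w)"
  using three assms unfolding three_form_def by blast+

lemma form_zero:
  assumes "u \<in> tangent_space A q" "v \<in> tangent_space A q"
  shows "\<omega> q u u v = 0" "\<omega> q v u u = 0"
  using three assms unfolding three_form_def by blast+

lemma form_smooth:
  "vector_field_on A V X \<Longrightarrow> vector_field_on A V Y \<Longrightarrow> vector_field_on A V Z \<Longrightarrow>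
    smooth_fun_on A V (\<lambda>p. \<omega> p (X p) (Y p) (Z p))"
  using three unfolding three_form_def by blast

text \<open>Polarisation: evaluate the form on the sum of the two vectors in both slots.\<close>

lemma form_alt12:
  assumes u: "u \<in> tangent_space A q" and v: "v \<in> tangent_space A q" and w: "w \<in> tangent_space A q"
  shows "\<omega> q u v w = - \<omega> q v u w"
proof -
  let ?s = "\<lambda>f. 1 * u f + 1 * v f"
  have s: "?s \<in> tangent_space A q" by (rule tangent_comb[OF u v])
  have "0 = \<omega> q ?s ?s w" by (rule form_zero(1)[OF s w, symmetric])
  also have "\<dots> = 1 * \<omega> q u ?s w + 1 * \<omega> q v ?s w"
    by (rule linear_at_comb[OF form_lin1[OF s w] u v])
  also have "\<omega> q u ?s w = 1 * \<omega> q u u w + 1 * \<omega> q u v w"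
    by (rule linear_at_comb[OF form_lin2[OF u w] u v])
  also have "\<omega> q v ?s w = 1 * \<omega> q v u w + 1 * \<omega> q v v w"
    by (rule linear_at_comb[OF form_lin2[OF v w] u v])
  finally show ?thesis by (simp add: form_zero u v w)
qed

lemma form_alt23:
  assumes u: "u \<in> tangent_space A q" and v: "v \<in> tangent_space A q" and w: "w \<in> tangent_space A q"
  shows "\<omega> q w u v = - \<omega> q w v u"
proof -
  let ?s = "\<lambda>f. 1 * u f + 1 * v f"
  have s: "?s \<in> tangent_space A q" by (rule tangent_comb[OF u v])
  have "0 = \<omega> q w ?s ?s" by (rule form_zero(2)[OF s w, symmetric])
  also have "\<dots> = 1 * \<omega> q w u ?s + 1 * \<omega> q w v ?s"
    by (rule linear_at_comb[OF form_lin2[OF w s] u v])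
  also have "\<omega> q w u ?s = 1 * \<omega> q w u u + 1 * \<omega> q w u v"
    by (rule linear_at_comb[OF form_lin3[OF w u] u v])
  also have "\<omega> q w v ?s = 1 * \<omega> q w v u + 1 * \<omega> q w v v"
    by (rule linear_at_comb[OF form_lin3[OF w v] u v])
  finally show ?thesis by (simp add: form_zero u v w)
qed

definition ww :: "7 \<Rightarrow> 7 \<Rightarrow> 7 \<Rightarrow> 'a \<Rightarrow> real" where "ww i j k q = \<omega> q (e i q) (e j q) (e k q)"

abbreviation (input) "wt q \<equiv> (\<lambda>i j k. ww i j k q)"

definition tau :: "7 \<Rightarrow> 7 \<Rightarrow> 'a \<Rightarrow> real" where "tau i j q = codiff3 D e \<omega> (e i) (e j) q"

definition Gt :: "7 \<Rightarrow> 7 \<Rightarrow> 7 \<Rightarrow> 'a \<Rightarrow> real" where "Gt i j k q = g q (D' (e i) (e j) q) (e k q)"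

definition AA :: "7 \<Rightarrow> 7 \<Rightarrow> 7 \<Rightarrow> 'a \<Rightarrow> real" where
  "AA i j k q = -1/6 * (\<Sum>l\<in>UNIV. tau i l q * ww l j k q)"

lemma ww_smooth: "smooth_fun_on A U (ww i j k)"
  unfolding ww_def[abs_def] by (intro form_smooth e_vf)

text \<open>\<open>Q\<close> holds the values of an adapted coframe on the frame \<open>e\<close>.
  It is orthogonal because the induced metric makes the coframe orthonormal, so near
  \<open>q\<close> the components of the form run through one orthogonal orbit; smoothness of
  \<open>Q\<close> allows differentiation along it.\<close>

lemma adapted:
  assumes "q \<in> U"
  obtains V Q where "open V" "q \<in> V" "V \<subseteq> U" "\<And>a i. smooth_fun_on A V (Q a i)"
    "\<And>r i j k. r \<in> V \<Longrightarrow> ww i j k r = g2_model (\<lambda>a i. Q a i r) i j k"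
    "\<And>r i j. r \<in> V \<Longrightarrow> (\<Sum>a\<in>UNIV. Q a i r * Q a j r) = kd i j"
proof -
  obtain W \<theta> where W: "q \<in> W" "adapted_coframe A \<omega> W \<theta>"
    using g2 unfolding g2_structure_def by blast
  define V where "V = U \<inter> W"
  define Q where "Q a i r = \<theta> a r (e i r)" for a i r
  have of: "one_form_on A W (\<theta> a)" for a
    using W(2) unfolding adapted_coframe_def local_coframe_def by blast
  then have "open W" unfolding one_form_on_def by blast
  then have V: "open V" "q \<in> V" "V \<subseteq> U" "V \<subseteq> W" using U_open assms W(1) by (auto simp: V_def)
  have "smooth_fun_on A V (Q a i)" for a i
    using of[of a] vf_subset[OF e_vf V(1,3)] V(4) unfolding one_form_on_def Q_def[abs_def] by blast
  moreover have "ww i j k r = g2_model (\<lambda>a i. Q a i r) i j k" if r: "r \<in> V" for i j k r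
  proof -
    have "r \<in> W" "r \<in> U" using r V by blast+
    then have "ww i j k r = g2_model (\<lambda>a. \<theta> a r) (e i r) (e j r) (e k r)"
      using W(2) e_tangent unfolding adapted_coframe_def ww_def by blast
    then show ?thesis by (simp add: g2_model_def wedge3_def Q_def)
  qed
  moreover have "(\<Sum>a\<in>UNIV. Q a i r * Q a j r) = kd i j" if r: "r \<in> V" for i j r
  proof -
    have "r \<in> W" "r \<in> U" using r V by blast+
    then have "g r (e i r) (e j r) = (\<Sum>a\<in>UNIV. \<theta> a r (e i r) * \<theta> a r (e j r))"
      using induced W(2) e_tangent unfolding induced_metric_def by blast
    then show ?thesis using e_on[OF \<open>r \<in> U\<close>] by (simp add: Q_def kd_def)
  qed
  ultimately show ?thesis using that V(1-3) by blast
qed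

lemma ww_tensor:
  assumes "q \<in> U"
  shows "g2_tensor (wt q)"
proof (rule adapted[OF assms])
  fix V Q assume V: "q \<in> V" "\<And>r i j k. r \<in> V \<Longrightarrow> ww i j k r = g2_model (\<lambda>a i. Q a i r) i j k"
    "\<And>r i j. r \<in> V \<Longrightarrow> (\<Sum>a\<in>UNIV. Q a i r * Q a j r) = kd i j"
  show ?thesis
    using g2_model_orthogonal(2)[of "\<lambda>a i. Q a i q", OF V(3)[OF V(1)]] by (simp add: V(2)[OF V(1)])
qed

lemma ww_deriv:
  assumes q: "q \<in> U"
  obtains S where "\<And>i j. S i j = - S j i" "\<And>b c d. e a q (ww b c d) = act S (wt q) b c d"
proof (rule adapted[OF q])
  fix V Q assume V: "open V" "q \<in> V" "V \<subseteq> U" and sm: "\<And>a i. smooth_fun_on A V (Q a i)"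
    and ww: "\<And>r i j k. r \<in> V \<Longrightarrow> ww i j k r = g2_model (\<lambda>a i. Q a i r) i j k"
    and on: "\<And>r i j. r \<in> V \<Longrightarrow> (\<Sum>a\<in>UNIV. Q a i r * Q a j r) = kd i j"
  define dQ where "dQ x i = e a q (Q x i)" for x i
  note tg = e_tangent[OF q, of a]
  have sa: "smooth_at A q (Q x i)" for x i by (rule smooth_fun_on_at[OF sm V(2)])
  have dzero: "(\<Sum>x\<in>UNIV. Q x i q * dQ x j + dQ x i * Q x j q) = 0" for i j
  proof -
    have "e a q (\<lambda>r. \<Sum>x\<in>UNIV. Q x i r * Q x j r) = e a q (\<lambda>r. kd i j)"
      by (rule tangent_cong[OF tg V(1,2)]) (rule on)
    then show ?thesis
      by (simp add: tangent_const[OF tg] tangent_sum[OF tg] tangent_mult[OF tg] smooth_at_mult sa dQ_def)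
  qed
  have der: "e a q (ww b c d) = (\<Sum>x\<in>UNIV. \<Sum>y\<in>UNIV. \<Sum>z\<in>UNIV.
      (Q x b q * (Q y c q * dQ z d + dQ y c * Q z d q) + dQ x b * (Q y c q * Q z d q)) * g2_model kd x y z)" for b c d
  proof -
    have "e a q (ww b c d) = e a q (\<lambda>r. \<Sum>x\<in>UNIV. \<Sum>y\<in>UNIV. \<Sum>z\<in>UNIV.
         (Q x b r * (Q y c r * Q z d r)) * g2_model kd x y z)"
      by (rule tangent_cong[OF tg V(1,2)], subst ww, assumption, rule g2_model_expand)
    also have "\<dots> = (\<Sum>x\<in>UNIV. \<Sum>y\<in>UNIV. \<Sum>z\<in>UNIV.
      (Q x b q * (Q y c q * dQ z d + dQ y c * Q z d q) + dQ x b * (Q y c q * Q z d q)) * g2_model kd x y z)"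
      by (simp add: tangent_const[OF tg] tangent_sum[OF tg] tangent_mult[OF tg] smooth_at_mult smooth_at_const sa dQ_def)
    finally show ?thesis .
  qed
  have wt: "g2_model (\<lambda>a i. Q a i q) = wt q" by (intro ext) (simp add: ww[OF V(2)])
  show thesis
  proof (rule g2_model_derivative[of "\<lambda>a i. Q a i q" dQ, OF on[OF V(2)] dzero])
    fix S assume S: "\<And>i j. S i j = - S j i" "\<And>b c d. (\<Sum>x\<in>UNIV. \<Sum>y\<in>UNIV. \<Sum>z\<in>UNIV.
      (Q x b q * (Q y c q * dQ z d + dQ y c * Q z d q) + dQ x b * (Q y c q * Q z d q)) * g2_model kd x y z)
        = act S (g2_model (\<lambda>a i. Q a i q)) b c d"
    show thesis
      by (rule that[of S]) (rule S(1), simp only: der S(2) wt)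
  qed
qed

lemma cov_deriv3_frame:
  assumes q: "q \<in> U"
  shows "cov_deriv3 D \<omega> (e a) (e b) (e c) (e d) q = e a q (ww b c d) - act (\<lambda>i j. Gam a i j q) (wt q) b c d"
proof -
  note t = e_tangent[OF q] and dt = D_tangent[OF e_vf e_vf q]
  show ?thesis
    unfolding cov_deriv3_def act_def Gam_def ww_def[abs_def]
    using linear_expand[OF q dt form_lin1[OF t t], of a b c d] linear_expand[OF q dt form_lin2[OF t t], of b a c d]
      linear_expand[OF q dt form_lin3[OF t t], of b c a d] by simp
qed

text \<open>For a torsion-free connection the alternation of the covariant derivative is the
  exterior derivative.\<close>

lemma closed_frame:
  assumes q: "q \<in> U"
  defines "N a b c d \<equiv> cov_deriv3 D \<omega> (e a) (e b) (e c) (e d) q"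
  shows "N a b c d - N b a c d + N c a b d - N d a b c = 0"
proof -
  note t = e_tangent[OF q] and dt = D_tangent[OF e_vf e_vf q]
  have lie: "\<omega> q (lie_bracket A (e i) (e j) q) (e k q) (e l q)
     = \<omega> q (D (e i) (e j) q) (e k q) (e l q) - \<omega> q (D (e j) (e i) q) (e k q) (e l q)" for i j k l
  proof -
    have "lie_bracket A (e i) (e j) q = (\<lambda>f. 1 * D (e i) (e j) q f + -1 * D (e j) (e i) q f)"
      using torsion[OF e_vf e_vf q, of i j] by (simp add: vf_diff_def)
    then show ?thesis
      by (simp only: linear_at_comb[OF form_lin1[OF t t] dt dt])
  qed
  have "ext_deriv3 A \<omega> (e a) (e b) (e c) (e d) q = 0"
    using closed e_vf q unfolding closed_form3_def by blast
  moreover have "\<omega> q (e k q) (D (e i) (e j) q) (e l q) = - \<omega> q (D (e i) (e j) q) (e k q) (e l q)"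
     "\<omega> q (e k q) (e l q) (D (e i) (e j) q) = \<omega> q (D (e i) (e j) q) (e k q) (e l q)" for i j k l
    using form_alt12[OF t dt t, of k i j l] form_alt23[OF t dt t, of k l i j] by auto
  ultimately show ?thesis
    unfolding N_def cov_deriv3_def ext_deriv3_def lie by simp
qed

text \<open>By \<open>ww_deriv\<close> the frame derivative of the form is the action of a skew
  matrix, and so is the covariant derivative, as \<open>Gam\<close> is skew. This supplies the
  hypotheses of \<open>closed_torsion\<close>; its third conclusion becomes parallelism for
  \<open>Gam + AA\<close>.\<close>

lemma tau_props:
  assumes q: "q \<in> U"
  shows "tau i j q = - tau j i q" and "(\<Sum>k\<in>UNIV. \<Sum>l\<in>UNIV. tau k l q * ww k l m q) = 0"
    and "e a q (ww b c d) = act (\<lambda>i j. Gam a i j q + AA a i j q) (wt q) b c d"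
proof -
  interpret w: g2_tensor "wt q" by (rule ww_tensor[OF q])
  define N where "N a b c d = cov_deriv3 D \<omega> (e a) (e b) (e c) (e d) q" for a b c d
  have "\<exists>S. (\<forall>i j. S i j = - S j i) \<and> (\<forall>b c d. e a q (ww b c d) = act S (wt q) b c d)" for a
    by (rule ww_deriv[OF q, of a]) blast
  then obtain S where S: "\<And>a i j. S a i j = - S a j i" "\<And>a b c d. e a q (ww b c d) = act (S a) (wt q) b c d"
    by metis
  have N: "N a b c d = act (\<lambda>i j. S a i j - Gam a i j q) (wt q) b c d" for a b c d
    unfolding N_def cov_deriv3_frame[OF q] S(2) act_diff ..
  have anti: "S a i j - Gam a i j q = - (S a j i - Gam a j i q)" for a i j
    using S(1)[of a i j] Gam_antisym[OF q, of a i j] by simp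
  have cl: "N a b c d - N b a c d + N c a b d - N d a b c = 0" for a b c d
    unfolding N_def by (rule closed_frame[OF q])
  have t: "tau c d q = - (\<Sum>a\<in>UNIV. N a a c d)" for c d
    by (simp add: tau_def codiff3_def N_def)
  note ct = w.closed_torsion[of N "\<lambda>a i j. S a i j - Gam a i j q" "\<lambda>i j. tau i j q", OF N anti cl t]
  show "tau i j q = - tau j i q" by (rule ct(1))
  show "(\<Sum>k\<in>UNIV. \<Sum>l\<in>UNIV. tau k l q * ww k l m q) = 0" by (rule ct(2))
  have "N a b c d = act (\<lambda>i j. AA a i j q) (wt q) b c d"
    unfolding AA_def by (rule ct(3))
  then show "e a q (ww b c d) = act (\<lambda>i j. Gam a i j q + AA a i j q) (wt q) b c d"
    unfolding act_add using cov_deriv3_frame[OF q, of a b c d] by (simp add: N_def)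
qed

text \<open>On \<open>U\<close> the frame formula writes \<open>tau\<close> through smooth functions
  and their frame derivatives. This is what permits differentiating \<open>tau\<close>
  itself.\<close>

lemma tau_smooth: "smooth_fun_on A U (tau i j)"
proof -
  have "smooth_fun_on A U (\<lambda>q. - (\<Sum>k\<in>UNIV. e k q (ww k i j) - act (\<lambda>x y. Gam k x y q) (wt q) k i j))"
    unfolding act_def
    by (intro smooth_fun_on_uminus smooth_fun_on_sum smooth_fun_on_diff smooth_fun_on_add smooth_fun_on_mult
        U_open e_smooth ww_smooth Gam_smooth)
  then show ?thesis
    by (subst smooth_fun_on_cong[of U "tau i j"]) (auto simp: tau_def codiff3_def cov_deriv3_frame)
qed

lemma AA_smooth: "smooth_fun_on A U (AA i j k)"
  unfolding AA_def[abs_def]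
  by (intro smooth_fun_on_sum smooth_fun_on_mult smooth_fun_on_const U_open tau_smooth ww_smooth)

section \<open>The canonical connection and its curvature\<close>

lemma D'_affine: "affine_connection A D'"
  using canonical unfolding canonical_connection_def by blast

lemma D'_eq:
  assumes "vector_field_on A U Y" "vector_field_on A U Z" "q \<in> U"
  shows "g q (D' (e i) Y q) (Z q) = g q (D (e i) Y q) (Z q) - 1/6 * (\<Sum>l\<in>UNIV. tau i l q * \<omega> q (e l q) (Y q) (Z q))"
  using canonical frame e_vf[of i] assms unfolding canonical_connection_def tau_def by blast

lemma Gt_eq: "q \<in> U \<Longrightarrow> Gt i j k q = Gam i j k q + AA i j k q"
  using D'_eq[OF e_vf e_vf, of q i j k] by (simp add: Gt_def Gam_def AA_def ww_def)

lemma D'_vf: "vector_field_on A U X \<Longrightarrow> vector_field_on A U Y \<Longrightarrow> vector_field_on A U (D' X Y)"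
proof -
  interpret affine_manifold A D' by unfold_locales (rule D'_affine)
  show "vector_field_on A U X \<Longrightarrow> vector_field_on A U Y \<Longrightarrow> vector_field_on A U (D' X Y)" by (rule D_vf)
qed

text \<open>The correction term is skew in \<open>Y\<close> and \<open>Z\<close>, so it cancels from
  the derivative of the metric.\<close>

lemma D'_compat:
  assumes Y: "vector_field_on A U Y" and Z: "vector_field_on A U Z" and q: "q \<in> U"
  shows "e i q (\<lambda>r. g r (Y r) (Z r)) = g q (D' (e i) Y q) (Z q) + g q (Y q) (D' (e i) Z q)"
proof -
  have "\<omega> q (e l q) (Z q) (Y q) = - \<omega> q (e l q) (Y q) (Z q)" for l
    by (rule form_alt23) (intro vf_tangent[OF _ q] Y Z e_vf)+
  then have "g q (D' (e i) Z q) (Y q) = g q (D (e i) Z q) (Y q) + 1/6 * (\<Sum>l\<in>UNIV. tau i l q * \<omega> q (e l q) (Y q) (Z q))"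
    using D'_eq[OF Z Y q, of i] by (simp add: sum_negf)
  moreover have "g q (D' (e i) Z q) (Y q) = g q (Y q) (D' (e i) Z q)" "g q (D (e i) Z q) (Y q) = g q (Y q) (D (e i) Z q)"
    by (intro g_sym vf_tangent[OF _ q] D'_vf D_vf e_vf Y Z)+
  ultimately show ?thesis
    using compat[OF Y Z q, of i] D'_eq[OF Y Z q, of i] by simp
qed

sublocale can: metric_frame A D' g U e
  by unfold_locales (rule D'_affine riem frame D'_compat bracket; assumption?)+

lemma can_Gam: "can.Gam = Gt"
  by (simp add: can.Gam_def Gt_def fun_eq_iff)

lemma parallel: "q \<in> U \<Longrightarrow> e a q (ww b c d) = act (\<lambda>i j. Gt a i j q) (wt q) b c d"
  using tau_props(3) by (simp add: Gt_eq)

text \<open>The holonomy argument: differentiating \<open>parallel\<close> a second time and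
  alternating shows that the curvature matrix annihilates the form, and
  \<open>g2_tensor_zero\<close> places it in the Lie algebra of G2.\<close>

lemma can_curvature_g2:
  assumes q: "q \<in> U"
  defines "R \<equiv> frame_curv (\<lambda>s i j k. e s q (Gt i j k)) (\<lambda>i j k. Gt i j k q) (\<lambda>i j k. cc i j k q)"
  shows "(\<Sum>j\<in>UNIV. \<Sum>k\<in>UNIV. R s i j k * ww j k m q) = 0"
proof (rule g2_tensor_zero[OF ww_tensor[OF q]])
  note tg = e_tangent[OF q]
  have GS: "smooth_fun_on A U (Gt i j k)" for i j k using can.Gam_smooth unfolding can_Gam .
  have Gs: "smooth_at A q (Gt i j k)" for i j k by (rule smooth_fun_on_at[OF GS q])
  have ws: "smooth_at A q (ww i j k)" for i j k by (rule smooth_fun_on_at[OF ww_smooth q])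
  have anti: "Gt i j k r = - Gt i k j r" if "r \<in> U" for i j k r
    using can.Gam_antisym[OF that] unfolding can_Gam .
  have danti: "e s q (Gt i j k) = - e s q (Gt i k j)" for s i j k
  proof -
    have "e s q (Gt i j k) = e s q (\<lambda>r. - Gt i k j r)"
      by (rule tangent_cong[OF tg U_open q]) (rule anti)
    also have "\<dots> = - e s q (Gt i k j)" by (rule tangent_uminus[OF tg Gs])
    finally show ?thesis .
  qed
  show "R s i j k = - R s i k j" for j k
    unfolding R_def by (rule frame_curv_antisym) (rule anti[OF q], rule danti)
  fix b c d
  have second: "e s q (\<lambda>r. e i r (ww b c d)) = act (\<lambda>x y. e s q (Gt i x y)) (wt q) b c d
      + act (\<lambda>x y. Gt i x y q) (act (\<lambda>x y. Gt s x y q) (wt q)) b c d" for s i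
  proof -
    have "e s q (\<lambda>r. e i r (ww b c d)) = e s q (\<lambda>r. act (\<lambda>x y. Gt i x y r) (wt r) b c d)"
      by (rule tangent_cong[OF tg U_open q]) (rule parallel)
    also have "\<dots> = act (\<lambda>x y. e s q (Gt i x y)) (wt q) b c d
      + act (\<lambda>x y. Gt i x y q) (\<lambda>x y z. e s q (ww x y z)) b c d"
      unfolding act_def
      by (simp add: tangent_add[OF tg] tangent_sum[OF tg] tangent_mult[OF tg] smooth_at_add smooth_at_mult Gs ws sum.distrib)
    finally show ?thesis by (simp add: parallel[OF q])
  qed
  have "e s q (\<lambda>r. e i r (ww b c d)) - e i q (\<lambda>r. e s r (ww b c d))
     = act (\<lambda>x y. \<Sum>l\<in>UNIV. cc s i l q * Gt l x y q) (wt q) b c d"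
    unfolding commutator[OF ww_smooth q] parallel[OF q] act_sum ..
  moreover have "act (R s i) (wt q) b c d = act (\<lambda>x y. e s q (Gt i x y)) (wt q) b c d - act (\<lambda>x y. e i q (Gt s x y)) (wt q) b c d
     + act (\<lambda>x y. (\<Sum>l\<in>UNIV. Gt i x l q * Gt s l y q) - (\<Sum>l\<in>UNIV. Gt s x l q * Gt i l y q)) (wt q) b c d
     - act (\<lambda>x y. \<Sum>l\<in>UNIV. cc s i l q * Gt l x y q) (wt q) b c d"
    unfolding act_diff[symmetric] act_add[symmetric] R_def frame_curv_def[abs_def] by (simp add: algebra_simps)
  ultimately show "act (R s i) (wt q) b c d = 0"
    unfolding second act_commutator[symmetric] by simp
qed

lemma ricci_frame:
  assumes q: "q \<in> U"
  shows "ricci_comp A g D' e i j q = 2/3 * ricci_comp A g D e i j q"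
proof -
  interpret w: g2_tensor "wt q" by (rule ww_tensor[OF q])
  note tg = e_tangent[OF q]
  \<comment> \<open>The canonical covariant derivative of \<open>tau\<close>. Differentiating the
    contraction of \<open>tau\<close> with the parallel form keeps it in the Lie algebra of G2,
    which is \<open>T14\<close>.\<close>
  define T where "T s i j = e s q (tau i j) - (\<Sum>n\<in>UNIV. Gt s i n q * tau n j q) - (\<Sum>n\<in>UNIV. Gt s j n q * tau i n q)" for s i j
  have ts: "smooth_at A q (tau i j)" for i j by (rule smooth_fun_on_at[OF tau_smooth q])
  have ws: "smooth_at A q (ww i j k)" for i j k by (rule smooth_fun_on_at[OF ww_smooth q])
  have GS: "smooth_fun_on A U (Gt i j k)" for i j k using can.Gam_smooth unfolding can_Gam .
  have Gs: "smooth_at A q (Gt i j k)" for i j k by (rule smooth_fun_on_at[OF GS q])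
  have As: "smooth_at A q (AA i j k)" for i j k by (rule smooth_fun_on_at[OF AA_smooth q])
  have anti: "Gt i j k q = - Gt i k j q" for i j k
    using can.Gam_antisym[OF q] unfolding can_Gam .
  have T14: "(\<Sum>k\<in>UNIV. \<Sum>l\<in>UNIV. T s k l * ww k l m q) = 0" for s m
    unfolding T_def
  proof (rule cov_deriv_contract[where w = "wt q"])
    show "Gt s i j q = - Gt s j i q" for i j by (rule anti)
    show "(\<Sum>k\<in>UNIV. \<Sum>l\<in>UNIV. tau k l q * ww k l m q) = 0" for m by (rule tau_props(2)[OF q])
    have "e s q (\<lambda>r. \<Sum>k\<in>UNIV. \<Sum>l\<in>UNIV. tau k l r * ww k l m r) = e s q (\<lambda>r. 0)"
      by (rule tangent_cong[OF tg U_open q]) (rule tau_props(2))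
    then show "(\<Sum>k\<in>UNIV. \<Sum>l\<in>UNIV. e s q (tau k l) * ww k l m q
        + tau k l q * act (\<lambda>i j. Gt s i j q) (wt q) k l m) = 0"
      by (simp add: tangent_const[OF tg] tangent_sum[OF tg] tangent_mult[OF tg] smooth_at_mult ts ws
          parallel[OF q] add.commute)
  qed
  define R where "R = frame_curv (\<lambda>s i j k. e s q (Gam i j k)) (\<lambda>i j k. Gam i j k q) (\<lambda>i j k. cc i j k q)"
  define Rt where "Rt = frame_curv (\<lambda>s i j k. e s q (Gt i j k)) (\<lambda>i j k. Gt i j k q) (\<lambda>i j k. cc i j k q)"
  have RC: "curv_comp A g D e s i j k q = R s i j k" for s i j k
    using curv_comp_frame[OF q, of s i j k] by (simp only: R_def)
  have RtC: "curv_comp A g D' e s i j k q = Rt s i j k" for s i j k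
    using can.curv_comp_frame[OF q, of s i j k] by (simp only: Rt_def can_Gam)
  have dA: "e s q (AA i j k) = -1/6 * (\<Sum>a\<in>UNIV. e s q (tau i a) * ww a j k q + tau i a q * act (\<lambda>x y. Gt s x y q) (wt q) a j k)" for s i j k
  proof -
    have "smooth_at A q (\<lambda>r. \<Sum>a\<in>UNIV. tau i a r * ww a j k r)"
      by (intro tangent_sum(2)[OF tg] smooth_at_mult ts ws)
    from tangent_mult[OF tg smooth_at_const this, of s "-1/6"]
    have "e s q (AA i j k) = -1/6 * e s q (\<lambda>r. \<Sum>a\<in>UNIV. tau i a r * ww a j k r)"
      by (simp only: AA_def[abs_def] tangent_const[OF tg] mult_zero_left add_0_right)
    then show ?thesis
      by (simp add: tangent_sum[OF tg] tangent_mult[OF tg] smooth_at_mult ts ws parallel[OF q] add.commute)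
  qed
  have dG: "e s q (Gam i j k) = e s q (Gt i j k) - e s q (AA i j k)" for s i j k
  proof -
    have "e s q (Gam i j k) = e s q (\<lambda>r. Gt i j k r - AA i j k r)"
      by (rule tangent_cong[OF tg U_open q]) (simp add: Gt_eq)
    then show ?thesis by (simp add: tangent_diff[OF tg] Gs As)
  qed
  \<comment> \<open>Since the form is parallel, this is the canonical covariant derivative of
    \<open>AA\<close>.\<close>
  define X where "X s i j k = -1/6 * (\<Sum>a\<in>UNIV. T s i a * ww a j k q)" for s i j k
  have cov: "X s i j k = e s q (AA i j k) - (\<Sum>l\<in>UNIV. Gt s i l q * AA l j k q)
       - (\<Sum>l\<in>UNIV. Gt s j l q * AA i l k q) - (\<Sum>l\<in>UNIV. Gt s k l q * AA i j l q)" for s i j k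
    unfolding X_def T_def
    by (rule cov_deriv_contract1[where w = "wt q" and G = "\<lambda>x y. Gt s x y q" and A = "\<lambda>i j k. AA i j k q"
          and dA = "\<lambda>i j k. e s q (AA i j k)" and tau = "\<lambda>i j. tau i j q"
          and dt = "\<lambda>i a. e s q (tau i a)" and r = "-1/6", symmetric])
      (rule anti, simp only: AA_def, rule dA)
  have shift: "R s i j k = Rt s i j k - X s i j k + X i s j k
     - (\<Sum>l\<in>UNIV. (AA s i l q - AA i s l q) * AA l j k q)
     + (\<Sum>l\<in>UNIV. AA i j l q * AA s l k q) - (\<Sum>l\<in>UNIV. AA s j l q * AA i l k q)" for s i j k
    unfolding R_def Rt_def
    by (rule frame_curv_shift[where A = "\<lambda>i j k. AA i j k q" and X = X])
      (simp add: Gt_eq[OF q], rule dG, rule anti, rule cc_Gam[OF q], rule cov)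
  have "(\<Sum>s\<in>UNIV. Rt s i j s) = 2/3 * (\<Sum>s\<in>UNIV. R s i j s)"
  proof (rule w.ricci_ratio[where R = R and Rt = Rt and tau = "\<lambda>i j. tau i j q" and T = T and A = "\<lambda>i j k. AA i j k q"])
    show "tau i j q = - tau j i q" for i j by (rule tau_props(1)[OF q])
    show "(\<Sum>k\<in>UNIV. \<Sum>l\<in>UNIV. tau k l q * ww k l m q) = 0" for m by (rule tau_props(2)[OF q])
    show "(\<Sum>k\<in>UNIV. \<Sum>l\<in>UNIV. T i k l * ww k l m q) = 0" for i m by (rule T14)
    show "AA i j k q = -1/6 * (\<Sum>a\<in>UNIV. tau i a q * ww a j k q)" for i j k by (simp only: AA_def)
    show "(\<Sum>j\<in>UNIV. \<Sum>k\<in>UNIV. Rt s i j k * ww j k m q) = 0" for s i m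
      unfolding Rt_def by (rule can_curvature_g2[OF q])
    show "R s i j k = Rt s i j k + 1/6 * (\<Sum>l\<in>UNIV. (T s i l - T i s l) * ww l j k q)
        - (\<Sum>l\<in>UNIV. (AA s i l q - AA i s l q) * AA l j k q)
        + (\<Sum>l\<in>UNIV. AA i j l q * AA s l k q) - (\<Sum>l\<in>UNIV. AA s j l q * AA i l k q)" for s i j k
    proof -
      have "- X s i j k + X i s j k = 1/6 * (\<Sum>l\<in>UNIV. (T s i l - T i s l) * ww l j k q)"
        by (simp add: X_def left_diff_distrib sum_subtractf diff_divide_distrib)
      then show ?thesis using shift[of s i j k] by linarith
    qed
    show "R i j k l = - R j i k l" for i j k l
      unfolding R_def by (rule frame_curv_swap) (simp add: cc_Gam[OF q])
    show "R i j k l = - R i j l k" for i j k l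
      unfolding R_def
    proof (rule frame_curv_antisym)
      show "Gam i j k q = - Gam i k j q" for i j k by (rule Gam_antisym[OF q])
      have Gs': "smooth_at A q (Gam i j k)" for i j k by (rule smooth_fun_on_at[OF Gam_smooth q])
      show "e s q (Gam i j k) = - e s q (Gam i k j)" for s i j k
      proof -
        have "e s q (Gam i j k) = e s q (\<lambda>r. - Gam i k j r)"
          by (rule tangent_cong[OF tg U_open q]) (rule Gam_antisym)
        also have "\<dots> = - e s q (Gam i k j)" by (rule tangent_uminus[OF tg Gs'])
        finally show ?thesis .
      qed
    qed
    show "R i j k l + R j k i l + R k i j l = 0" for i j k l
      using bianchi[OF q, of i j k l] unfolding RC .
  qed
  then show ?thesis by (simp add: ricci_comp_def RC RtC)
qed

end

theorem corollary5p5: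
  fixes A :: "('a::{t2_space, second_countable_topology}) chart set"
    and \<omega> :: "'a form3"
    and g :: "'a \<Rightarrow> 'a tangent \<Rightarrow> 'a tangent \<Rightarrow> real"
    and D D' :: "'a vfield \<Rightarrow> 'a vfield \<Rightarrow> 'a vfield"
  assumes "smooth_atlas A"
    and "g2_structure A \<omega>"
    and "closed_form3 A \<omega>"
    and "induced_metric A \<omega> g"
    and "levi_civita A g D"
    and "canonical_connection A \<omega> g D D'"
  shows "\<forall>U e. orthonormal_frame A g U e \<longrightarrow>
           (\<forall>p\<in>U. \<forall>i j. ricci_comp A g D' e i j p = 2/3 * ricci_comp A g D e i j p)"
proof (intro allI impI ballI)
  fix U e p i j
  assume fr: "orthonormal_frame A g U e" and p: "p \<in> U"
  interpret smooth_manifold A by unfold_locales fact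
  note lc = assms(5)[unfolded levi_civita_def]
  interpret affine_manifold A D by unfold_locales (use lc in blast)
  have vf: "vector_field_on A U (e i)" for i using fr unfolding orthonormal_frame_def by blast
  have tors: "vf_diff (D X Y) (D Y X) p = lie_bracket A X Y p"
    if "vector_field_on A V X" "vector_field_on A V Y" "p \<in> V" for V X Y p
    using lc that by blast
  interpret closed_g2_frame A D g U e \<omega> D'
  proof unfold_locales
    show "riemannian_metric A g" using assms(4) unfolding induced_metric_def by blast
    show "e i q (\<lambda>r. g r (Y r) (Z r)) = g q (D (e i) Y q) (Z q) + g q (Y q) (D (e i) Z q)"
      if "vector_field_on A U Y" "vector_field_on A U Z" "q \<in> U" for Y Z i q
      using lc vf that by blast
    \<comment> \<open>The bracket inherits smoothness from \<open>D\<close>, since torsion-freeness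
      makes it a difference of two covariant derivatives.\<close>
    show "vector_field_on A U (lie_bracket A (e i) (e j))" for i j
      by (rule vf_cong[OF vf_vf_diff[OF D_vf[OF vf vf] D_vf[OF vf vf]] tors[OF vf vf]])
    show "vf_diff (D X Y) (D Y X) p = lie_bracket A X Y p"
      if "vector_field_on A U X" "vector_field_on A U Y" "p \<in> U" for X Y p
      by (rule tors[OF that])
  qed (use fr assms in simp_all)
  show "ricci_comp A g D' e i j p = 2/3 * ricci_comp A g D e i j p"
    by (rule ricci_frame[OF p])
qed

end
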